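(* Let $0\le p\le1$ and $A\in\mathcal W_p(E)$ with representation $A=\sum_{j\in G}M_{b^{(j)}}V_j$. Let $(b,0)$ be the graph over $G$ with $$b(k,\ell):=2\Bigl(\frac{\|b^{(k-\ell)}\|_\infty+\|b^{(\ell-k)}\|_\infty}{2}\Bigr)^p\ (k\neq\ell),\qquad b(k,k):=0,$$ and assume that this graph has subexponential growth and is connected. Let $(W_n)_{n\in\mathbb N}$ be a sequence of finite nonempty subsets of $G$ with $W_n\subseteq W_{n+1}$ for all $n\in\mathbb N$ and $\bigcup_{n\in\mathbb N}W_n=G$. Then, for every $\varepsilon>0$, in the sense of Hausdorff convergence as $n\to\infty$, $$\gamma_\varepsilon^{W_n}(A)\to\mathrm{spec}_\varepsilon A,\quad\gamma_{\varepsilon+\varepsilon_p(W_n,A)}^{W_n}(A)\to\mathrm{spec}_\varepsilon A,\quad\Gamma_\varepsilon^{W_n}(A)\to\mathrm{Spec}_\varepsilon A,\quad\Gamma_{\varepsilon+\varepsilon_p(W_n,A)}^{W_n}(A)\to\mathrm{Spec}_\varepsilon A.$$ Moreover, for $\varepsilon=0$: $\Gamma^{W_n}_{\varepsilon_p(W_n,A)}(A)\to\mathrm{Spec}_0A=\operatorname{Spec}A$.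
   Context: $(G,+)$ is a countable Abelian group with counting measure, $Y$ is a complex Hilbert space, $E:=\ell^2(G,Y)$. $M_b$ is multiplication by $b\in\ell^\infty(G,L(Y))$, $(M_bx)_i=b_ix_i$; $V_j$ is the shift $(V_jx)_i=x_{i-j}$. The Wiener algebra $\mathcal W(E)$ is the set of all $A=\sum_{j\in G}M_{b^{(j)}}V_j$ with $b^{(j)}\in\ell^\infty(G,L(Y))$ and $\sum_{j\in G}\|b^{(j)}\|_\infty<\infty$. For $0\le p\le1$, $\mathcal W_p(E):=\{A\in\mathcal W(E):\sum_{j\in G}\|b^{(j)}\|_\infty^p<\infty\}$. Convention: $a^0:=\lim_{p\to0^+}a^p$ for $a\ge0$, so $0^0=0$. Lower norm: $\nu(B):=\inf\{\|Bx\|:\|x\|=1\}$. $A^*$ is the Banach space adjoint (transpose without conjugation) on $\ell^2(G,Y')$, $Y'$ the dual of $Y$. For $B$ bounded on $E$, $\mu(B):=\min(\nu(B),\nu(B^* ))$; $\mathrm{spec}_\varepsilon A:=\{\lambda\in\mathbb C:\mu(A-\lambda I)<\varepsilon\}$ ($\varepsilon>0$), $\mathrm{Spec}_\varepsilon A:=\{\lambda\in\mathbb C:\mu(A-\lambda I)\le\varepsilon\}$ ($\varepsilon\ge0$), so $\mathrm{Spec}_0A=\operatorname{Spec}A$ is the spectrum. For finite $W\subset G$ and $k\in G$: $P_k$ is multiplication by the characteristic function of $k+W$; $A_k:=AP_k$ and $(A^* )_k:=A^*P_k$ as operators from $\ell^2(k+W,\cdot)$ to $\ell^2(G,\cdot)$;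 $I_k$ is the canonical embedding $\ell^2(k+W,\cdot)\to\ell^2(G,\cdot)$ by zero extension. With $m_W(\lambda):=\inf_{k\in G}\min\{\nu(A_k-\lambda I_k),\nu((A^* )_k-\lambda I_k)\}$, set $\gamma_\varepsilon^W(A):=\{\lambda\in\mathbb C:m_W(\lambda)<\varepsilon\}$ ($\varepsilon>0$) and $\Gamma_\varepsilon^W(A):=\{\lambda\in\mathbb C:m_W(\lambda)\le\varepsilon\}$ ($\varepsilon\ge0$). The penalty term is $$\varepsilon_p(W,A):=\sqrt{\sum_{j\in G\setminus\{0\}}\Bigl(\frac{\|b^{(j)}\|_\infty+\|b^{(-j)}\|_\infty}{2}\Bigr)^{2-p}}\ \sqrt{\min\operatorname{Spec}L_W^{(D)}},$$ where $L_W^{(D)}$ is the Dirichlet Laplacian on $\ell^2(W)$: $(L_W^{(D)}x)_k=\sum_{\ell\in W}b(k,\ell)(x_k-x_\ell)+\bigl(\sum_{\ell\in G\setminus W}b(k,\ell)\bigr)x_k$, $k\in W$. Graph notions: $k\sim\ell$ iff $b(k,\ell)>0$; $d(k,\ell)$ is the combinatorial graph distance, i.e. the least $n\in\mathbb N_0$ such that there are $k=i_0\sim i_1\sim\dots\sim i_n=\ell$ ($\infty$ if there is none); the graph is connected if $d(k,\ell)<\infty$ for all $k,\ell$; $B(k,r):=\{\ell\in G:d(k,\ell)\le r\}$; the graph has subexponential growth if $\liminf_{r\to\infty}\inf_{k\in G}\frac1r\log\frac{\sharp B(k,r)}{\sharp B(k,1)}=0$. Hausdorff convergence: for bounded $S,T\subset\mathbb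 C$, $d_H(S,T):=\max(\sup_{s\in S}\operatorname{dist}(s,T),\sup_{t\in T}\operatorname{dist}(t,S))$, and $S_n\to S$ means $d_H(S_n,S)\to0$ (a pseudometric on bounded sets; the limit is determined only up to closure). *)

theory Defs
  imports "HOL-Analysis.Analysis"
begin

subsection \<open>Complex normed spaces and complex Hilbert spaces\<close>

class complex_normed_space = real_normed_vector +
  fixes scaleC :: "complex \<Rightarrow> 'a \<Rightarrow> 'a" (infixr \<open>*\<^sub>C\<close> 75)
  assumes scaleC_add_right: "c *\<^sub>C (x + y) = c *\<^sub>C x + c *\<^sub>C y"
    and scaleC_add_left: "(c + d) *\<^sub>C x = c *\<^sub>C x + d *\<^sub>C x"
    and scaleC_scaleC: "c *\<^sub>C (d *\<^sub>C x) = (c * d) *\<^sub>C x"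
    and scaleR_eq_scaleC: "r *\<^sub>R x = complex_of_real r *\<^sub>C x"
    and norm_scaleC: "norm (c *\<^sub>C x) = cmod c * norm x"

class complex_hilbert_space = complex_normed_space + complete_space +
  fixes cinner :: "'a \<Rightarrow> 'a \<Rightarrow> complex"
  assumes cinner_add_left: "cinner (x + y) z = cinner x z + cinner y z"
    and cinner_scaleC_left: "cinner (c *\<^sub>C x) y = c * cinner x y"
    and cinner_commute: "cinner x y = cnj (cinner y x)"
    and cinner_self: "cinner x x = complex_of_real ((norm x)\<^sup>2)"

instantiation complex :: complex_hilbert_space
begin

definition scaleC_complex :: "complex \<Rightarrow> complex \<Rightarrow> complex"
  where "scaleC_complex c x = c * x"

definition cinner_complex :: "complex \<Rightarrow> complex \<Rightarrow> complex"
  where "cinner_complex x y = x * cnj y"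

instance
  by standard
    (simp_all add: scaleC_complex_def cinner_complex_def algebra_simps norm_mult
      scaleR_conv_of_real flip: complex_norm_square)

end

lemma bounded_linear_scaleC: "bounded_linear (\<lambda>x :: 'a::complex_normed_space. c *\<^sub>C x)"
proof (rule bounded_linear_intro[where K = "cmod c"])
  show "c *\<^sub>C (r *\<^sub>R x) = r *\<^sub>R c *\<^sub>C x" for r and x :: 'a
    by (simp add: scaleR_eq_scaleC scaleC_scaleC mult.commute)
qed (simp_all add: scaleC_add_right norm_scaleC)

instantiation blinfun :: (real_normed_vector, complex_normed_space) complex_normed_space
begin

definition scaleC_blinfun :: "complex \<Rightarrow> ('a \<Rightarrow>\<^sub>L 'b) \<Rightarrow> ('a \<Rightarrow>\<^sub>L 'b)"
  where "scaleC_blinfun c f = Blinfun (\<lambda>y. c *\<^sub>C blinfun_apply f y)"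

lemma blinfun_apply_scaleC: "blinfun_apply (c *\<^sub>C f) y = c *\<^sub>C blinfun_apply f y"
  for f :: "'a \<Rightarrow>\<^sub>L 'b"
  unfolding scaleC_blinfun_def
  by (subst bounded_linear_Blinfun_apply)
    (auto intro: bounded_linear_compose[OF bounded_linear_scaleC] blinfun.bounded_linear_right)

instance
proof
  fix c d :: complex and r :: real and f g :: "'a \<Rightarrow>\<^sub>L 'b"
  show "c *\<^sub>C (f + g) = c *\<^sub>C f + c *\<^sub>C g"
    by (rule blinfun_eqI) (simp add: blinfun_apply_scaleC blinfun.add_left scaleC_add_right)
  show "(c + d) *\<^sub>C f = c *\<^sub>C f + d *\<^sub>C f"
    by (rule blinfun_eqI) (simp add: blinfun_apply_scaleC blinfun.add_left scaleC_add_left)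
  show "c *\<^sub>C d *\<^sub>C f = (c * d) *\<^sub>C f"
    by (rule blinfun_eqI) (simp add: blinfun_apply_scaleC scaleC_scaleC)
  show "r *\<^sub>R f = complex_of_real r *\<^sub>C f"
    by (rule blinfun_eqI) (simp add: blinfun_apply_scaleC blinfun.scaleR_left scaleR_eq_scaleC)
  have le: "norm (e *\<^sub>C h) \<le> cmod e * norm h" for e and h :: "'a \<Rightarrow>\<^sub>L 'b"
  proof (rule norm_blinfun_bound)
    fix y
    have "cmod e * norm (blinfun_apply h y) \<le> cmod e * (norm h * norm y)"
      by (intro mult_left_mono norm_blinfun) simp
    then show "norm (blinfun_apply (e *\<^sub>C h) y) \<le> cmod e * norm h * norm y"
      by (simp add: blinfun_apply_scaleC norm_scaleC mult.assoc)
  qed simp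
  show "norm (c *\<^sub>C f) = cmod c * norm f"
  proof (cases "c = 0")
    case True
    then show ?thesis using le[of 0 f] by simp
  next
    case False
    have one: "1 *\<^sub>C h = h" for h :: "'a \<Rightarrow>\<^sub>L 'b"
      by (rule blinfun_eqI)
        (metis blinfun_apply_scaleC scaleR_eq_scaleC of_real_1 scaleR_one)
    have comp: "inverse c *\<^sub>C c *\<^sub>C f = (inverse c * c) *\<^sub>C f"
      by (rule blinfun_eqI) (simp add: blinfun_apply_scaleC scaleC_scaleC)
    have "norm f = norm (inverse c *\<^sub>C c *\<^sub>C f)"
      using False one comp by simp
    also have "\<dots> \<le> cmod (inverse c) * norm (c *\<^sub>C f)"
      by (rule le)
    finally have "cmod c * norm f \<le> cmod c * (cmod (inverse c) * norm (c *\<^sub>C f))"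
      by (intro mult_left_mono) auto
    also have "\<dots> = norm (c *\<^sub>C f)"
      using False by (simp add: norm_inverse)
    finally have "cmod c * norm f \<le> norm (c *\<^sub>C f)" .
    with le[of c f] show ?thesis by simp
  qed
qed

end

text \<open>The underlying set of the dual space: the complex-linear elements of the
  type of real-linear bounded functionals; the norms agree.\<close>

definition dual_space :: "('y::complex_normed_space \<Rightarrow>\<^sub>L complex) set"
  where "dual_space = {f. \<forall>c y. blinfun_apply f (c *\<^sub>C y) = c *\<^sub>C blinfun_apply f y}"


subsection \<open>Square-summable functions and operators\<close>

text \<open>The space of square-summable functions on \<open>S\<close> with values in \<open>F\<close> is realised
  by functions on the whole index type that vanish off \<open>S\<close>, so that extension by zero to
  a larger index set is the identity map.\<close>

definition l2 :: "'i set \<Rightarrow> 'v::real_normed_vector set \<Rightarrow> ('i \<Rightarrow> 'v) set"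
  where "l2 S F = {x. (\<forall>i\<in>S. x i \<in> F) \<and> (\<forall>i. i \<notin> S \<longrightarrow> x i = 0)
                     \<and> (\<lambda>i. (norm (x i))\<^sup>2) summable_on UNIV}"

definition l2norm :: "('i \<Rightarrow> 'v::real_normed_vector) \<Rightarrow> real"
  where "l2norm x = sqrt (\<Sum>\<^sub>\<infinity>i. (norm (x i))\<^sup>2)"

text \<open>Operators are functions whose values matter only on their domain \<open>D\<close>.\<close>

definition bounded_operators ::
    "('i \<Rightarrow> 'v::complex_normed_space) set \<Rightarrow> ('k \<Rightarrow> 'w::complex_normed_space) set
      \<Rightarrow> (('i \<Rightarrow> 'v) \<Rightarrow> 'k \<Rightarrow> 'w) set"
  where "bounded_operators D D' = {B.
      (\<forall>x\<in>D. B x \<in> D')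
    \<and> (\<forall>x\<in>D. \<forall>y\<in>D. B (\<lambda>i. x i + y i) = (\<lambda>i. B x i + B y i))
    \<and> (\<forall>c. \<forall>x\<in>D. B (\<lambda>i. c *\<^sub>C x i) = (\<lambda>i. c *\<^sub>C B x i))
    \<and> (\<exists>K. \<forall>x\<in>D. l2norm (B x) \<le> K * l2norm x)}"

definition op_norm ::
    "('i \<Rightarrow> 'v::complex_normed_space) set
      \<Rightarrow> (('i \<Rightarrow> 'v) \<Rightarrow> 'k \<Rightarrow> 'w::complex_normed_space) \<Rightarrow> ennreal"
  where "op_norm D B = (SUP x\<in>{x\<in>D. l2norm x \<le> 1}. ennreal (l2norm (B x)))"

text \<open>With values in \<^typ>\<open>ennreal\<close>, the lower norm on the zero space is the infimum of the
  empty set, \<open>\<infinity>\<close>.\<close>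

definition lower_norm ::
    "('i \<Rightarrow> 'v::complex_normed_space) set
      \<Rightarrow> (('i \<Rightarrow> 'v) \<Rightarrow> 'k \<Rightarrow> 'w::complex_normed_space) \<Rightarrow> ennreal"
  where "lower_norm D B = (INF x\<in>{x\<in>D. l2norm x = 1}. ennreal (l2norm (B x)))"

definition minus_scalar ::
    "(('i \<Rightarrow> 'v) \<Rightarrow> 'i \<Rightarrow> 'v) \<Rightarrow> complex \<Rightarrow> ('i \<Rightarrow> 'v::complex_normed_space) \<Rightarrow> 'i \<Rightarrow> 'v"
  where "minus_scalar B z x = (\<lambda>i. B x i - z *\<^sub>C x i)"

definition spectrum ::
    "('i \<Rightarrow> 'v::complex_normed_space) set \<Rightarrow> (('i \<Rightarrow> 'v) \<Rightarrow> 'i \<Rightarrow> 'v) \<Rightarrow> complex set"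
  where "spectrum D B = {z. \<not> (\<exists>C \<in> bounded_operators D D.
      \<forall>x\<in>D. C (minus_scalar B z x) = x \<and> minus_scalar B z (C x) = x)}"

abbreviation l2E :: "('g \<Rightarrow> 'y::complex_hilbert_space) set"
  where "l2E \<equiv> l2 UNIV UNIV"

abbreviation l2E' :: "('g \<Rightarrow> ('y::complex_hilbert_space \<Rightarrow>\<^sub>L complex)) set"
  where "l2E' \<equiv> l2 UNIV dual_space"

definition dual_pairing ::
    "('g \<Rightarrow> ('y::complex_normed_space \<Rightarrow>\<^sub>L complex)) \<Rightarrow> ('g \<Rightarrow> 'y) \<Rightarrow> complex"
  where "dual_pairing f x = (\<Sum>\<^sub>\<infinity>i. blinfun_apply (f i) (x i))"

definition adjoint_op ::
    "(('g \<Rightarrow> 'y::complex_hilbert_space) \<Rightarrow> 'g \<Rightarrow> 'y)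
      \<Rightarrow> ('g \<Rightarrow> ('y \<Rightarrow>\<^sub>L complex)) \<Rightarrow> 'g \<Rightarrow> ('y \<Rightarrow>\<^sub>L complex)"
  where "adjoint_op B f =
    (THE g. g \<in> l2E' \<and> (\<forall>x\<in>l2E. dual_pairing g x = dual_pairing f (B x)))"


subsection \<open>The Wiener algebra\<close>

definition mult_op ::
    "('g \<Rightarrow> ('y::complex_hilbert_space \<Rightarrow>\<^sub>L 'y)) \<Rightarrow> ('g \<Rightarrow> 'y) \<Rightarrow> 'g \<Rightarrow> 'y"
  where "mult_op a x = (\<lambda>i. blinfun_apply (a i) (x i))"

definition shift_op :: "'g::ab_group_add \<Rightarrow> ('g \<Rightarrow> 'y) \<Rightarrow> 'g \<Rightarrow> 'y"
  where "shift_op j x = (\<lambda>i. x (i - j))"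

text \<open>Bounded families of bounded complex-linear operators.\<close>

definition linf_ops :: "('g \<Rightarrow> ('y::complex_hilbert_space \<Rightarrow>\<^sub>L 'y)) set"
  where "linf_ops = {a. (\<forall>i c y. blinfun_apply (a i) (c *\<^sub>C y) = c *\<^sub>C blinfun_apply (a i) y)
                      \<and> bdd_above (range (\<lambda>i. norm (a i)))}"

definition supnorm :: "('g \<Rightarrow> 'v::real_normed_vector) \<Rightarrow> real"
  where "supnorm a = (SUP i. norm (a i))"

text \<open>\<open>A = (\<Sum>j. M\<^bsub>b j\<^esub> V\<^sub>j)\<close>, unconditionally in operator norm.\<close>

definition wiener_representation ::
    "(('g::ab_group_add \<Rightarrow> 'y::complex_hilbert_space) \<Rightarrow> 'g \<Rightarrow> 'y)
      \<Rightarrow> ('g \<Rightarrow> 'g \<Rightarrow> ('y \<Rightarrow>\<^sub>L 'y)) \<Rightarrow> bool"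
  where "wiener_representation A b \<longleftrightarrow>
      A \<in> bounded_operators l2E l2E
    \<and> (\<forall>j. b j \<in> linf_ops)
    \<and> (\<lambda>j. supnorm (b j)) summable_on UNIV
    \<and> ((\<lambda>F. op_norm l2E (\<lambda>x i. A x i - (\<Sum>j\<in>F. mult_op (b j) (shift_op j x) i))) \<longlongrightarrow> 0)
        (finite_subsets_at_top UNIV)"

text \<open>Here and below, \<^term>\<open>(0::real) powr 0 = 0\<close> is exactly the convention
  \<open>a\<^sup>0 = lim a\<^sup>p\<close> for \<open>p \<rightarrow> 0+\<close>.\<close>

definition wiener_algebra ::
    "real \<Rightarrow> (('g::ab_group_add \<Rightarrow> 'y::complex_hilbert_space) \<Rightarrow> 'g \<Rightarrow> 'y) set"
  where "wiener_algebra p = {A. \<exists>b. wiener_representation A b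
                                \<and> (\<lambda>j. supnorm (b j) powr p) summable_on UNIV}"


subsection \<open>Pseudospectra and their approximations\<close>

definition mu :: "(('g \<Rightarrow> 'y::complex_hilbert_space) \<Rightarrow> 'g \<Rightarrow> 'y) \<Rightarrow> ennreal"
  where "mu B = min (lower_norm l2E B) (lower_norm l2E' (adjoint_op B))"

definition pseudospec_open ::
    "real \<Rightarrow> (('g \<Rightarrow> 'y::complex_hilbert_space) \<Rightarrow> 'g \<Rightarrow> 'y) \<Rightarrow> complex set"
  where "pseudospec_open \<epsilon> A = {z. mu (minus_scalar A z) < ennreal \<epsilon>}"

definition pseudospec_closed ::
    "real \<Rightarrow> (('g \<Rightarrow> 'y::complex_hilbert_space) \<Rightarrow> 'g \<Rightarrow> 'y) \<Rightarrow> complex set"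
  where "pseudospec_closed \<epsilon> A = {z. mu (minus_scalar A z) \<le> ennreal \<epsilon>}"

definition window_proj :: "'g set \<Rightarrow> ('g \<Rightarrow> 'v::zero) \<Rightarrow> 'g \<Rightarrow> 'v"
  where "window_proj S x = (\<lambda>i. if i \<in> S then x i else 0)"

text \<open>The embedding \<open>I\<^sub>k\<close> is the identity map on \<^term>\<open>l2 ((+) k ` W) F\<close>, so
  \<open>A\<^sub>k - z I\<^sub>k\<close> is the operator \<^term>\<open>minus_scalar (A \<circ> window_proj ((+) k ` W)) z\<close>
  on that domain.\<close>

definition window_mu ::
    "'g::ab_group_add set \<Rightarrow> (('g \<Rightarrow> 'y::complex_hilbert_space) \<Rightarrow> 'g \<Rightarrow> 'y)
      \<Rightarrow> complex \<Rightarrow> ennreal"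
  where "window_mu W A z = (INF k.
    min (lower_norm (l2 ((+) k ` W) UNIV)
           (minus_scalar (A \<circ> window_proj ((+) k ` W)) z))
        (lower_norm (l2 ((+) k ` W) dual_space)
           (minus_scalar (adjoint_op A \<circ> window_proj ((+) k ` W)) z)))"

definition gamma_open ::
    "real \<Rightarrow> 'g::ab_group_add set \<Rightarrow> (('g \<Rightarrow> 'y::complex_hilbert_space) \<Rightarrow> 'g \<Rightarrow> 'y)
      \<Rightarrow> complex set"
  where "gamma_open \<epsilon> W A = {z. window_mu W A z < ennreal \<epsilon>}"

definition Gamma_closed ::
    "real \<Rightarrow> 'g::ab_group_add set \<Rightarrow> (('g \<Rightarrow> 'y::complex_hilbert_space) \<Rightarrow> 'g \<Rightarrow> 'y)
      \<Rightarrow> complex set"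
  where "Gamma_closed \<epsilon> W A = {z. window_mu W A z \<le> ennreal \<epsilon>}"


subsection \<open>Weighted graphs\<close>

text \<open>A graph \<open>(w, 0)\<close> over the index type is given by its edge weights \<open>w\<close>.\<close>

definition graph_dist :: "('g \<Rightarrow> 'g \<Rightarrow> real) \<Rightarrow> 'g \<Rightarrow> 'g \<Rightarrow> enat"
  where "graph_dist w k l = (INF n\<in>{n. (k, l) \<in> {(i, j). w i j > 0} ^^ n}. enat n)"

definition connected_graph :: "('g \<Rightarrow> 'g \<Rightarrow> real) \<Rightarrow> bool"
  where "connected_graph w \<longleftrightarrow> (\<forall>k l. graph_dist w k l < \<infinity>)"

definition graph_ball :: "('g \<Rightarrow> 'g \<Rightarrow> real) \<Rightarrow> 'g \<Rightarrow> real \<Rightarrow> 'g set"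
  where "graph_ball w k r = {l. ereal_of_enat (graph_dist w k l) \<le> ereal r}"

text \<open>\<open>log (\<sharp>S / \<sharp>T)\<close> for cardinalities in \<open>\<nat> \<union> {\<infinity>}\<close>, with the convention
  \<open>\<infinity> / \<infinity> = 1\<close> for balls \<open>T \<subseteq> S\<close> in graphs that are not locally finite (there both sets
  are countably infinite).\<close>

definition log_card_ratio :: "'g set \<Rightarrow> 'g set \<Rightarrow> ereal"
  where "log_card_ratio S T =
    (if infinite T then 0
     else if infinite S then \<infinity>
     else ereal (ln (real (card S) / real (card T))))"

definition subexponential_growth :: "('g \<Rightarrow> 'g \<Rightarrow> real) \<Rightarrow> bool"
  where "subexponential_growth w \<longleftrightarrow>
    Liminf at_top (\<lambda>r::real. INF k.
      ereal (1 / r) * log_card_ratio (graph_ball w k r) (graph_ball w k 1)) = 0"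

definition dirichlet_laplacian ::
    "('g \<Rightarrow> 'g \<Rightarrow> real) \<Rightarrow> 'g set \<Rightarrow> ('g \<Rightarrow> complex) \<Rightarrow> 'g \<Rightarrow> complex"
  where "dirichlet_laplacian w W x = (\<lambda>k.
    if k \<in> W
    then (\<Sum>l\<in>W. complex_of_real (w k l) * (x k - x l))
           + complex_of_real (\<Sum>\<^sub>\<infinity>l\<in>UNIV - W. w k l) * x k
    else 0)"

definition min_spec_dirichlet :: "('g \<Rightarrow> 'g \<Rightarrow> real) \<Rightarrow> 'g set \<Rightarrow> real"
  where "min_spec_dirichlet w W =
    (LEAST r. complex_of_real r \<in> spectrum (l2 W UNIV) (dirichlet_laplacian w W))"

definition coeff_graph ::
    "real \<Rightarrow> ('g::ab_group_add \<Rightarrow> 'g \<Rightarrow> 'v::real_normed_vector) \<Rightarrow> 'g \<Rightarrow> 'g \<Rightarrow> real"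
  where "coeff_graph p b k l =
    (if k = l then 0
     else 2 * ((supnorm (b (k - l)) + supnorm (b (l - k))) / 2) powr p)"

definition penalty ::
    "real \<Rightarrow> 'g set \<Rightarrow> ('g::ab_group_add \<Rightarrow> 'g \<Rightarrow> 'v::real_normed_vector) \<Rightarrow> real"
  where "penalty p W b =
    sqrt (\<Sum>\<^sub>\<infinity>j\<in>UNIV - {0}. ((supnorm (b j) + supnorm (b (- j))) / 2) powr (2 - p))
    * sqrt (min_spec_dirichlet (coeff_graph p b) W)"


subsection \<open>Hausdorff convergence\<close>

definition hausdorff_dist :: "complex set \<Rightarrow> complex set \<Rightarrow> ennreal"
  where "hausdorff_dist S T =
    max (SUP s\<in>S. INF t\<in>T. ennreal (dist s t)) (SUP t\<in>T. INF s\<in>S. ennreal (dist t s))"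

definition hausdorff_converges :: "(nat \<Rightarrow> complex set) \<Rightarrow> complex set \<Rightarrow> bool"
  where "hausdorff_converges S T \<longleftrightarrow>
    (\<forall>n. bounded (S n)) \<and> bounded T \<and> (\<lambda>n. hausdorff_dist (S n) T) \<longlonglongrightarrow> 0"

end

theory Submission
  imports Defs
begin

text \<open>
  Write \<open>\<mu>(z)\<close> for the smaller of the lower norms of \<open>A - z\<close> and its adjoint, and
  \<open>m\<^sub>W(z)\<close> for the infimum of the lower norms of their restrictions to the translates of a window \<open>W\<close>.  Restriction
  can only increase lower norms, so \<open>\<mu> \<le> m\<^sub>W\<close>.  Everything rests on the converse inequality
  \<open>m\<^sub>W \<le> \<mu> + \<epsilon>\<^sub>W\<close> with the penalty \<open>\<epsilon>\<^sub>W\<close> (\<open>window_mu_le\<close>), on \<open>\<epsilon>\<^sub>W \<rightarrow> 0\<close>, and on the fact that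
  the sublevel sets of \<open>\<mu>\<close> vary continuously in the Hausdorff distance.

  For the inequality, cut a vector \<open>x\<close> into the pieces \<open>\<phi>\<^sub>k x\<close>, where \<open>\<phi>\<^sub>k\<close> are the translates
  of a unit vector \<open>\<phi>\<close> supported in \<open>W\<close>.  The sum of \<open>\<parallel>\<phi>\<^sub>k x\<parallel>\<^sup>2\<close> over \<open>k\<close> is
  \<open>\<parallel>x\<parallel>\<^sup>2\<close>, and \<open>(A - z) \<phi>\<^sub>k x\<close> differs from \<open>\<phi>\<^sub>k (A - z) x\<close> by a commutator, whose norm,
  square-summed over \<open>k\<close>, is at most \<open>\<Sum>\<^sub>j \<parallel>b j\<parallel> D\<^sub>j\<^bsup>1/2\<^esup> \<parallel>x\<parallel>\<close> with
  \<open>D\<^sub>j = \<Sum>\<^sub>i \<bar>\<phi>(i - j) - \<phi>(i)\<bar>\<^sup>2\<close> (\<open>localisation\<close>).  By the Cauchy--Schwarz inequality this is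
  bounded by the Dirichlet energy of \<open>\<phi>\<close> (\<open>commutator_bound\<close>), and for the ground state of
  the Dirichlet Laplacian the bound is exactly the penalty.  Only a triangle inequality is used, so the
  same argument applies to the adjoint, which acts by a series of the same type on families of
  functionals (\<open>adjoint_series\<close>).

  The bottom of the Dirichlet spectrum is the minimum of the energy over unit vectors on the window
  (\<open>min_spec_dirichlet_eq\<close>).  It tends to zero because the weights are summable and translation
  invariant: in an Abelian group the sums of at most \<open>N\<close> copies of given generators grow
  polynomially in \<open>N\<close>, which yields finite sets whose indicator functions have small relative energy
  (\<open>exists_almost_invariant\<close>, \<open>exists_small_energy\<close>), and the windows eventually contain any
  finite set.

  The function \<open>\<mu>\<close> is Lipschitz continuous with bounded sublevel sets, so
  \<open>{\<mu> \<le> \<epsilon> + \<delta>}\<close> shrinks to \<open>{\<mu> \<le> \<epsilon>}\<close> as \<open>\<delta>\<close> decreases to \<open>0\<close>.  For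
  \<open>\<epsilon> > 0\<close> it is also necessary that \<open>{\<mu> < \<epsilon>}\<close> is dense in \<open>{\<mu> \<le> \<epsilon>}\<close>, that is, that
  the norm of the resolvent has no local maximum.  This can fail in Banach spaces; in Hilbert spaces it
  follows from the parallelogram law (\<open>lower_norm_not_locally_minimal\<close>).  For \<open>\<epsilon> = 0\<close> the set
  \<open>{\<mu> = 0}\<close> is the spectrum, because an operator bounded below together with its adjoint is
  invertible (\<open>surj_shifted\<close>, \<open>mu_zero_iff_spectrum\<close>).
\<close>

section \<open>The Banach space of square-summable families\<close>

instance complex_hilbert_space \<subseteq> banach ..

text \<open>As a type, the square-summable families inherit the general theory of Banach spaces, in particular
  absolutely convergent series; families with values in the dual space are a subset of such a type.\<close>

typedef (overloaded) ('i, 'v::real_normed_vector) ell2 =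
    "{x :: 'i \<Rightarrow> 'v. (\<lambda>i. (norm (x i))\<^sup>2) summable_on UNIV}"
  morphisms coord Ell2
  by (rule exI[of _ "\<lambda>_. 0"]) simp

setup_lifting type_definition_ell2

lemma L2_set_le_l2norm:
  assumes "(\<lambda>i. (norm (x i))\<^sup>2) summable_on UNIV" "finite F"
  shows "L2_set (\<lambda>i. norm (x i)) F \<le> l2norm x"
  unfolding L2_set_def l2norm_def
  by (rule real_sqrt_le_mono, rule finite_sum_le_infsum) (use assms in auto)

text \<open>A norm bound can be tested on finite sets of coordinates, which transfers the inequalities for
  finite sums of squares to families.\<close>

lemma l2norm_leI:
  assumes "\<And>F. finite F \<Longrightarrow> L2_set (\<lambda>i. norm (x i)) F \<le> c"
  shows "(\<lambda>i. (norm (x i))\<^sup>2) summable_on UNIV" "l2norm x \<le> c"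
proof -
  have c: "0 \<le> c" using assms[of "{}"] by simp
  have le: "(\<Sum>i\<in>F. (norm (x i))\<^sup>2) \<le> c\<^sup>2" if "finite F" for F
    using assms[OF that] c
    by (simp add: L2_set_def real_sqrt_le_iff sqrt_le_D)
  show s: "(\<lambda>i. (norm (x i))\<^sup>2) summable_on UNIV"
    by (rule nonneg_bdd_above_summable_on) (auto intro!: bdd_aboveI2[where M="c\<^sup>2"] le)
  have "(\<Sum>\<^sub>\<infinity>i. (norm (x i))\<^sup>2) \<le> c\<^sup>2"
    by (rule infsum_le_finite_sums[OF s]) (use le in auto)
  then show "l2norm x \<le> c"
    unfolding l2norm_def using c real_le_lsqrt by blast
qed

lemma l2norm_nonneg [simp]: "0 \<le> l2norm x"
  by (simp add: l2norm_def infsum_nonneg)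

lemma l2norm_add:
  assumes x: "(\<lambda>i. (norm (x i))\<^sup>2) summable_on UNIV" and y: "(\<lambda>i. (norm (y i))\<^sup>2) summable_on UNIV"
  shows "(\<lambda>i. (norm (x i + y i))\<^sup>2) summable_on UNIV"
    and "l2norm (\<lambda>i. x i + y i) \<le> l2norm x + l2norm y"
proof -
  have "L2_set (\<lambda>i. norm (x i + y i)) F \<le> l2norm x + l2norm y" if "finite F" for F
  proof -
    have "L2_set (\<lambda>i. norm (x i + y i)) F \<le> L2_set (\<lambda>i. norm (x i) + norm (y i)) F"
      by (rule L2_set_mono) (auto intro: norm_triangle_ineq)
    also have "\<dots> \<le> L2_set (\<lambda>i. norm (x i)) F + L2_set (\<lambda>i. norm (y i)) F"
      by (rule L2_set_triangle_ineq)
    also have "\<dots> \<le> l2norm x + l2norm y"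
      using L2_set_le_l2norm[OF x that] L2_set_le_l2norm[OF y that] by simp
    finally show ?thesis .
  qed
  from l2norm_leI[OF this]
  show "(\<lambda>i. (norm (x i + y i))\<^sup>2) summable_on UNIV"
    "l2norm (\<lambda>i. x i + y i) \<le> l2norm x + l2norm y"
    by auto
qed

lemma l2norm_scaleR: "l2norm (\<lambda>i. r *\<^sub>R x i) = \<bar>r\<bar> * l2norm x"
  by (simp add: l2norm_def power_mult_distrib infsum_cmult_right' real_sqrt_mult)

instantiation ell2 :: (type, real_normed_vector) real_normed_vector
begin

lift_definition zero_ell2 :: "('a, 'b) ell2" is "\<lambda>_. 0" by simp
lift_definition plus_ell2 :: "('a, 'b) ell2 \<Rightarrow> ('a, 'b) ell2 \<Rightarrow> ('a, 'b) ell2"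
  is "\<lambda>x y i. x i + y i" by (rule l2norm_add)
lift_definition uminus_ell2 :: "('a, 'b) ell2 \<Rightarrow> ('a, 'b) ell2" is "\<lambda>x i. - x i" by simp
lift_definition minus_ell2 :: "('a, 'b) ell2 \<Rightarrow> ('a, 'b) ell2 \<Rightarrow> ('a, 'b) ell2"
  is "\<lambda>x y i. x i - y i"
  using l2norm_add(1)[of _ "\<lambda>i. - _ i"] by simp
lift_definition scaleR_ell2 :: "real \<Rightarrow> ('a, 'b) ell2 \<Rightarrow> ('a, 'b) ell2" is "\<lambda>r x i. r *\<^sub>R x i"
  by (simp add: power_mult_distrib summable_on_cmult_right)
lift_definition norm_ell2 :: "('a, 'b) ell2 \<Rightarrow> real" is l2norm .

definition dist_ell2 :: "('a, 'b) ell2 \<Rightarrow> ('a, 'b) ell2 \<Rightarrow> real"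
  where "dist_ell2 x y = norm (x - y)"
definition sgn_ell2 :: "('a, 'b) ell2 \<Rightarrow> ('a, 'b) ell2"
  where "sgn_ell2 x = scaleR (inverse (norm x)) x"
definition uniformity_ell2 :: "(('a, 'b) ell2 \<times> ('a, 'b) ell2) filter"
  where "uniformity_ell2 = (INF e\<in>{0<..}. principal {(x, y). dist x y < e})"
definition open_ell2 :: "('a, 'b) ell2 set \<Rightarrow> bool"
  where "open_ell2 U = (\<forall>x\<in>U. \<forall>\<^sub>F (x', y) in uniformity. x' = x \<longrightarrow> y \<in> U)"

instance
proof
  fix x y z :: "('a, 'b) ell2" and r s :: real
  show "dist x y = norm (x - y)" by (rule dist_ell2_def)
  show "sgn x = scaleR (inverse (norm x)) x" by (rule sgn_ell2_def)
  show "uniformity = (INF e\<in>{0<..}. principal {(x, y :: ('a, 'b) ell2). dist x y < e})"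
    by (rule uniformity_ell2_def)
  show "open U = (\<forall>x\<in>U. \<forall>\<^sub>F (x', y) in uniformity. x' = x \<longrightarrow> y \<in> U)"
    for U :: "('a, 'b) ell2 set" by (rule open_ell2_def)
  show "x + y + z = x + (y + z)" by transfer (simp add: add.assoc)
  show "x + y = y + x" by transfer (simp add: add.commute)
  show "0 + x = x" by transfer simp
  show "- x + x = 0" by transfer simp
  show "x - y = x + - y" by transfer simp
  show "r *\<^sub>R (x + y) = r *\<^sub>R x + r *\<^sub>R y" by transfer (simp add: scaleR_add_right)
  show "(r + s) *\<^sub>R x = r *\<^sub>R x + s *\<^sub>R x" by transfer (simp add: scaleR_add_left)
  show "r *\<^sub>R s *\<^sub>R x = (r * s) *\<^sub>R x" by transfer simp
  show "1 *\<^sub>R x = x" by transfer simp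
  show "norm (x + y) \<le> norm x + norm y" by transfer (rule l2norm_add)
  show "norm (r *\<^sub>R x) = \<bar>r\<bar> * norm x" by transfer (rule l2norm_scaleR)
  show "(norm x = 0) = (x = 0)"
  proof transfer
    fix x :: "'a \<Rightarrow> 'b" assume s: "(\<lambda>i. (norm (x i))\<^sup>2) summable_on UNIV"
    show "(l2norm x = 0) = (x = (\<lambda>_. 0))"
    proof
      assume "l2norm x = 0"
      then have "(\<Sum>\<^sub>\<infinity>i. (norm (x i))\<^sup>2) \<le> 0" by (simp add: l2norm_def)
      then have "(norm (x i))\<^sup>2 = 0" for i
        by (rule nonneg_infsum_le_0D[OF _ s]) auto
      then show "x = (\<lambda>_. 0)" by auto
    qed (simp add: l2norm_def)
  qed
qed

end

lemma coord_simps [simp]: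
  "coord 0 i = 0" "coord (x + y) i = coord x i + coord y i" "coord (x - y) i = coord x i - coord y i"
  "coord (- x) i = - coord x i" "coord (r *\<^sub>R x) i = r *\<^sub>R coord x i"
  by (transfer; simp)+

lemma ell2_eqI: "(\<And>i. coord x i = coord y i) \<Longrightarrow> x = y"
  by (metis coord_inject ext)

lemma summable_coord: "(\<lambda>i. (norm (coord x i))\<^sup>2) summable_on UNIV"
  using coord by blast

lemma coord_Ell2: "(\<lambda>i. (norm (x i))\<^sup>2) summable_on UNIV \<Longrightarrow> coord (Ell2 x) = x"
  by (simp add: Ell2_inverse)

lemma norm_ell2: "norm x = l2norm (coord x)"
  by (rule norm_ell2.rep_eq)

lemma norm_Ell2: "(\<lambda>i. (norm (x i))\<^sup>2) summable_on UNIV \<Longrightarrow> norm (Ell2 x) = l2norm x"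
  by (simp add: norm_ell2 coord_Ell2)

lemma norm_ell2_square: "(norm x)\<^sup>2 = (\<Sum>\<^sub>\<infinity>i. (norm (coord x i))\<^sup>2)"
  by (simp add: norm_ell2 l2norm_def infsum_nonneg)

lemma norm_coord_le: "norm (coord x i) \<le> norm x"
  using L2_set_le_l2norm[OF summable_coord, of "{i}" x] by (simp add: norm_ell2)

lemma bounded_linear_coord: "bounded_linear (\<lambda>x. coord x i)"
  by (rule bounded_linear_intro[where K=1]) (simp_all add: norm_coord_le)

text \<open>Families dominated by a known one arise as the terms of the series below.\<close>

lemma norm_ell2_le:
  assumes "\<And>i. norm (x i) \<le> c * norm (coord y i)" "0 \<le> c"
  shows "(\<lambda>i. (norm (x i))\<^sup>2) summable_on UNIV" "l2norm x \<le> c * norm y"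
proof -
  have "L2_set (\<lambda>i. norm (x i)) F \<le> c * norm y" if "finite F" for F
  proof -
    have "L2_set (\<lambda>i. norm (x i)) F \<le> L2_set (\<lambda>i. c * norm (coord y i)) F"
      by (rule L2_set_mono) (use assms in auto)
    also have "\<dots> = c * L2_set (\<lambda>i. norm (coord y i)) F"
      using assms(2) by (simp add: L2_set_right_distrib)
    also have "\<dots> \<le> c * norm y"
      using L2_set_le_l2norm[OF summable_coord that, of y] assms(2)
      by (simp add: mult_left_mono norm_ell2)
    finally show ?thesis .
  qed
  from l2norm_leI[OF this]
  show "(\<lambda>i. (norm (x i))\<^sup>2) summable_on UNIV" "l2norm x \<le> c * norm y" by auto
qed

text \<open>Completeness: a coordinatewise limit inherits the norm bounds on finite sets of
  coordinates.\<close>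

instance ell2 :: (type, banach) banach
proof
  fix X :: "nat \<Rightarrow> ('a, 'b) ell2"
  assume C: "Cauchy X"
  have "Cauchy (\<lambda>n. coord (X n) i)" for i
    by (rule bounded_linear.Cauchy[OF bounded_linear_coord C])
  then have "\<forall>i. \<exists>l. (\<lambda>n. coord (X n) i) \<longlonglongrightarrow> l"
    by (simp add: Cauchy_convergent convergentD)
  then obtain x where x: "\<And>i. (\<lambda>n. coord (X n) i) \<longlonglongrightarrow> x i" by metis
  have bd: "\<exists>N. \<forall>n\<ge>N. \<forall>F. finite F \<longrightarrow> L2_set (\<lambda>i. norm (coord (X n) i - x i)) F \<le> e" if "0 < e" for e
  proof -
    obtain N where N: "\<And>m n. m \<ge> N \<Longrightarrow> n \<ge> N \<Longrightarrow> norm (X m - X n) < e"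
      using CauchyD[OF C \<open>0 < e\<close>] by auto
    have "L2_set (\<lambda>i. norm (coord (X n) i - x i)) F \<le> e" if "n \<ge> N" "finite F" for n F
    proof (rule tendsto_upperbound)
      show "(\<lambda>m. L2_set (\<lambda>i. norm (coord (X n) i - coord (X m) i)) F)
          \<longlonglongrightarrow> L2_set (\<lambda>i. norm (coord (X n) i - x i)) F"
        unfolding L2_set_def by (intro tendsto_intros x)
      show "\<forall>\<^sub>F m in sequentially. L2_set (\<lambda>i. norm (coord (X n) i - coord (X m) i)) F \<le> e"
        using eventually_ge_at_top[of N]
      proof eventually_elim
        case (elim m)
        have "L2_set (\<lambda>i. norm (coord (X n - X m) i)) F \<le> norm (X n - X m)"
          unfolding norm_ell2 by (rule L2_set_le_l2norm[OF summable_coord that(2)])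
        then show ?case using N[OF that(1) elim] by simp
      qed
    qed simp
    then show ?thesis by blast
  qed
  obtain N where N: "\<And>n F. n \<ge> N \<Longrightarrow> finite F \<Longrightarrow> L2_set (\<lambda>i. norm (coord (X n) i - x i)) F \<le> 1"
    using bd[of 1] by auto
  have "(\<lambda>i. (norm (coord (X N) i - x i))\<^sup>2) summable_on UNIV"
    by (rule l2norm_leI(1)) (use N[of N] in auto)
  from l2norm_add(1)[OF summable_coord[of "- X N"] this]
  have sx: "(\<lambda>i. (norm (x i))\<^sup>2) summable_on UNIV" by simp
  have "X \<longlonglongrightarrow> Ell2 x"
  proof (rule LIMSEQ_I)
    fix e :: real assume "0 < e"
    then obtain N where N: "\<And>n F. n \<ge> N \<Longrightarrow> finite F \<Longrightarrow> L2_set (\<lambda>i. norm (coord (X n) i - x i)) F \<le> e/2"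
      using bd[of "e/2"] by auto
    have "norm (X n - Ell2 x) \<le> e/2" if "n \<ge> N" for n
      unfolding norm_ell2 by (rule l2norm_leI(2)) (use N[OF that] in \<open>simp add: coord_Ell2[OF sx]\<close>)
    then have "norm (X n - Ell2 x) < e" if "n \<ge> N" for n
      using that \<open>0 < e\<close> by fastforce
    then show "\<exists>N. \<forall>n\<ge>N. norm (X n - Ell2 x) < e" by blast
  qed
  then show "convergent X" by (rule convergentI)
qed

section \<open>Hilbert space geometry\<close>

lemma cinner_rules:
  fixes x y z :: "'h::complex_hilbert_space"
  shows cinner_add_right: "cinner x (y + z) = cinner x y + cinner x z"
    and cinner_scaleC_right: "cinner x (c *\<^sub>C y) = cnj c * cinner x y"
    and cinner_minus_right: "cinner x (y - z) = cinner x y - cinner x z"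
    and cinner_zero_left: "cinner 0 x = 0"
    and cinner_zero_right: "cinner x 0 = 0"
proof -
  show a: "cinner x (y + z) = cinner x y + cinner x z" for x y z :: 'h
    by (metis cinner_add_left cinner_commute complex_cnj_add)
  show "cinner x (c *\<^sub>C y) = cnj c * cinner x y"
    by (metis cinner_scaleC_left cinner_commute complex_cnj_mult)
  have b: "cinner (x - y) z = cinner x z - cinner y z" for x y z :: 'h
    using cinner_add_left[of "x - y" y z] by simp
  show "cinner x (y - z) = cinner x y - cinner x z"
    using a[of x "y - z" z] by simp
  show "cinner 0 x = 0" for x :: 'h using b[of x x x] by simp
  then show "cinner x 0 = 0" by (metis cinner_commute complex_cnj_zero)
qed

lemma norm_add_square:
  "(norm (x + y))\<^sup>2 = (norm x)\<^sup>2 + (norm y)\<^sup>2 + 2 * Re (cinner x y)" for x :: "'h::complex_hilbert_space"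
proof -
  have "complex_of_real ((norm (x + y))\<^sup>2) = cinner x x + cinner y y + (cinner x y + cinner y x)"
    by (simp only: cinner_self[symmetric] cinner_add_left cinner_add_right ac_simps)
  also have "cinner x y + cinner y x = complex_of_real (2 * Re (cinner x y))"
    by (subst (2) cinner_commute) (simp add: complex_add_cnj)
  finally show ?thesis by (simp only: cinner_self of_real_add[symmetric] of_real_eq_iff)
qed

lemma scaleC_m1: "(-1) *\<^sub>C x = - x" for x :: "'h::complex_normed_space"
  using scaleR_eq_scaleC[of "-1" x] by simp

lemma norm_minus_square:
  "(norm (x - y))\<^sup>2 = (norm x)\<^sup>2 + (norm y)\<^sup>2 - 2 * Re (cinner x y)" for x :: "'h::complex_hilbert_space"
  using norm_add_square[of x "- y"] cinner_minus_right[of x 0 y] by (simp add: cinner_zero_right)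

lemma parallelogram:
  "(norm (x + y))\<^sup>2 + (norm (x - y))\<^sup>2 = 2 * (norm x)\<^sup>2 + 2 * (norm y)\<^sup>2" for x :: "'h::complex_hilbert_space"
  by (simp add: norm_add_square norm_minus_square)

lemma cinner_le: "norm (cinner x y) \<le> norm x * norm y" for x :: "'h::complex_hilbert_space"
proof (cases "y = 0")
  case True then show ?thesis by (simp add: cinner_zero_right)
next
  case False
  define c where "c = cinner x y / complex_of_real ((norm y)\<^sup>2)"
  have "Re (cinner x (c *\<^sub>C y)) = (norm (cinner x y))\<^sup>2 / (norm y)\<^sup>2"
    by (simp add: cinner_scaleC_right c_def cmod_def power2_eq_square field_simps)
  moreover have "(norm (c *\<^sub>C y))\<^sup>2 = (norm (cinner x y))\<^sup>2 / (norm y)\<^sup>2"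
    using False by (simp add: norm_scaleC c_def norm_divide power2_eq_square norm_mult)
  moreover have "0 \<le> (norm (x - c *\<^sub>C y))\<^sup>2" by simp
  ultimately have "(norm (cinner x y))\<^sup>2 / (norm y)\<^sup>2 \<le> (norm x)\<^sup>2"
    unfolding norm_minus_square by linarith
  then have "(norm (cinner x y))\<^sup>2 \<le> (norm x * norm y)\<^sup>2"
    using False by (simp add: pos_divide_le_eq power_mult_distrib)
  then show ?thesis by (rule power2_le_imp_le) simp
qed

instantiation ell2 :: (type, complex_normed_space) complex_normed_space
begin

lift_definition scaleC_ell2 :: "complex \<Rightarrow> ('a, 'b) ell2 \<Rightarrow> ('a, 'b) ell2" is "\<lambda>c x i. c *\<^sub>C x i"
  by (simp add: norm_scaleC power_mult_distrib summable_on_cmult_right)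

instance
proof
  fix x y :: "('a, 'b) ell2" and c d :: complex and r :: real
  show "c *\<^sub>C (x + y) = c *\<^sub>C x + c *\<^sub>C y" by transfer (simp add: scaleC_add_right)
  show "(c + d) *\<^sub>C x = c *\<^sub>C x + d *\<^sub>C x" by transfer (simp add: scaleC_add_left)
  show "c *\<^sub>C d *\<^sub>C x = (c * d) *\<^sub>C x" by transfer (simp add: scaleC_scaleC)
  show "r *\<^sub>R x = complex_of_real r *\<^sub>C x" by transfer (simp add: scaleR_eq_scaleC)
  show "norm (c *\<^sub>C x) = cmod c * norm x"
    by transfer
      (simp add: l2norm_def norm_scaleC power_mult_distrib infsum_cmult_right' real_sqrt_mult)
qed

end

lemma coord_scaleC [simp]: "coord (c *\<^sub>C x) i = c *\<^sub>C coord x i"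
  by transfer simp

lemma summable_cinner_coord:
  "(\<lambda>i. cinner (coord x i) (coord y i)) summable_on UNIV"
proof (rule abs_summable_summable, rule summable_on_comparison_test)
  show "(\<lambda>i. (norm (coord x i))\<^sup>2 + (norm (coord y i))\<^sup>2) summable_on UNIV"
    by (intro summable_on_add summable_coord)
  fix i
  have "norm (cinner (coord x i) (coord y i)) \<le> norm (coord x i) * norm (coord y i)"
    by (rule cinner_le)
  also have "\<dots> \<le> (norm (coord x i))\<^sup>2 + (norm (coord y i))\<^sup>2"
    using sum_squares_bound[of "norm (coord x i)" "norm (coord y i)"]
      mult_nonneg_nonneg[OF norm_ge_zero[of "coord x i"] norm_ge_zero[of "coord y i"]]
    by linarith
  finally show "norm (cinner (coord x i) (coord y i)) \<le> (norm (coord x i))\<^sup>2 + (norm (coord y i))\<^sup>2" .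
qed simp

instantiation ell2 :: (type, complex_hilbert_space) complex_hilbert_space
begin

definition cinner_ell2 :: "('a, 'b) ell2 \<Rightarrow> ('a, 'b) ell2 \<Rightarrow> complex"
  where "cinner_ell2 x y = (\<Sum>\<^sub>\<infinity>i. cinner (coord x i) (coord y i))"

instance
proof
  fix x y z :: "('a, 'b) ell2" and c :: complex
  show "cinner (x + y) z = cinner x z + cinner y z"
    by (simp add: cinner_ell2_def cinner_add_left infsum_add summable_cinner_coord)
  show "cinner (c *\<^sub>C x) y = c * cinner x y"
    by (simp add: cinner_ell2_def cinner_scaleC_left infsum_cmult_right')
  show "cinner x y = cnj (cinner y x)"
    unfolding cinner_ell2_def infsum_cnj[symmetric] by (intro infsum_cong cinner_commute)
  show "cinner x x = complex_of_real ((norm x)\<^sup>2)"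
    unfolding cinner_ell2_def cinner_self norm_ell2_square
    by (rule infsumI, rule has_sum_of_real, rule has_sum_infsum, rule summable_coord)
qed

end

text \<open>The residual of a minimising sequence for the distance to a proper closed subspace converges, by
  the parallelogram law, to a vector orthogonal to the subspace.\<close>

lemma exists_orthogonal:
  fixes S :: "'h::complex_hilbert_space set"
  assumes "closed S" and add: "\<And>x y. x \<in> S \<Longrightarrow> y \<in> S \<Longrightarrow> x + y \<in> S"
    and scale: "\<And>c x. x \<in> S \<Longrightarrow> c *\<^sub>C x \<in> S" and "0 \<in> S" and "u \<notin> S"
  obtains w where "w \<noteq> 0" "\<And>s. s \<in> S \<Longrightarrow> cinner s w = 0"
proof -
  have scaleR: "r *\<^sub>R x \<in> S" if "x \<in> S" for r x using scale that by (simp add: scaleR_eq_scaleC)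
  define d where "d = (INF s\<in>S. (norm (u - s))\<^sup>2)"
  have bb: "bdd_below ((\<lambda>s. (norm (u - s))\<^sup>2) ` S)" by (rule bdd_belowI2[where m=0]) simp
  have d_le: "d \<le> (norm (u - s))\<^sup>2" if "s \<in> S" for s
    unfolding d_def using bb that by (rule cINF_lower)
  have "\<exists>s\<in>S. (norm (u - s))\<^sup>2 < d + 1 / real (Suc n)" for n
    using cInf_lessD[of "(\<lambda>s. (norm (u - s))\<^sup>2) ` S" "d + 1 / real (Suc n)"] \<open>0 \<in> S\<close>
    by (auto simp: d_def)
  then obtain s where s: "\<And>n. s n \<in> S" "\<And>n. (norm (u - s n))\<^sup>2 < d + 1 / real (Suc n)" by metis
  have diff: "(norm (s m - s n))\<^sup>2 \<le> 2 / real (Suc m) + 2 / real (Suc n)" for m n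
  proof -
    let ?m = "(1/2) *\<^sub>R (s m + s n)"
    have "?m \<in> S" using add scaleR s by blast
    then have 1: "d \<le> (norm (u - ?m))\<^sup>2" by (rule d_le)
    have e: "(u - s m) + (u - s n) = 2 *\<^sub>R (u - ?m)"
      by (simp add: algebra_simps scaleR_2)
    have 2: "(norm ((u - s m) + (u - s n)))\<^sup>2 = 4 * (norm (u - ?m))\<^sup>2"
      unfolding e by (simp add: power_mult_distrib)
    show ?thesis
      using parallelogram[of "u - s m" "u - s n"] 1 2 s(2)[of m] s(2)[of n]
      by (simp add: norm_minus_commute[of "s m"])
  qed
  have "Cauchy s"
  proof (rule CauchyI)
    fix e :: real assume e: "0 < e"
    obtain N where N: "4 / e\<^sup>2 < real N" using reals_Archimedean2 by blast
    have "norm (s m - s n) < e" if "m \<ge> N" "n \<ge> N" for m n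
    proof -
      have pos: "0 < real N" using N e by (smt (verit) divide_pos_pos zero_less_power)
      have "2 / real (Suc m) \<le> 2 / real N" "2 / real (Suc n) \<le> 2 / real N"
        using that pos by (auto intro!: divide_left_mono)
      then have "(norm (s m - s n))\<^sup>2 \<le> 4 / real N" using diff[of m n] by simp
      also have "\<dots> < e\<^sup>2" using N e pos by (simp add: field_simps)
      finally show ?thesis using e by (simp add: power2_less_imp_less)
    qed
    then show "\<exists>M. \<forall>m\<ge>M. \<forall>n\<ge>M. norm (s m - s n) < e" by blast
  qed
  then obtain l where l: "s \<longlonglongrightarrow> l" using Cauchy_convergent convergentD by blast
  have lS: "l \<in> S" using \<open>closed S\<close> s(1) l closed_sequentially by blast
  define w where "w = u - l"
  have "(norm w)\<^sup>2 \<le> d"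
  proof (rule LIMSEQ_le)
    show "(\<lambda>n. (norm (u - s n))\<^sup>2) \<longlonglongrightarrow> (norm w)\<^sup>2" unfolding w_def by (intro tendsto_intros l)
    show "(\<lambda>n. d + 1 / real (Suc n)) \<longlonglongrightarrow> d"
      using tendsto_add[OF tendsto_const LIMSEQ_inverse_real_of_nat] by (simp add: inverse_eq_divide)
    show "\<exists>N. \<forall>n\<ge>N. (norm (u - s n))\<^sup>2 \<le> d + 1 / real (Suc n)" using s(2) less_imp_le by blast
  qed
  have orth: "cinner t w = 0" if t: "t \<in> S" for t
  proof -
    \<comment> \<open>Moving from \<open>l\<close> by a multiple of \<open>t\<close> cannot decrease the distance to \<open>u\<close>.\<close>
    define a where "a = cinner w t"
    define T where "T = (norm t)\<^sup>2 + 1"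
    have T: "0 < T" by (simp add: T_def add_nonneg_pos)
    define c where "c = a / complex_of_real T"
    have "l + c *\<^sub>C t \<in> S" using add lS scale t by blast
    then have "d \<le> (norm (u - (l + c *\<^sub>C t)))\<^sup>2" by (rule d_le)
    then have "(norm w)\<^sup>2 \<le> (norm (w - c *\<^sub>C t))\<^sup>2"
      using \<open>(norm w)\<^sup>2 \<le> d\<close> unfolding w_def diff_diff_add by linarith
    then have "2 * Re (cinner w (c *\<^sub>C t)) \<le> (norm (c *\<^sub>C t))\<^sup>2"
      unfolding norm_minus_square by simp
    moreover have "cnj c * a = complex_of_real ((cmod a)\<^sup>2 / T)"
      by (simp add: c_def mult.commute[of "cnj a"] complex_norm_square[symmetric] del: of_real_divide)
         (simp add: complex_norm_square mult.commute)
    then have "Re (cinner w (c *\<^sub>C t)) = (cmod a)\<^sup>2 / T"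
      by (simp add: cinner_scaleC_right a_def del: of_real_divide)
    moreover have "(norm (c *\<^sub>C t))\<^sup>2 = (cmod a)\<^sup>2 / T * ((norm t)\<^sup>2 / T)"
      using T by (simp add: norm_scaleC c_def norm_divide power2_eq_square)
    moreover have "(cmod a)\<^sup>2 / T * ((norm t)\<^sup>2 / T) \<le> (cmod a)\<^sup>2 / T * 1"
      using T by (intro mult_left_mono) (auto simp: T_def)
    ultimately have "(cmod a)\<^sup>2 / T \<le> 0" by simp
    then have "a = 0" using T by (simp add: divide_le_0_iff)
    then show ?thesis by (metis a_def cinner_commute complex_cnj_zero)
  qed
  moreover have "w \<noteq> 0" using lS \<open>u \<notin> S\<close> by (auto simp: w_def)
  ultimately show ?thesis using that by blast
qed

text \<open>An operator that is bounded below has closed range, so a missed vector yields one orthogonal to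
  the range.\<close>

lemma bounded_below_surj:
  fixes B :: "'h::complex_hilbert_space \<Rightarrow> 'h"
  assumes add: "\<And>x y. B (x + y) = B x + B y" and scale: "\<And>c x. B (c *\<^sub>C x) = c *\<^sub>C B x"
    and bounded: "\<And>x. norm (B x) \<le> M * norm x"
    and below: "\<And>x. \<epsilon> * norm x \<le> norm (B x)" and "0 < \<epsilon>"
    and dense: "\<And>w. (\<And>x. cinner (B x) w = 0) \<Longrightarrow> w = 0"
  shows "surj B"
proof (rule ccontr)
  assume "\<not> surj B"
  then obtain u where u: "u \<notin> range B" by blast
  have zero: "B 0 = 0" using add[of 0 0] by simp
  have bl: "bounded_linear B"
    by (rule bounded_linear_intro[where K=M])
      (auto simp: add scale scaleR_eq_scaleC bounded mult.commute)
  have "closed (range B)"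
    using complete_isometric_image[OF \<open>0 < \<epsilon>\<close> subspace_UNIV bl]
      below by (simp add: complete_eq_closed complete_UNIV)
  then obtain w where "w \<noteq> 0" "\<And>s. s \<in> range B \<Longrightarrow> cinner s w = 0"
    by (rule exists_orthogonal[of "range B" u])
      (use u zero in \<open>auto simp: add[symmetric] scale[symmetric] intro: range_eqI[of _ _ 0]\<close>)
  then show False using dense by blast
qed

section \<open>Lower norms\<close>

lemma scaleC_diff_right: "c *\<^sub>C (x - y) = c *\<^sub>C x - c *\<^sub>C y" for x :: "'v::complex_normed_space"
  using scaleC_add_right[of c "x - y" y] by simp

lemma scaleR_scaleC_commute: "r *\<^sub>R c *\<^sub>C x = c *\<^sub>C r *\<^sub>R x" for x :: "'v::complex_normed_space"
  by (simp add: scaleR_eq_scaleC scaleC_scaleC mult.commute)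

lemma l2_summable: "x \<in> l2 S F \<Longrightarrow> (\<lambda>i. (norm (x i))\<^sup>2) summable_on UNIV"
  by (simp add: l2_def)

lemma l2_scaleR:
  assumes "x \<in> l2 S F" "\<And>v. v \<in> F \<Longrightarrow> r *\<^sub>R v \<in> F"
  shows "(\<lambda>i. r *\<^sub>R x i) \<in> l2 S F"
  using assms by (auto simp: l2_def power_mult_distrib summable_on_cmult_right)

text \<open>By homogeneity the infimum over the unit sphere becomes an inequality for all vectors.  Comparing
  with real numbers covers the zero space too, where the lower norm is \<open>\<infinity>\<close>.\<close>

lemma lower_norm_ge_iff:
  fixes B :: "('i \<Rightarrow> 'v::complex_normed_space) \<Rightarrow> 'k \<Rightarrow> 'w::complex_normed_space"
  assumes D: "\<And>x r. x \<in> D \<Longrightarrow> (\<lambda>i. r *\<^sub>R x i) \<in> D"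
    and B: "\<And>x r. x \<in> D \<Longrightarrow> B (\<lambda>i. r *\<^sub>R x i) = (\<lambda>i. r *\<^sub>R B x i)"
    and c: "0 \<le> c"
  shows "ennreal c \<le> lower_norm D B \<longleftrightarrow> (\<forall>x\<in>D. c * l2norm x \<le> l2norm (B x))"
proof
  assume le: "ennreal c \<le> lower_norm D B"
  show "\<forall>x\<in>D. c * l2norm x \<le> l2norm (B x)"
  proof
    fix x assume x: "x \<in> D"
    show "c * l2norm x \<le> l2norm (B x)"
    proof (cases "l2norm x = 0")
      case False
      then have pos: "0 < l2norm x" using l2norm_nonneg[of x] by linarith
      define y where "y = (\<lambda>i. inverse (l2norm x) *\<^sub>R x i)"
      have "y \<in> D" "l2norm y = 1"
        using D[OF x] pos by (simp_all add: y_def l2norm_scaleR)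
      then have "lower_norm D B \<le> ennreal (l2norm (B y))"
        unfolding lower_norm_def by (intro INF_lower) simp
      with le have "ennreal c \<le> ennreal (l2norm (B y))" by (rule order_trans)
      then have "c \<le> inverse (l2norm x) * l2norm (B x)"
        using pos by (simp add: y_def B[OF x] l2norm_scaleR)
      then show ?thesis using pos by (simp add: field_simps)
    qed simp
  qed
next
  assume "\<forall>x\<in>D. c * l2norm x \<le> l2norm (B x)"
  then show "ennreal c \<le> lower_norm D B"
    unfolding lower_norm_def by (intro INF_greatest) (force intro: ennreal_leI)
qed

section \<open>Localisation to translated windows\<close>

text \<open>Summing over the translates first, each of them contributes the same factor.\<close>

lemma has_sum_translate_product:
  fixes g :: "'g::ab_group_add \<Rightarrow> real" and h :: "'g \<Rightarrow> real"
  assumes g: "(g has_sum G) UNIV" "\<And>i. 0 \<le> g i" and h: "(h has_sum H) UNIV" "\<And>i. 0 \<le> h i"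
  shows "((\<lambda>(k, i). g (i - k) * h i) has_sum G * H) UNIV"
proof -
  have bij: "bij_betw (\<lambda>k. i - k) UNIV UNIV" for i :: 'g
    by (rule bij_betwI[where g="\<lambda>k. i - k"]) auto
  have inner: "((\<lambda>k. g (i - k) * h i) has_sum G * h i) UNIV" for i
    by (rule has_sum_cmult_left) (use has_sum_reindex_bij_betw[OF bij] g in blast)
  have outer: "((\<lambda>i. G * h i) has_sum G * H) UNIV"
    by (rule has_sum_cmult_right[OF h(1)])
  have "((\<lambda>(i, k). g (i - k) * h i) has_sum G * H) (UNIV \<times> UNIV)"
  proof (rule has_sum_SigmaI)
    show "(\<lambda>(i, k). g (i - k) * h i) summable_on UNIV \<times> UNIV"
      by (rule summable_on_SigmaI[where g="\<lambda>i. G * h i"])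
        (use inner outer g h in \<open>auto intro: has_sum_imp_summable\<close>)
  qed (use inner outer in auto)
  then show ?thesis by (subst (asm) has_sum_swap) simp
qed

text \<open>The family \<open>(k, i) \<mapsto> g (i - k) y\<^sub>i\<close> collects all translates of the window function \<open>g\<close>,
  applied to one vector.\<close>

lemma translate_product:
  fixes g :: "'g::ab_group_add \<Rightarrow> real" and y :: "'g \<Rightarrow> 'v::real_normed_vector"
  assumes g: "(\<lambda>i. (g i)\<^sup>2) summable_on UNIV" and y: "(\<lambda>i. (norm (y i))\<^sup>2) summable_on UNIV"
  shows "(\<lambda>(k, i). (norm (g (i - k) *\<^sub>R y i))\<^sup>2) summable_on UNIV"
    and "l2norm (\<lambda>(k, i). g (i - k) *\<^sub>R y i) = sqrt (\<Sum>\<^sub>\<infinity>i. (g i)\<^sup>2) * l2norm y"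
proof -
  from has_sum_translate_product[OF has_sum_infsum[OF g] _ has_sum_infsum[OF y]]
  have *: "((\<lambda>(k, i). (norm (g (i - k) *\<^sub>R y i))\<^sup>2) has_sum
      (\<Sum>\<^sub>\<infinity>i. (g i)\<^sup>2) * (\<Sum>\<^sub>\<infinity>i. (norm (y i))\<^sup>2)) UNIV"
    by (simp add: power_mult_distrib)
  then show "(\<lambda>(k, i). (norm (g (i - k) *\<^sub>R y i))\<^sup>2) summable_on UNIV"
    by (rule has_sum_imp_summable)
  have "(\<lambda>p. (norm ((\<lambda>(k, i). g (i - k) *\<^sub>R y i) p))\<^sup>2) = (\<lambda>(k, i). (norm (g (i - k) *\<^sub>R y i))\<^sup>2)"
    by auto
  with infsumI[OF *] show "l2norm (\<lambda>(k, i). g (i - k) *\<^sub>R y i) = sqrt (\<Sum>\<^sub>\<infinity>i. (g i)\<^sup>2) * l2norm y"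
    by (simp add: l2norm_def real_sqrt_mult)
qed

text \<open>The contribution of the edges in direction \<open>j\<close> to the Dirichlet energy of \<open>\<phi>\<close>.\<close>

definition difference_energy :: "('g::ab_group_add \<Rightarrow> real) \<Rightarrow> 'g \<Rightarrow> real"
  where "difference_energy \<phi> j = (\<Sum>\<^sub>\<infinity>i. (\<phi> (i - j) - \<phi> i)\<^sup>2)"

lemma l2norm_translate:
  fixes x :: "'g::ab_group_add \<Rightarrow> 'v::real_normed_vector"
  assumes "(\<lambda>i. (norm (x i))\<^sup>2) summable_on UNIV"
  shows "(\<lambda>i. (norm (x (i - j)))\<^sup>2) summable_on UNIV" "l2norm (\<lambda>i. x (i - j)) = l2norm x"
proof -
  have bij: "bij_betw (\<lambda>i. i - j) UNIV UNIV"
    by (rule bij_betwI[where g="\<lambda>i. i + j"]) auto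
  show "(\<lambda>i. (norm (x (i - j)))\<^sup>2) summable_on UNIV"
    using summable_on_reindex_bij_betw[OF bij, of "\<lambda>i. (norm (x i))\<^sup>2"] assms by simp
  show "l2norm (\<lambda>i. x (i - j)) = l2norm x"
    using infsum_reindex_bij_betw[OF bij, of "\<lambda>i. (norm (x i))\<^sup>2"] by (simp add: l2norm_def)
qed

lemma summable_finite_support:
  assumes "finite V" "\<And>i. i \<notin> V \<Longrightarrow> f i = 0"
  shows "(f :: 'i \<Rightarrow> real) summable_on UNIV"
  by (rule finite_nonzero_values_imp_summable_on, rule finite_subset[of _ V]) (use assms in auto)

text \<open>The common frame for an operator of the Wiener algebra and for its adjoint, whose values lie in the
  dual space.\<close>

locale convolution_operator =
  fixes F :: "'v::{complex_normed_space, banach} set"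
    and T :: "('g::ab_group_add \<Rightarrow> 'v) \<Rightarrow> 'g \<Rightarrow> 'v"
    and c :: "'g \<Rightarrow> 'g \<Rightarrow> 'v \<Rightarrow> 'v" and s :: "'g \<Rightarrow> real"
  assumes zero_in_F: "0 \<in> F"
    and F_scaleR: "\<And>r v. v \<in> F \<Longrightarrow> r *\<^sub>R v \<in> F"
    and T_summable: "\<And>x. x \<in> l2 UNIV F \<Longrightarrow> (\<lambda>i. (norm (T x i))\<^sup>2) summable_on UNIV"
    and T_has_sum: "\<And>x i. x \<in> l2 UNIV F \<Longrightarrow> ((\<lambda>j. c j i (x (i - j))) has_sum T x i) UNIV"
    and c_linear: "\<And>j i. bounded_linear (c j i)"
    and c_bound: "\<And>j i v. norm (c j i v) \<le> s j * norm v"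
    and s_nonneg: "\<And>j. 0 \<le> s j"
    and s_summable: "s summable_on UNIV"
begin

lemma T_scaleR:
  assumes "x \<in> l2 UNIV F"
  shows "T (\<lambda>i. r *\<^sub>R x i) = (\<lambda>i. r *\<^sub>R T x i)"
proof
  fix i
  have "((\<lambda>j. c j i (r *\<^sub>R x (i - j))) has_sum T (\<lambda>i. r *\<^sub>R x i) i) UNIV"
    using T_has_sum[OF l2_scaleR[OF assms F_scaleR]] .
  moreover have "((\<lambda>j. c j i (r *\<^sub>R x (i - j))) has_sum r *\<^sub>R T x i) UNIV"
    using has_sum_scaleR[OF T_has_sum[OF assms]] linear_simps(5)[OF c_linear] by simp
  ultimately show "T (\<lambda>i. r *\<^sub>R x i) i = r *\<^sub>R T x i" by (rule has_sum_unique)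
qed

lemma minus_scalar_scaleR:
  assumes "x \<in> l2 UNIV F"
  shows "minus_scalar T z (\<lambda>i. r *\<^sub>R x i) = (\<lambda>i. r *\<^sub>R minus_scalar T z x i)"
  by (simp add: minus_scalar_def T_scaleR[OF assms] scaleR_right_diff_distrib scaleR_scaleC_commute)

lemma minus_scalar_summable:
  assumes "x \<in> l2 UNIV F"
  shows "(\<lambda>i. (norm (minus_scalar T z x i))\<^sup>2) summable_on UNIV"
proof -
  have "coord (Ell2 (T x) - z *\<^sub>C Ell2 x) = minus_scalar T z x"
    using T_summable[OF assms] l2_summable[OF assms]
    by (auto simp: minus_scalar_def coord_Ell2)
  then show ?thesis by (metis summable_coord)
qed

lemma l2_subset: "l2 S F \<subseteq> l2 UNIV F"
  using zero_in_F by (force simp: l2_def)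

lemma lower_norm_minus_scalar_ge_iff:
  assumes "0 \<le> a"
  shows "ennreal a \<le> lower_norm (l2 UNIV F) (minus_scalar T z)
    \<longleftrightarrow> (\<forall>x\<in>l2 UNIV F. a * l2norm x \<le> l2norm (minus_scalar T z x))"
  by (rule lower_norm_ge_iff) (use assms l2_scaleR F_scaleR minus_scalar_scaleR in blast)+

text \<open>On families supported in the window the projection is the identity, so the operators compressed
  to windows have the lower norms of restrictions of the full operator.\<close>

lemma lower_norm_window_ge_iff:
  assumes "0 \<le> a"
  shows "ennreal a \<le> lower_norm (l2 S F) (minus_scalar (T \<circ> window_proj S) z)
    \<longleftrightarrow> (\<forall>x\<in>l2 S F. a * l2norm x \<le> l2norm (minus_scalar T z x))"
proof -
  have eq: "minus_scalar (T \<circ> window_proj S) z x = minus_scalar T z x" if "x \<in> l2 S F" for x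
  proof -
    have "window_proj S x = x" using that by (auto simp: window_proj_def l2_def)
    then show ?thesis by (simp add: minus_scalar_def)
  qed
  have sc: "(\<lambda>i. r *\<^sub>R x i) \<in> l2 S F" if "x \<in> l2 S F" for x r
    using l2_scaleR[OF that F_scaleR] .
  have "ennreal a \<le> lower_norm (l2 S F) (minus_scalar (T \<circ> window_proj S) z)
    \<longleftrightarrow> (\<forall>x\<in>l2 S F. a * l2norm x \<le> l2norm (minus_scalar (T \<circ> window_proj S) z x))"
    by (rule lower_norm_ge_iff[OF sc _ assms])
      (simp_all add: eq sc minus_scalar_scaleR subsetD[OF l2_subset])
  then show ?thesis by (simp add: eq)
qed

text \<open>The commutator of the operator with multiplication by the translated window
  functions is a sum over \<open>j\<close> of families whose norms are controlled by the energies of the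
  differences of the window function; summing over all windows at once, the triangle inequality
  in the space of families indexed by pairs (window, position) yields the bound.\<close>

lemma localisation:
  assumes W: "finite W" and \<phi>: "\<And>k. k \<notin> W \<Longrightarrow> \<phi> k = 0" and unit: "(\<Sum>k\<in>W. (\<phi> k)\<^sup>2) = 1"
    and low: "\<And>k y. y \<in> l2 ((+) k ` W) F \<Longrightarrow>
      a * l2norm y \<le> l2norm (minus_scalar T z y)" and "0 \<le> a"
    and x: "x \<in> l2 UNIV F"
  shows "a * l2norm x \<le> l2norm (minus_scalar T z x)
    + (\<Sum>\<^sub>\<infinity>j. s j * sqrt (difference_energy \<phi> j)) * l2norm x"
    and "(\<lambda>j. s j * sqrt (difference_energy \<phi> j)) summable_on UNIV"
proof -
  note sx = l2_summable[OF x]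
  note sT = minus_scalar_summable[OF x, of z]
  have s\<phi>: "(\<lambda>i. (\<phi> i)\<^sup>2) summable_on UNIV"
    by (rule summable_finite_support[OF W]) (simp add: \<phi>)
  have "(\<lambda>i. (norm (\<phi> i))\<^sup>2) summable_on UNIV" using s\<phi> by simp
  note trans\<phi> = l2norm_translate[OF this]
  define \<delta> where "\<delta> j i = \<phi> (i - j) - \<phi> i" for i j
  have s\<delta>: "(\<lambda>i. (\<delta> j i)\<^sup>2) summable_on UNIV" for j
    using l2norm_add(1)[OF trans\<phi>(1)[of j], of "\<lambda>i. - \<phi> i"] s\<phi> by (simp add: \<delta>_def)
  have e1: "(\<Sum>\<^sub>\<infinity>i. (\<phi> i)\<^sup>2) = 1"
    using infsum_cong_neutral[of W UNIV "\<lambda>i. (\<phi> i)\<^sup>2" "\<lambda>i. (\<phi> i)\<^sup>2"] W \<phi> unit by simp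
  have n\<phi>: "l2norm \<phi> = 1" using e1 by (simp add: l2norm_def)
  have \<delta>_le: "sqrt (difference_energy \<phi> j) \<le> 2" for j
  proof -
    have "sqrt (difference_energy \<phi> j) = l2norm (\<lambda>i. \<phi> (i - j) + - \<phi> i)"
      by (simp add: difference_energy_def l2norm_def)
    also have "\<dots> \<le> l2norm (\<lambda>i. \<phi> (i - j)) + l2norm (\<lambda>i. - \<phi> i)"
      by (rule l2norm_add(2)) (use trans\<phi> s\<phi> in auto)
    also have "\<dots> = 2" using trans\<phi> l2norm_scaleR[of "-1" \<phi>] by (simp add: n\<phi>)
    finally show ?thesis .
  qed
  show sE: "(\<lambda>j. s j * sqrt (difference_energy \<phi> j)) summable_on UNIV"
  proof (rule summable_on_comparison_test)
    show "(\<lambda>j. s j * 2) summable_on UNIV" by (rule summable_on_cmult_left[OF s_summable])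
    show "s j * sqrt (difference_energy \<phi> j) \<le> s j * 2" for j
      using \<delta>_le s_nonneg by (rule mult_left_mono)
  qed (simp add: s_nonneg difference_energy_def infsum_nonneg)

  \<comment> \<open>\<open>Z j\<close> is the \<open>j\<close>-th term of the commutator, indexed by window and position;
    \<open>P j\<close> is the family that dominates it.\<close>
  define P where "P j = Ell2 (\<lambda>(k, i). \<delta> j (i - k) *\<^sub>R x (i - j))" for j
  define Z where "Z j = Ell2 (\<lambda>(k, i). c j i (\<delta> j (i - k) *\<^sub>R x (i - j)))" for j
  have split_norm: "(\<lambda>p. (norm ((\<lambda>(k, i). f k i) p))\<^sup>2) = (\<lambda>(k, i). (norm (f k i))\<^sup>2)"
    for f :: "'g \<Rightarrow> 'g \<Rightarrow> 'v" by auto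
  note tp = translate_product[OF s\<delta> l2norm_translate(1)[OF sx], folded split_norm]
  have cP: "coord (P j) (k, i) = \<delta> j (i - k) *\<^sub>R x (i - j)" for j k i
    unfolding P_def by (subst coord_Ell2[OF tp(1)]) simp
  have nP: "norm (P j) = sqrt (difference_energy \<phi> j) * l2norm x" for j
    unfolding P_def norm_Ell2[OF tp(1)] tp(2)
    by (simp add: difference_energy_def \<delta>_def l2norm_translate(2)[OF sx])
  have Zle: "norm ((\<lambda>(k, i). c j i (\<delta> j (i - k) *\<^sub>R x (i - j))) p) \<le> s j * norm (coord (P j) p)" for j p
    by (cases p) (simp only: split cP c_bound)
  note Zb = norm_ell2_le[OF Zle s_nonneg]
  have cZ: "coord (Z j) (k, i) = c j i (\<delta> j (i - k) *\<^sub>R x (i - j))" for j k i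
    unfolding Z_def by (subst coord_Ell2[OF Zb(1)]) simp
  have nZ: "norm (Z j) \<le> s j * sqrt (difference_energy \<phi> j) * l2norm x" for j
    unfolding Z_def norm_Ell2[OF Zb(1)] using Zb(2)[of j] by (simp add: nP mult.assoc)
  have sEx: "(\<lambda>j. s j * sqrt (difference_energy \<phi> j) * l2norm x) summable_on UNIV"
    by (rule summable_on_cmult_left[OF sE])
  have Zabs: "(\<lambda>j. norm (Z j)) summable_on UNIV"
    by (rule summable_on_comparison_test[OF sEx]) (auto intro: nZ)
  have Zs: "(Z has_sum (\<Sum>\<^sub>\<infinity>j. Z j)) UNIV"
    using abs_summable_summable[OF Zabs] by simp
  have nZs: "norm (\<Sum>\<^sub>\<infinity>j. Z j) \<le> (\<Sum>\<^sub>\<infinity>j. s j * sqrt (difference_energy \<phi> j)) * l2norm x"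
  proof -
    have "norm (\<Sum>\<^sub>\<infinity>j. Z j) \<le> (\<Sum>\<^sub>\<infinity>j. norm (Z j))" by (rule norm_infsum_bound[OF Zabs])
    also have "\<dots> \<le> (\<Sum>\<^sub>\<infinity>j. s j * sqrt (difference_energy \<phi> j) * l2norm x)"
      by (rule infsum_mono[OF Zabs sEx nZ])
    finally show ?thesis by (simp add: infsum_cmult_left')
  qed

  \<comment> \<open>\<open>Y\<close> and the sum of the \<open>Z j\<close> add up to \<open>T - z\<close> applied to the pieces
    \<open>xk\<close> of \<open>x\<close>, one for each window.\<close>
  define Y where "Y = Ell2 (\<lambda>(k, i). \<phi> (i - k) *\<^sub>R minus_scalar T z x i)"
  note tpY = translate_product[OF s\<phi> sT, folded split_norm]
  have cY: "coord Y (k, i) = \<phi> (i - k) *\<^sub>R minus_scalar T z x i" for k i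
    unfolding Y_def by (subst coord_Ell2[OF tpY(1)]) simp
  have nY: "norm Y = l2norm (minus_scalar T z x)"
    unfolding Y_def norm_Ell2[OF tpY(1)] tpY(2) by (simp add: e1)

  define xk where "xk k = (\<lambda>i. \<phi> (i - k) *\<^sub>R x i)" for k
  have sup: "xk k i = 0" if "i \<notin> (+) k ` W" for k i
    using that \<phi>[of "i - k"] by (force simp: xk_def image_iff)
  have xF: "xk k i \<in> F" for k i using x F_scaleR by (auto simp: xk_def l2_def)
  have sxk: "(\<lambda>i. (norm (xk k i))\<^sup>2) summable_on UNIV" for k
    by (rule summable_finite_support[of "(+) k ` W"]) (use W sup in auto)
  have xk: "xk k \<in> l2 ((+) k ` W) F" "xk k \<in> l2 UNIV F" for k
    using xF sup sxk by (auto simp: l2_def)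
  have cYZ: "coord (Y + (\<Sum>\<^sub>\<infinity>j. Z j)) (k, i) = minus_scalar T z (xk k) i" for k i
  proof -
    have "((\<lambda>j. coord (Z j) (k, i)) has_sum coord (\<Sum>\<^sub>\<infinity>j. Z j) (k, i)) UNIV"
      by (rule has_sum_bounded_linear[OF bounded_linear_coord Zs])
    moreover have "((\<lambda>j. \<phi> (i - k) *\<^sub>R c j i (x (i - j))) has_sum \<phi> (i - k) *\<^sub>R T x i) UNIV"
      by (rule has_sum_scaleR[OF T_has_sum[OF x]])
    ultimately have "((\<lambda>j. coord (Z j) (k, i) + \<phi> (i - k) *\<^sub>R c j i (x (i - j)))
        has_sum coord (\<Sum>\<^sub>\<infinity>j. Z j) (k, i) + \<phi> (i - k) *\<^sub>R T x i) UNIV"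
      by (rule has_sum_add)
    moreover have "coord (Z j) (k, i) + \<phi> (i - k) *\<^sub>R c j i (x (i - j)) = c j i (xk k (i - j))" for j
    proof -
      have eq: "\<phi> (i - k - j) = \<phi> (i - j - k)" by (simp add: algebra_simps)
      show ?thesis
        using c_linear[of j i]
        unfolding cZ \<delta>_def xk_def eq by (simp add: linear_simps scaleR_left_diff_distrib)
    qed
    ultimately have "((\<lambda>j. c j i (xk k (i - j))) has_sum
        coord (\<Sum>\<^sub>\<infinity>j. Z j) (k, i) + \<phi> (i - k) *\<^sub>R T x i) UNIV" by simp
    then have "coord (\<Sum>\<^sub>\<infinity>j. Z j) (k, i) + \<phi> (i - k) *\<^sub>R T x i = T (xk k) i"
      using T_has_sum[OF xk(2)] by (rule has_sum_unique)
    then show ?thesis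
      by (simp add: cY minus_scalar_def xk_def scaleR_right_diff_distrib scaleR_scaleC_commute add.commute)
  qed
  have le: "a * l2norm (xk k) \<le> l2norm (minus_scalar T z (xk k))" for k
    by (rule low[OF xk(1)])
  define V where "V = Ell2 (\<lambda>(k, i). \<phi> (i - k) *\<^sub>R x i)"
  note tpV = translate_product[OF s\<phi> sx, folded split_norm]
  have cV: "coord V (k, i) = xk k i" for k i
    unfolding V_def xk_def by (subst coord_Ell2[OF tpV(1)]) simp
  have nV: "norm V = l2norm x"
    unfolding V_def norm_Ell2[OF tpV(1)] tpV(2) by (simp add: e1)
  have fubini: "(norm U)\<^sup>2 = (\<Sum>\<^sub>\<infinity>k. (l2norm (\<lambda>i. coord U (k, i)))\<^sup>2)"
    "(\<lambda>k. (l2norm (\<lambda>i. coord U (k, i)))\<^sup>2) summable_on UNIV" for U :: "('g \<times> 'g, 'v) ell2"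
  proof -
    have "(\<lambda>(k, i). (norm (coord U (k, i)))\<^sup>2) summable_on UNIV \<times> UNIV"
      using summable_coord[of U] by (simp add: case_prod_unfold)
    from infsum_Sigma'_banach[OF this] summable_on_Sigma_banach[OF this]
    show "(norm U)\<^sup>2 = (\<Sum>\<^sub>\<infinity>k. (l2norm (\<lambda>i. coord U (k, i)))\<^sup>2)"
      "(\<lambda>k. (l2norm (\<lambda>i. coord U (k, i)))\<^sup>2) summable_on UNIV"
      by (simp_all add: norm_ell2_square l2norm_def infsum_nonneg case_prod_unfold)
  qed
  have "(a * norm V)\<^sup>2 = (\<Sum>\<^sub>\<infinity>k. a\<^sup>2 * (l2norm (xk k))\<^sup>2)"
    by (simp add: power_mult_distrib fubini(1)[of V] cV infsum_cmult_right')
  also have "\<dots> \<le> (\<Sum>\<^sub>\<infinity>k. (l2norm (minus_scalar T z (xk k)))\<^sup>2)"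
  proof (rule infsum_mono)
    show "(\<lambda>k. a\<^sup>2 * (l2norm (xk k))\<^sup>2) summable_on UNIV"
      using fubini(2)[of V] by (intro summable_on_cmult_right) (simp add: cV)
    show "(\<lambda>k. (l2norm (minus_scalar T z (xk k)))\<^sup>2) summable_on UNIV"
      using fubini(2)[of "Y + (\<Sum>\<^sub>\<infinity>j. Z j)"] by (simp only: cYZ)
    show "a\<^sup>2 * (l2norm (xk k))\<^sup>2 \<le> (l2norm (minus_scalar T z (xk k)))\<^sup>2" for k
      using power_mono[OF le[of k], of 2] \<open>0 \<le> a\<close> by (simp add: power_mult_distrib)
  qed
  also have "\<dots> = (norm (Y + (\<Sum>\<^sub>\<infinity>j. Z j)))\<^sup>2"
    by (simp only: fubini(1) cYZ)
  finally have "a * norm V \<le> norm (Y + (\<Sum>\<^sub>\<infinity>j. Z j))"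
    by (rule power2_le_imp_le) simp
  also have "\<dots> \<le> norm Y + norm (\<Sum>\<^sub>\<infinity>j. Z j)" by (rule norm_triangle_ineq)
  finally show "a * l2norm x \<le> l2norm (minus_scalar T z x)
    + (\<Sum>\<^sub>\<infinity>j. s j * sqrt (difference_energy \<phi> j)) * l2norm x"
    using nZs by (simp add: nV nY)
qed

end

section \<open>The lower norm of an invertible operator has no local minimum\<close>

lemma parallelogram_four:
  fixes a b d :: "'h::complex_hilbert_space"
  shows "(norm (a + b + d))\<^sup>2 + (norm (a - b + d))\<^sup>2 + (norm (a + \<i> *\<^sub>C b - d))\<^sup>2 + (norm (a - \<i> *\<^sub>C b - d))\<^sup>2
    = 4 * ((norm a)\<^sup>2 + (norm b)\<^sup>2 + (norm d)\<^sup>2)"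
proof -
  have "(norm (a + b + d))\<^sup>2 + (norm (a - b + d))\<^sup>2 = 2 * (norm (a + d))\<^sup>2 + 2 * (norm b)\<^sup>2"
    using parallelogram[of "a + d" b] by (simp add: algebra_simps)
  moreover have "(norm (a + \<i> *\<^sub>C b - d))\<^sup>2 + (norm (a - \<i> *\<^sub>C b - d))\<^sup>2
      = 2 * (norm (a - d))\<^sup>2 + 2 * (norm b)\<^sup>2"
    using parallelogram[of "a - d" "\<i> *\<^sub>C b"] by (simp add: algebra_simps norm_scaleC)
  ultimately show ?thesis using parallelogram[of a d] by simp
qed

text \<open>If the lower norms of all \<open>B - w\<close> with small \<open>w\<close> were at least \<open>\<epsilon>\<close>, then apply this to
  \<open>x + w R x + w\<^sup>2 R\<^sup>2 x\<close>, where \<open>R\<close> is the inverse of \<open>B\<close>: its image under \<open>B - w\<close> is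
  \<open>B x - w\<^sup>3 R\<^sup>2 x\<close>.  Averaging over the four values \<open>w = \<plusminus> \<rho>, \<plusminus> \<i> \<rho>\<close>, the parallelogram
  law separates the summands, and the term \<open>\<rho>\<^sup>2 \<parallel>R x\<parallel>\<^sup>2\<close> beats the error of order \<open>\<rho>\<^sup>3\<close>.\<close>

lemma lower_norm_not_locally_minimal:
  fixes B :: "'h::complex_hilbert_space \<Rightarrow> 'h"
  assumes add: "\<And>x y. B (x + y) = B x + B y" and scale: "\<And>c x. B (c *\<^sub>C x) = c *\<^sub>C B x"
    and bounded: "\<And>x. norm (B x) \<le> M * norm x" and M: "0 < M" and surj: "surj B"
    and below: "\<And>w x. cmod w < r \<Longrightarrow> \<epsilon> * norm x \<le> norm (B x - w *\<^sub>C x)" and \<epsilon>: "0 < \<epsilon>" and r: "0 < r"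
  obtains \<eta> where "0 < \<eta>" "\<And>x. (\<epsilon> + \<eta>) * norm x \<le> norm (B x)"
proof -
  have zero: "0 *\<^sub>C x = 0" for x :: 'h using norm_scaleC[of 0 x] by simp
  have one: "1 *\<^sub>C x = x" for x :: 'h using scaleR_eq_scaleC[of 1 x] by simp
  have minus: "(- w) *\<^sub>C x = - (w *\<^sub>C x)" for x :: 'h and w
    using scaleC_scaleC[of "-1" w x] scaleC_m1[of "w *\<^sub>C x"] by simp
  have below0: "\<epsilon> * norm x \<le> norm (B x)" for x using below[of 0 x] r by (simp add: zero)
  obtain R where R: "\<And>y. B (R y) = y" using surj by (metis surjD)
  have Rle: "norm (R y) \<le> norm y / \<epsilon>" for y using below0[of "R y"] \<epsilon> by (simp add: R field_simps)
  define \<rho> where "\<rho> = min (min (r / 2) (\<epsilon> / 2)) (\<epsilon>^3 / (4 * M\<^sup>2))"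
  have \<rho>: "0 < \<rho>" "\<rho> < r" "\<rho> \<le> \<epsilon>^3 / (4 * M\<^sup>2)" "\<rho> < \<epsilon>"
    using r \<epsilon> M by (auto simp: \<rho>_def min_def)
  define q where "q = \<epsilon> * sqrt (1 + \<rho>\<^sup>2 / M\<^sup>2) - \<rho>^3 / \<epsilon>\<^sup>2"
  have main: "q * norm x \<le> norm (B x)" for x
  proof -
    define u where "u w = x + w *\<^sub>C R x + w\<^sup>2 *\<^sub>C R (R x)" for w
    have Bu: "B (u w) - w *\<^sub>C u w = B x - w^3 *\<^sub>C R (R x)" for w
      by (simp add: u_def add scale R scaleC_add_right scaleC_scaleC power2_eq_square power3_eq_cube mult.assoc)
    have up: "(\<epsilon> * norm (u w))\<^sup>2 \<le> (norm (B x) + \<rho>^3 / \<epsilon>\<^sup>2 * norm x)\<^sup>2" if "cmod w = \<rho>" for w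
    proof (rule power_mono)
      have "\<epsilon> * norm (u w) \<le> norm (B (u w) - w *\<^sub>C u w)" using below that \<rho> by simp
      also have "\<dots> \<le> norm (B x) + \<rho>^3 * norm (R (R x))"
        unfolding Bu by (rule order_trans[OF norm_triangle_ineq4]) (simp add: norm_scaleC norm_power that)
      also have "norm (R (R x)) \<le> norm x / \<epsilon> / \<epsilon>"
        using Rle[of "R x"] divide_right_mono[OF Rle[of x], of \<epsilon>] \<epsilon> by linarith
      finally show "\<epsilon> * norm (u w) \<le> norm (B x) + \<rho>^3 / \<epsilon>\<^sup>2 * norm x"
        using \<rho> by (simp add: power2_eq_square mult_left_mono)
    qed (use \<epsilon> in simp)
    have expand:
      "u (complex_of_real \<rho>) = x + complex_of_real \<rho> *\<^sub>C R x + (complex_of_real \<rho>)\<^sup>2 *\<^sub>C R (R x)"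
      "u (- complex_of_real \<rho>) = x - complex_of_real \<rho> *\<^sub>C R x + (complex_of_real \<rho>)\<^sup>2 *\<^sub>C R (R x)"
      "u (\<i> * complex_of_real \<rho>) = x + \<i> *\<^sub>C complex_of_real \<rho> *\<^sub>C R x - (complex_of_real \<rho>)\<^sup>2 *\<^sub>C R (R x)"
      "u (- (\<i> * complex_of_real \<rho>)) = x - \<i> *\<^sub>C complex_of_real \<rho> *\<^sub>C R x - (complex_of_real \<rho>)\<^sup>2 *\<^sub>C R (R x)"
      by (simp_all add: u_def minus scaleC_scaleC power_mult_distrib)
    have "4 * (\<epsilon>\<^sup>2 * ((norm x)\<^sup>2 + \<rho>\<^sup>2 * (norm (R x))\<^sup>2)) \<le>
      \<epsilon>\<^sup>2 * (4 * ((norm x)\<^sup>2 + (norm (complex_of_real \<rho> *\<^sub>C R x))\<^sup>2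
        + (norm ((complex_of_real \<rho>)\<^sup>2 *\<^sub>C R (R x)))\<^sup>2))"
      by (simp add: norm_scaleC power_mult_distrib distrib_left)
    also have "\<dots> = (\<epsilon> * norm (u (complex_of_real \<rho>)))\<^sup>2 + (\<epsilon> * norm (u (- complex_of_real \<rho>)))\<^sup>2
        + (\<epsilon> * norm (u (\<i> * complex_of_real \<rho>)))\<^sup>2 + (\<epsilon> * norm (u (- (\<i> * complex_of_real \<rho>))))\<^sup>2"
      unfolding parallelogram_four[symmetric] expand by (simp only: power_mult_distrib distrib_left)
    also have "\<dots> \<le> 4 * (norm (B x) + \<rho>^3 / \<epsilon>\<^sup>2 * norm x)\<^sup>2"
    proof -
      have "cmod (complex_of_real \<rho>) = \<rho>" "cmod (- complex_of_real \<rho>) = \<rho>"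
        "cmod (\<i> * complex_of_real \<rho>) = \<rho>" "cmod (- (\<i> * complex_of_real \<rho>)) = \<rho>"
        using \<rho> by (simp_all add: norm_mult)
      from this[THEN up] show ?thesis by linarith
    qed
    finally have 1: "\<epsilon>\<^sup>2 * ((norm x)\<^sup>2 + \<rho>\<^sup>2 * (norm (R x))\<^sup>2) \<le> (norm (B x) + \<rho>^3 / \<epsilon>\<^sup>2 * norm x)\<^sup>2"
      by simp
    have "norm x \<le> M * norm (R x)" using bounded[of "R x"] by (simp add: R)
    then have "(norm x)\<^sup>2 \<le> M\<^sup>2 * (norm (R x))\<^sup>2"
      using power_mono[of "norm x" "M * norm (R x)" 2] by (simp add: power_mult_distrib)
    then have "(norm x)\<^sup>2 / M\<^sup>2 \<le> (norm (R x))\<^sup>2" using M by (simp add: field_simps)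
    then have "\<rho>\<^sup>2 * ((norm x)\<^sup>2 / M\<^sup>2) \<le> \<rho>\<^sup>2 * (norm (R x))\<^sup>2" by (rule mult_left_mono) simp
    then have "\<epsilon>\<^sup>2 * ((norm x)\<^sup>2 + \<rho>\<^sup>2 * ((norm x)\<^sup>2 / M\<^sup>2)) \<le> \<epsilon>\<^sup>2 * ((norm x)\<^sup>2 + \<rho>\<^sup>2 * (norm (R x))\<^sup>2)"
      by (intro mult_left_mono) auto
    then have "(\<epsilon> * sqrt (1 + \<rho>\<^sup>2 / M\<^sup>2) * norm x)\<^sup>2 \<le> (norm (B x) + \<rho>^3 / \<epsilon>\<^sup>2 * norm x)\<^sup>2"
      using 1 by (simp add: power_mult_distrib distrib_left distrib_right add_nonneg_nonneg mult.assoc)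
    then have "\<epsilon> * sqrt (1 + \<rho>\<^sup>2 / M\<^sup>2) * norm x \<le> norm (B x) + \<rho>^3 / \<epsilon>\<^sup>2 * norm x"
      by (rule power2_le_imp_le) (use \<epsilon> \<rho> in simp)
    then show ?thesis by (simp add: q_def left_diff_distrib)
  qed
  define t where "t = \<rho>^3 / \<epsilon>^3"
  have t0: "0 < t" using \<rho> \<epsilon> by (simp add: t_def)
  have rM: "4 * t \<le> \<rho>\<^sup>2 / M\<^sup>2"
  proof -
    have "4 * M\<^sup>2 * \<rho> \<le> \<epsilon>^3" using \<rho>(3) M by (simp add: field_simps)
    then have "(4 * M\<^sup>2 * \<rho>) * \<rho>\<^sup>2 \<le> \<epsilon>^3 * \<rho>\<^sup>2" by (rule mult_right_mono) simp
    then show ?thesis using M \<epsilon> by (simp add: t_def field_simps power2_eq_square power3_eq_cube)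
  qed
  have "q > \<epsilon>"
  proof -
    have "t < 1" using power_strict_mono[OF \<rho>(4), of 3] \<rho>(1) \<epsilon> by (simp add: t_def)
    have "(1 + t)\<^sup>2 < 1 + 4 * t"
      using mult_strict_left_mono[OF \<open>t < 1\<close> t0] t0 by (simp add: power2_eq_square algebra_simps)
    also have "\<dots> \<le> 1 + \<rho>\<^sup>2 / M\<^sup>2" using rM by simp
    finally have "1 + t < sqrt (1 + \<rho>\<^sup>2 / M\<^sup>2)" by (rule real_less_rsqrt)
    then have "\<epsilon> * (1 + t) < \<epsilon> * sqrt (1 + \<rho>\<^sup>2 / M\<^sup>2)" using \<epsilon> by (rule mult_strict_left_mono)
    moreover have "\<epsilon> * t = \<rho>^3 / \<epsilon>\<^sup>2" using \<epsilon> by (simp add: t_def power2_eq_square power3_eq_cube)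
    ultimately show ?thesis by (simp add: q_def distrib_left)
  qed
  then show ?thesis using that[of "q - \<epsilon>"] main by simp
qed

section \<open>Series of shifted operators and their adjoints\<close>

lemma infsum_diff:
  fixes f g :: "'i \<Rightarrow> complex"
  assumes "f summable_on I" "g summable_on I"
  shows "(\<Sum>\<^sub>\<infinity>i\<in>I. f i - g i) = infsum f I - infsum g I"
  using infsum_add[of f I "\<lambda>i. - g i"] assms by (simp add: infsum_uminus summable_on_uminus)

lemma norm_le_supnorm: "a \<in> linf_ops \<Longrightarrow> norm (a i) \<le> supnorm a"
  unfolding supnorm_def by (rule cSUP_upper) (auto simp: linf_ops_def)

lemma supnorm_nonneg: "a \<in> linf_ops \<Longrightarrow> 0 \<le> supnorm a"
  using norm_le_supnorm[of a undefined] norm_ge_zero order_trans by blast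

text \<open>The series converges absolutely in norm because shifts are isometries; evaluation at a position is
  continuous, so norm and coordinatewise sums agree.\<close>

lemma convolution_series:
  fixes x :: "'g::ab_group_add \<Rightarrow> 'v::real_normed_vector" and c :: "'g \<Rightarrow> 'g \<Rightarrow> 'v \<Rightarrow> 'w::banach"
  assumes x: "(\<lambda>i. (norm (x i))\<^sup>2) summable_on UNIV"
    and c: "\<And>j i v. norm (c j i v) \<le> s j * norm v" and s: "\<And>j. 0 \<le> s j" "s summable_on UNIV"
  obtains Z and G :: "('g, 'w) ell2" where "(Z has_sum G) UNIV"
    "\<And>j i. coord (Z j) i = c j i (x (i - j))" "norm G \<le> (\<Sum>\<^sub>\<infinity>j. s j) * l2norm x"
    "\<And>i. ((\<lambda>j. c j i (x (i - j))) has_sum coord G i) UNIV"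
proof -
  define X where "X j = Ell2 (\<lambda>i. x (i - j))" for j
  have cX: "coord (X j) = (\<lambda>i. x (i - j))" "norm (X j) = l2norm x" for j
    using l2norm_translate[OF x, of j] by (simp_all add: X_def coord_Ell2 norm_Ell2)
  define Z where "Z j = Ell2 (\<lambda>i. c j i (x (i - j)))" for j
  have "norm (c j i (x (i - j))) \<le> s j * norm (coord (X j) i)" for i j
    using c by (simp add: cX)
  note Zb = norm_ell2_le[OF this s(1)]
  have cZ: "coord (Z j) i = c j i (x (i - j))" for j i
    unfolding Z_def by (subst coord_Ell2[OF Zb(1)]) simp
  have nZ: "norm (Z j) \<le> s j * l2norm x" for j
    unfolding Z_def norm_Ell2[OF Zb(1)] using Zb(2)[of j] by (simp add: cX)
  have sx: "(\<lambda>j. s j * l2norm x) summable_on UNIV" by (rule summable_on_cmult_left[OF s(2)])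
  have Zabs: "(\<lambda>j. norm (Z j)) summable_on UNIV"
    by (rule summable_on_comparison_test[OF sx]) (auto intro: nZ)
  have hs: "(Z has_sum (\<Sum>\<^sub>\<infinity>j. Z j)) UNIV"
    using abs_summable_summable[OF Zabs] by simp
  have "norm (\<Sum>\<^sub>\<infinity>j. Z j) \<le> (\<Sum>\<^sub>\<infinity>j. norm (Z j))" by (rule norm_infsum_bound[OF Zabs])
  also have "\<dots> \<le> (\<Sum>\<^sub>\<infinity>j. s j * l2norm x)" by (rule infsum_mono[OF Zabs sx nZ])
  finally have nG: "norm (\<Sum>\<^sub>\<infinity>j. Z j) \<le> (\<Sum>\<^sub>\<infinity>j. s j) * l2norm x" by (simp add: infsum_cmult_left')
  show ?thesis
    by (rule that[OF hs cZ nG]) (use has_sum_bounded_linear[OF bounded_linear_coord hs] cZ in simp)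
qed

lemma summable_l2E: "x \<in> l2E \<longleftrightarrow> (\<lambda>i. (norm (x i))\<^sup>2) summable_on UNIV"
  by (simp add: l2_def)

lemma coord_in_l2E: "coord X \<in> l2E"
  by (simp add: summable_l2E summable_coord)

lemma coord_Ell2_l2: "x \<in> l2 S F \<Longrightarrow> coord (Ell2 x) = x"
  by (simp add: coord_Ell2 l2_summable)

text \<open>The operator norm dominates the error at each single position.\<close>

lemma wiener_has_sum:
  assumes rep: "wiener_representation A b" and x: "x \<in> l2E"
  shows "((\<lambda>j. blinfun_apply (b j i) (x (i - j))) has_sum A x i) UNIV"
proof -
  have A: "A \<in> bounded_operators l2E l2E" and b: "\<And>j. b j \<in> linf_ops"
    and lim: "((\<lambda>F. op_norm l2E (\<lambda>x i. A x i - (\<Sum>j\<in>F. mult_op (b j) (shift_op j x) i))) \<longlongrightarrow> 0)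
        (finite_subsets_at_top UNIV)"
    using rep by (auto simp: wiener_representation_def)
  define R where "R F x i = A x i - (\<Sum>j\<in>F. mult_op (b j) (shift_op j x) i)" for F x i
  have R_eq: "R F = (\<lambda>x i. A x i - (\<Sum>j\<in>F. mult_op (b j) (shift_op j x) i))" for F
    by (simp add: R_def fun_eq_iff)
  define r where "r = l2norm x + 1"
  have r: "0 < r" unfolding r_def using l2norm_nonneg[of x] by linarith
  define y where "y = (\<lambda>i. inverse r *\<^sub>R x i)"
  have y: "y \<in> l2E" "l2norm y \<le> 1"
    using l2_scaleR[OF x] r by (auto simp: y_def l2norm_scaleR field_simps r_def)
  have Ry: "R F y i = inverse r *\<^sub>R R F x i" for F i
  proof -
    have "A y i = inverse r *\<^sub>R A x i"
      using A x unfolding y_def bounded_operators_def scaleR_eq_scaleC by auto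
    moreover have "mult_op (b j) (shift_op j y) i = inverse r *\<^sub>R mult_op (b j) (shift_op j x) i" for j
      by (simp add: mult_op_def shift_op_def y_def blinfun.scaleR_right)
    ultimately show ?thesis by (simp add: R_def scaleR_right_diff_distrib scaleR_sum_right)
  qed
  have sR: "(\<lambda>i. (norm (R F x i))\<^sup>2) summable_on UNIV" for F
  proof -
    have s1: "(\<lambda>i. (norm (mult_op (b j) (shift_op j x) i))\<^sup>2) summable_on UNIV" for j
    proof -
      have "norm (mult_op (b j) (shift_op j x) i) \<le> supnorm (b j) * norm (coord (Ell2 (\<lambda>i. x (i - j))) i)" for i
        using norm_blinfun[of "b j i" "x (i - j)"] mult_right_mono[OF norm_le_supnorm[OF b, of j i] norm_ge_zero[of "x (i - j)"]]
        by (simp add: mult_op_def shift_op_def coord_Ell2 l2norm_translate(1)[OF l2_summable[OF x]])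
      then show ?thesis by (rule norm_ell2_le(1)) (rule supnorm_nonneg[OF b])
    qed
    have "A x \<in> l2E" using A x by (auto simp: bounded_operators_def)
    moreover have "coord (Ell2 (A x) - (\<Sum>j\<in>F. Ell2 (mult_op (b j) (shift_op j x)))) i = R F x i"
      if "A x \<in> l2E" for i
      by (simp add: coord_Ell2_l2[OF that] R_def linear_sum[OF bounded_linear.linear[OF bounded_linear_coord]]
          coord_Ell2[OF s1])
    ultimately show ?thesis
      using summable_coord[of "Ell2 (A x) - (\<Sum>j\<in>F. Ell2 (mult_op (b j) (shift_op j x)))"] by simp
  qed
  show ?thesis
    unfolding has_sum_def tendsto_iff
  proof (intro allI impI)
    fix e :: real assume e: "0 < e"
    then have "\<forall>\<^sub>F F in finite_subsets_at_top UNIV. op_norm l2E (R F) < ennreal (e / r)"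
      using r order_tendstoD(2)[OF lim, of "ennreal (e / r)"] by (simp add: R_eq)
    then show "\<forall>\<^sub>F F in finite_subsets_at_top UNIV.
        dist (\<Sum>j\<in>F. blinfun_apply (b j i) (x (i - j))) (A x i) < e"
    proof eventually_elim
      case (elim F)
      have "ennreal (l2norm (R F y)) \<le> op_norm l2E (R F)"
        unfolding op_norm_def using y by (intro SUP_upper) auto
      with elim have "ennreal (l2norm (R F y)) < ennreal (e / r)" by (rule order.strict_trans1[rotated])
      then have "l2norm (R F y) < e / r" by (simp add: ennreal_less_iff)
      moreover have "l2norm (R F y) = inverse r * l2norm (R F x)"
        using l2norm_scaleR[of "inverse r" "R F x"] r by (simp add: Ry[abs_def, of F, symmetric] fun_eq_iff)
      ultimately have "l2norm (R F x) < e" using r by (simp add: field_simps)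
      moreover have "norm (R F x i) \<le> l2norm (R F x)"
        using L2_set_le_l2norm[OF sR, of "{i}" F] by simp
      ultimately show ?case
        by (simp add: R_def dist_norm norm_minus_commute mult_op_def shift_op_def)
    qed
  qed
qed

subsection \<open>The dual pairing\<close>

lemma dual_spaceD: "f \<in> dual_space \<Longrightarrow> blinfun_apply f (c *\<^sub>C y) = c * blinfun_apply f y"
  by (simp add: dual_space_def scaleC_complex_def)

lemma pairing_summable:
  "(\<lambda>i. norm (blinfun_apply (coord f i) (coord x i))) summable_on UNIV"
  "(\<Sum>\<^sub>\<infinity>i. norm (blinfun_apply (coord f i) (coord x i))) \<le> norm f * norm x"
proof -
  have le: "(\<Sum>i\<in>F. norm (blinfun_apply (coord f i) (coord x i))) \<le> norm f * norm x" if "finite F" for F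
  proof -
    have "(\<Sum>i\<in>F. norm (blinfun_apply (coord f i) (coord x i)))
        \<le> (\<Sum>i\<in>F. \<bar>norm (coord f i)\<bar> * \<bar>norm (coord x i)\<bar>)"
      by (rule sum_mono) (simp add: norm_blinfun)
    also have "\<dots> \<le> L2_set (\<lambda>i. norm (coord f i)) F * L2_set (\<lambda>i. norm (coord x i)) F"
      by (rule L2_set_mult_ineq)
    also have "\<dots> \<le> norm f * norm x"
      by (intro mult_mono) (simp_all add: norm_ell2 L2_set_le_l2norm summable_coord that)
    finally show ?thesis .
  qed
  show s: "(\<lambda>i. norm (blinfun_apply (coord f i) (coord x i))) summable_on UNIV"
    by (rule nonneg_bdd_above_summable_on) (auto intro!: bdd_aboveI2 le)
  show "(\<Sum>\<^sub>\<infinity>i. norm (blinfun_apply (coord f i) (coord x i))) \<le> norm f * norm x"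
    by (rule infsum_le_finite_sums[OF s]) (use le in auto)
qed

text \<open>Boundedness allows the pairing to be exchanged with norm convergent series.\<close>

lemma pairing_bounded_bilinear:
  "bounded_bilinear (\<lambda>f x. dual_pairing (coord f) (coord x))"
proof
  note s = abs_summable_summable[OF pairing_summable(1)]
  fix f g :: "('a, 'b \<Rightarrow>\<^sub>L complex) ell2" and x y :: "('a, 'b) ell2" and r :: real
  show "dual_pairing (coord (f + g)) (coord x) = dual_pairing (coord f) (coord x) + dual_pairing (coord g) (coord x)"
    by (simp add: dual_pairing_def blinfun.add_left infsum_add s)
  show "dual_pairing (coord f) (coord (x + y)) = dual_pairing (coord f) (coord x) + dual_pairing (coord f) (coord y)"
    by (simp add: dual_pairing_def blinfun.add_right infsum_add s)
  show "dual_pairing (coord (r *\<^sub>R f)) (coord x) = r *\<^sub>R dual_pairing (coord f) (coord x)"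
    by (simp add: dual_pairing_def blinfun.scaleR_left infsum_scaleR_right)
  show "dual_pairing (coord f) (coord (r *\<^sub>R x)) = r *\<^sub>R dual_pairing (coord f) (coord x)"
    by (simp add: dual_pairing_def blinfun.scaleR_right infsum_scaleR_right)
  show "\<exists>K. \<forall>(a :: ('a, 'b \<Rightarrow>\<^sub>L complex) ell2) (b :: ('a, 'b) ell2).
      norm (dual_pairing (coord a) (coord b)) \<le> norm a * norm b * K"
    unfolding dual_pairing_def
    by (intro exI[of _ 1] allI)
      (use norm_infsum_bound[OF pairing_summable(1)] pairing_summable(2) order_trans in fastforce)
qed

lemma pairing_le: "norm (dual_pairing (coord f) (coord x)) \<le> norm f * norm x"
  unfolding dual_pairing_def
  by (rule order_trans[OF norm_infsum_bound[OF pairing_summable(1)] pairing_summable(2)])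

lemma pairing_single:
  "dual_pairing f (\<lambda>k. if k = i then y else 0) = blinfun_apply (f i) y"
proof -
  have "dual_pairing f (\<lambda>k. if k = i then y else 0) = (\<Sum>\<^sub>\<infinity>k\<in>{i}. blinfun_apply (f i) y)"
    unfolding dual_pairing_def by (rule infsum_cong_neutral) auto
  then show ?thesis by simp
qed

lemma single_in_l2E: "(\<lambda>k. if k = i then y else 0) \<in> l2E"
  unfolding summable_l2E by (rule finite_nonzero_values_imp_summable_on, rule finite_subset[of _ "{i}"]) auto

text \<open>Families supported at one position separate the functionals, so a candidate for the adjoint is
  unique.\<close>

lemma adjoint_op_eqI:
  assumes "g \<in> l2E'" "\<And>x. x \<in> l2E \<Longrightarrow> dual_pairing g x = dual_pairing f (B x)"
  shows "adjoint_op B f = g"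
  unfolding adjoint_op_def
proof (rule the_equality)
  fix h assume h: "h \<in> l2E' \<and> (\<forall>x\<in>l2E. dual_pairing h x = dual_pairing f (B x))"
  show "h = g"
  proof (rule ext, rule blinfun_eqI)
    fix i y
    show "blinfun_apply (h i) y = blinfun_apply (g i) y"
      using bspec[OF conjunct2[OF h] single_in_l2E[of i y]] assms(2)[OF single_in_l2E[of i y]]
      by (simp add: pairing_single)
  qed
qed (use assms in auto)

text \<open>The dual norm is attained up to a factor arbitrarily close to one.\<close>

lemma almost_norming:
  assumes f: "coord f \<in> l2E'" and t: "0 \<le> t" "t < 1"
  obtains x :: "('g, 'y::complex_hilbert_space) ell2"
  where "norm x \<le> norm f" "t * (norm f)\<^sup>2 \<le> norm (dual_pairing (coord f) (coord x))"
proof -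
  have "\<exists>y. norm y \<le> norm (coord f i) \<and>
      blinfun_apply (coord f i) y = complex_of_real (t * (norm (coord f i))\<^sup>2)" for i
  proof (cases "coord f i = 0")
    case True
    then show ?thesis by (intro exI[of _ 0]) simp
  next
    case False
    define g where "g = coord f i"
    have g: "g \<in> dual_space" "0 < norm g" using f False by (auto simp: l2_def g_def)
    \<comment> \<open>Otherwise \<open>t\<close> times the norm of \<open>g\<close> would bound \<open>g\<close>.\<close>
    have "\<exists>y. t * norm g * norm y < norm (blinfun_apply g y)"
    proof (rule ccontr)
      assume "\<not> ?thesis"
      then have "norm g \<le> t * norm g" using t by (intro norm_blinfun_bound) (auto simp: not_less)
      then show False using g t by simp
    qed
    then obtain y where y: "t * norm g * norm y < norm (blinfun_apply g y)" by blast
    have gy: "0 < norm (blinfun_apply g y)"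
      using y t g by (smt (verit) mult_nonneg_nonneg norm_ge_zero)
    \<comment> \<open>The factor rotates and scales the value to a prescribed positive number.\<close>
    define c where "c = complex_of_real (t * (norm g)\<^sup>2) / blinfun_apply g y"
    have "blinfun_apply g (c *\<^sub>C y) = complex_of_real (t * (norm g)\<^sup>2)"
      using gy by (simp add: dual_spaceD[OF g(1)] c_def)
    moreover have "norm (c *\<^sub>C y) \<le> norm g"
    proof -
      have "norm g * (t * norm g * norm y) \<le> norm g * norm (blinfun_apply g y)"
        using y g by (intro mult_left_mono) auto
      then show ?thesis
        using gy t by (simp add: norm_scaleC c_def norm_divide norm_mult norm_power field_simps power2_eq_square)
    qed
    ultimately show ?thesis unfolding g_def by blast
  qed
  then obtain y where y: "\<And>i. norm (y i) \<le> norm (coord f i)"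
    "\<And>i. blinfun_apply (coord f i) (y i) = complex_of_real (t * (norm (coord f i))\<^sup>2)" by metis
  have "norm (y i) \<le> 1 * norm (coord f i)" for i using y(1)[of i] by simp
  note yb = norm_ell2_le[OF this, simplified]
  have "dual_pairing (coord f) (coord (Ell2 y)) = complex_of_real (t * (norm f)\<^sup>2)"
    unfolding dual_pairing_def coord_Ell2[OF yb(1)] y(2) norm_ell2_square
    by (intro infsumI has_sum_of_real has_sum_cmult_right has_sum_infsum summable_coord)
  then have "norm (dual_pairing (coord f) (coord (Ell2 y))) = t * (norm f)\<^sup>2"
    using t by (simp add: norm_mult norm_power)
  then show ?thesis using that[of "Ell2 y"] yb by (simp add: norm_Ell2)
qed

lemma dual_space_has_sum:
  assumes "(f has_sum g) I" "\<And>i. i \<in> I \<Longrightarrow> f i \<in> dual_space"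
  shows "g \<in> dual_space"
proof -
  have "blinfun_apply g (c *\<^sub>C y) = c * blinfun_apply g y" for c y
  proof -
    have ev: "((\<lambda>i. blinfun_apply (f i) y) has_sum blinfun_apply g y) I" for y
      by (rule has_sum_bounded_linear[OF _ assms(1)])
        (rule bounded_linear_intros | simp add: blinfun.bounded_linear_left)+
    have "((\<lambda>i. blinfun_apply (f i) (c *\<^sub>C y)) has_sum c * blinfun_apply g y) I"
      using has_sum_cmult_right[OF ev[of y], of c] assms(2)
      by (simp add: dual_spaceD cong: has_sum_cong)
    with ev[of "c *\<^sub>C y"] show ?thesis by (rule has_sum_unique)
  qed
  then show ?thesis by (simp add: dual_space_def scaleC_complex_def)
qed

lemma dual_space_scaleC: "f \<in> dual_space \<Longrightarrow> c *\<^sub>C f \<in> dual_space"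
  by (simp add: dual_space_def blinfun_apply_scaleC scaleC_complex_def mult.left_commute)

lemma dual_space_diff: "f \<in> dual_space \<Longrightarrow> g \<in> dual_space \<Longrightarrow> f - g \<in> dual_space"
  by (simp add: dual_space_def blinfun.diff_left scaleC_complex_def right_diff_distrib)

text \<open>The adjoint of \<open>\<Sum>\<^sub>j M\<^bsub>b j\<^esub> V\<^sub>j\<close> is the series of the transposed
  coefficients \<open>(b (- j)) (i - j)\<close>, hence an operator of the same kind on the dual space.\<close>

lemma adjoint_series:
  fixes A :: "('g::ab_group_add \<Rightarrow> 'y::complex_hilbert_space) \<Rightarrow> 'g \<Rightarrow> 'y"
  assumes rep: "wiener_representation A b" and f: "f \<in> l2E'"
  shows "adjoint_op A f \<in> l2E'"
    and "\<And>x. x \<in> l2E \<Longrightarrow> dual_pairing (adjoint_op A f) x = dual_pairing f (A x)"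
    and "\<And>i. ((\<lambda>j. f (i - j) o\<^sub>L b (- j) (i - j)) has_sum adjoint_op A f i) UNIV"
proof -
  define s where "s j = supnorm (b j)" for j
  have b: "\<And>j. b j \<in> linf_ops" and s: "\<And>j. 0 \<le> s j" "s summable_on UNIV"
    using rep by (auto simp: wiener_representation_def supnorm_nonneg s_def[abs_def])
  have bij: "bij_betw uminus UNIV (UNIV :: 'g set)"
    by (rule bij_betwI[where g=uminus]) auto
  have s': "\<And>j. 0 \<le> s (- j)" "(\<lambda>j. s (- j)) summable_on UNIV"
    using s summable_on_reindex_bij_betw[OF bij, of s] by auto
  note sf = l2_summable[OF f]
  have c: "norm (v o\<^sub>L b (- j) (i - j)) \<le> s (- j) * norm v" for j i and v :: "'y \<Rightarrow>\<^sub>L complex"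
    using norm_blinfun_compose[of v "b (- j) (i - j)"]
      mult_left_mono[OF norm_le_supnorm[OF b, of "- j" "i - j"] norm_ge_zero[of v]]
    by (simp add: s_def mult.commute)
  obtain Z G where Z: "(Z has_sum G) UNIV" "\<And>j i. coord (Z j) i = f (i - j) o\<^sub>L b (- j) (i - j)"
    and "norm G \<le> (\<Sum>\<^sub>\<infinity>j. s (- j)) * l2norm f"
    and G: "\<And>i. ((\<lambda>j. f (i - j) o\<^sub>L b (- j) (i - j)) has_sum coord G i) UNIV"
    by (rule convolution_series[where c="\<lambda>j i v. v o\<^sub>L b (- j) (i - j)", OF sf c s']) (rule that)
  have "f (i - j) o\<^sub>L b (- j) (i - j) \<in> dual_space" for i j
    using f b[of "- j"] by (simp add: l2_def dual_space_def linf_ops_def)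
  then have "coord G i \<in> dual_space" for i by (rule dual_space_has_sum[OF G])
  then have G_l2: "coord G \<in> l2E'" by (simp add: l2_def summable_coord)
  have pair: "dual_pairing (coord G) x = dual_pairing f (A x)" if x: "x \<in> l2E" for x
  proof -
    have c2: "norm (blinfun_apply (b j i) v) \<le> s j * norm v" for j i v
      using norm_blinfun[of "b j i" v] mult_right_mono[OF norm_le_supnorm[OF b, of j i] norm_ge_zero[of v]]
      by (simp add: s_def)
    obtain Y H where Y: "(Y has_sum H) UNIV" "\<And>j i. coord (Y j) i = blinfun_apply (b j i) (x (i - j))"
      and "norm H \<le> (\<Sum>\<^sub>\<infinity>j. s j) * l2norm x"
      and H: "\<And>i. ((\<lambda>j. blinfun_apply (b j i) (x (i - j))) has_sum coord H i) UNIV"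
      by (rule convolution_series[where c="\<lambda>j i. blinfun_apply (b j i)", OF l2_summable[OF x] c2 s]) (rule that)
    have AH: "A x = coord H"
      using has_sum_unique[OF wiener_has_sum[OF rep x] H] by blast
    interpret P: bounded_bilinear
      "\<lambda>(f :: ('g, 'y \<Rightarrow>\<^sub>L complex) ell2) (x :: ('g, 'y) ell2). dual_pairing (coord f) (coord x)"
      by (rule pairing_bounded_bilinear)
    have 1: "((\<lambda>j. dual_pairing (coord (Z j)) x) has_sum dual_pairing (coord G) x) UNIV"
      using has_sum_bounded_linear[OF P.bounded_linear_left[of "Ell2 x"] Z(1)] by (simp add: coord_Ell2_l2[OF x])
    have 2: "((\<lambda>j. dual_pairing f (coord (Y j))) has_sum dual_pairing f (coord H)) UNIV"
      using has_sum_bounded_linear[OF P.bounded_linear_right[of "Ell2 f"] Y(1)] by (simp add: coord_Ell2_l2[OF f])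
    have "dual_pairing (coord (Z (- j))) x = dual_pairing f (coord (Y j))" for j
    proof -
      have "bij_betw (\<lambda>i. i + j) UNIV UNIV" by (rule bij_betwI[where g="\<lambda>i. i - j"]) auto
      from infsum_reindex_bij_betw[OF this, of "\<lambda>i. blinfun_apply (f i) (coord (Y j) i)"]
      show ?thesis by (simp add: dual_pairing_def Y(2) Z(2))
    qed
    then have "((\<lambda>j. dual_pairing (coord (Z (- j))) x) has_sum dual_pairing f (coord H)) UNIV"
      using 2 by simp
    then have "((\<lambda>j. dual_pairing (coord (Z j)) x) has_sum dual_pairing f (coord H)) UNIV"
      using has_sum_reindex_bij_betw[OF bij, of "\<lambda>j. dual_pairing (coord (Z j)) x"] by simp
    with 1 show ?thesis unfolding AH by (rule has_sum_unique)
  qed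
  have "adjoint_op A f = coord G" by (rule adjoint_op_eqI[OF G_l2 pair])
  then show "adjoint_op A f \<in> l2E'"
    "\<And>x. x \<in> l2E \<Longrightarrow> dual_pairing (adjoint_op A f) x = dual_pairing f (A x)"
    "\<And>i. ((\<lambda>j. f (i - j) o\<^sub>L b (- j) (i - j)) has_sum adjoint_op A f i) UNIV"
    using G_l2 pair G by auto
qed

lemma adjoint_minus_scalar:
  fixes A :: "('g::ab_group_add \<Rightarrow> 'y::complex_hilbert_space) \<Rightarrow> 'g \<Rightarrow> 'y"
  assumes rep: "wiener_representation A b" and f: "f \<in> l2E'"
  shows "adjoint_op (minus_scalar A z) f = minus_scalar (adjoint_op A) z f"
    and "minus_scalar (adjoint_op A) z f \<in> l2E'"
    and "\<And>x. x \<in> l2E \<Longrightarrow>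
      dual_pairing (minus_scalar (adjoint_op A) z f) x = dual_pairing f (minus_scalar A z x)"
proof -
  note adj = adjoint_series[OF rep f]
  have eq: "minus_scalar (adjoint_op A) z f = coord (Ell2 (adjoint_op A f) - z *\<^sub>C Ell2 f)"
    by (auto simp: minus_scalar_def coord_Ell2_l2[OF adj(1)] coord_Ell2_l2[OF f])
  have in_dual: "minus_scalar (adjoint_op A) z f i \<in> dual_space" for i
    using adj(1) f by (simp add: minus_scalar_def l2_def dual_space_diff dual_space_scaleC)
  show m: "minus_scalar (adjoint_op A) z f \<in> l2E'"
    using in_dual summable_coord[of "Ell2 (adjoint_op A f) - z *\<^sub>C Ell2 f"]
    unfolding eq[symmetric] by (simp add: l2_def)
  show p: "dual_pairing (minus_scalar (adjoint_op A) z f) x = dual_pairing f (minus_scalar A z x)"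
    if x: "x \<in> l2E" for x
  proof -
    have Ax: "A x \<in> l2E" using rep x by (auto simp: wiener_representation_def bounded_operators_def)
    have s: "(\<lambda>i. blinfun_apply (h i) (y i)) summable_on UNIV" if "h \<in> l2E'" "y \<in> l2E"
      for h :: "'g \<Rightarrow> 'y \<Rightarrow>\<^sub>L complex" and y
      using abs_summable_summable[OF pairing_summable(1), of "Ell2 h" "Ell2 y"]
      by (simp add: coord_Ell2_l2[OF that(1)] coord_Ell2_l2[OF that(2)])
    have "dual_pairing (minus_scalar (adjoint_op A) z f) x
      = dual_pairing (adjoint_op A f) x - z * dual_pairing f x"
      using s[OF adj(1) x] summable_on_cmult_right[OF s[OF f x], of z]
      by (simp add: dual_pairing_def minus_scalar_def blinfun.diff_left blinfun_apply_scaleC scaleC_complex_def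
          infsum_diff infsum_cmult_right')
    also have "\<dots> = dual_pairing f (minus_scalar A z x)"
      using s[OF f Ax] summable_on_cmult_right[OF s[OF f x], of z] f
      by (simp add: adj(2)[OF x])
        (simp add: dual_pairing_def minus_scalar_def blinfun.diff_right dual_spaceD l2_def
          infsum_diff infsum_cmult_right')
    finally show ?thesis .
  qed
  show "adjoint_op (minus_scalar A z) f = minus_scalar (adjoint_op A) z f"
    by (rule adjoint_op_eqI[OF m p])
qed

section \<open>Coercive operators and the resolvent set\<close>

text \<open>The operator \<open>A - z\<close> on a subspace \<open>D\<close> is compared with an invertible operator \<open>B\<close> on
  all square-summable families; the second condition on \<open>D\<close> makes the inverse of \<open>B\<close> map
  \<open>D\<close> into itself.\<close>

lemma not_in_spectrumI:
  fixes B :: "('i, 'v::complex_normed_space) ell2 \<Rightarrow> ('i, 'v) ell2"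
  assumes add: "\<And>x y. B (x + y) = B x + B y" and scale: "\<And>c x. B (c *\<^sub>C x) = c *\<^sub>C B x"
    and below: "\<And>x. \<epsilon> * norm x \<le> norm (B x)" and \<epsilon>: "0 < \<epsilon>" and surj: "surj B"
    and D: "D \<subseteq> l2 UNIV UNIV" "\<And>x. coord (B x) \<in> D \<Longrightarrow> coord x \<in> D"
    and B: "\<And>x. x \<in> D \<Longrightarrow> coord (B (Ell2 x)) = minus_scalar A z x"
  shows "z \<notin> spectrum D A"
proof -
  have zero: "B 0 = 0" using add[of 0 0] by simp
  have diff: "B (x - y) = B x - B y" for x y using add[of "x - y" y] by simp
  have inj: "x = y" if "B x = B y" for x y
    using below[of "x - y"] \<epsilon> by (simp add: diff that mult_le_0_iff)
  define R where "R = inv B"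
  have BR: "B (R y) = y" for y unfolding R_def using surj by (rule surj_f_inv_f)
  have RB: "R (B x) = x" for x using inj BR by blast
  have R_add: "R (x + y) = R x + R y" for x y by (rule inj) (simp add: BR add)
  have R_scale: "R (c *\<^sub>C x) = c *\<^sub>C R x" for c x by (rule inj) (simp add: BR scale)
  define C where "C y = coord (R (Ell2 y))" for y
  have cE: "coord (Ell2 x) = x" if "x \<in> D" for x using D(1) that by (auto intro: coord_Ell2_l2)
  have E_add: "Ell2 (\<lambda>i. x i + y i) = Ell2 x + Ell2 y" if "x \<in> D" "y \<in> D" for x y
  proof -
    have "(\<lambda>i. x i + y i) = coord (Ell2 x + Ell2 y)" using that by (auto simp: cE)
    then show ?thesis by (simp add: coord_inverse)
  qed
  have E_scale: "Ell2 (\<lambda>i. c *\<^sub>C x i) = c *\<^sub>C Ell2 x" if "x \<in> D" for c x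
  proof -
    have "(\<lambda>i. c *\<^sub>C x i) = coord (c *\<^sub>C Ell2 x)" using that by (auto simp: cE)
    then show ?thesis by (simp add: coord_inverse)
  qed
  have C_D: "C y \<in> D" if "y \<in> D" for y unfolding C_def by (rule D(2)) (simp add: BR cE that)
  have "C \<in> bounded_operators D D"
    unfolding bounded_operators_def
  proof (intro CollectI conjI ballI allI)
    show "\<exists>K. \<forall>x\<in>D. l2norm (C x) \<le> K * l2norm x"
    proof (intro exI[of _ "1 / \<epsilon>"] ballI)
      fix x assume "x \<in> D"
      then show "l2norm (C x) \<le> 1 / \<epsilon> * l2norm x"
        using below[of "R (Ell2 x)"] \<epsilon> by (simp add: BR norm_ell2 cE C_def field_simps)
    qed
  qed (auto simp: C_D, simp_all add: C_def E_add E_scale R_add R_scale fun_eq_iff)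
  moreover have "C (minus_scalar A z x) = x" "minus_scalar A z (C x) = x" if x: "x \<in> D" for x
  proof -
    show "C (minus_scalar A z x) = x"
      using x by (simp add: B[symmetric] C_def coord_inverse RB cE)
    have "minus_scalar A z (C x) = coord (B (Ell2 (C x)))"
      using B[OF C_D[OF x]] by simp
    then show "minus_scalar A z (C x) = x" using x by (simp add: C_def coord_inverse BR cE)
  qed
  ultimately show ?thesis unfolding spectrum_def by blast
qed

text \<open>A form of the Lax--Milgram lemma.\<close>

lemma coercive_surj:
  fixes B :: "'h::complex_hilbert_space \<Rightarrow> 'h"
  assumes add: "\<And>x y. B (x + y) = B x + B y" and scale: "\<And>c x. B (c *\<^sub>C x) = c *\<^sub>C B x"
    and bounded: "\<And>x. norm (B x) \<le> M * norm x"
    and coercive: "\<And>x. m * (norm x)\<^sup>2 \<le> Re (cinner (B x) x)" and m: "0 < m"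
  shows "surj B" and "\<And>x. m * norm x \<le> norm (B x)"
proof -
  show below: "m * norm x \<le> norm (B x)" for x
  proof (cases "x = 0")
    case False
    have "m * norm x * norm x \<le> norm (B x) * norm x"
      using coercive[of x] cinner_le[of "B x" x] complex_Re_le_cmod[of "cinner (B x) x"]
      by (simp add: power2_eq_square)
    then show ?thesis using False by simp
  qed simp
  show "surj B"
  proof (rule bounded_below_surj[OF add scale bounded below m])
    fix w assume "\<And>x. cinner (B x) w = 0"
    then have "m * (norm w)\<^sup>2 \<le> 0" using coercive[of w] by simp
    then show "w = 0" using m by (simp add: mult_le_0_iff)
  qed
qed

section \<open>The bottom of the spectrum of a Dirichlet Laplacian\<close>

definition single :: "'i \<Rightarrow> 'v::real_normed_vector \<Rightarrow> ('i, 'v) ell2"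
  where "single i v = Ell2 (\<lambda>k. if k = i then v else 0)"

lemma coord_single: "coord (single i v) k = (if k = i then v else 0)"
  unfolding single_def
  by (subst coord_Ell2, rule finite_nonzero_values_imp_summable_on, rule finite_subset[of _ "{i}"]) auto

lemma norm_single: "norm (single i v) = norm v"
proof -
  have "(norm (single i v))\<^sup>2 = (\<Sum>\<^sub>\<infinity>k\<in>{i}. (norm v)\<^sup>2)"
    unfolding norm_ell2_square by (rule infsum_cong_neutral) (auto simp: coord_single)
  then show ?thesis by simp
qed

lemma bounded_linear_single: "bounded_linear (single i)"
  by (rule bounded_linear_intro[where K=1])
    (auto intro!: ell2_eqI simp: coord_single norm_single)

lemma coord_sum: "coord (\<Sum>k\<in>K. f k) i = (\<Sum>k\<in>K. coord (f k) i)"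
  by (rule linear_sum[OF bounded_linear.linear[OF bounded_linear_coord]])

lemma cinner_single: "cinner (single i v) X = cinner v (coord X i)"
proof -
  have "cinner (single i v) X = (\<Sum>\<^sub>\<infinity>k\<in>{i}. cinner v (coord X i))"
    unfolding cinner_ell2_def by (rule infsum_cong_neutral) (auto simp: coord_single cinner_zero_left)
  then show ?thesis by simp
qed

lemma cinner_sum_left: "cinner (\<Sum>k\<in>K. f k) x = (\<Sum>k\<in>K. cinner (f k) x)"
  by (induction K rule: infinite_finite_induct) (auto simp: cinner_zero_left cinner_add_left)

lemma has_sum_sum:
  fixes f :: "'k \<Rightarrow> 'i \<Rightarrow> real"
  assumes "\<And>k. k \<in> K \<Longrightarrow> (f k has_sum s k) I"
  shows "((\<lambda>i. \<Sum>k\<in>K. f k i) has_sum (\<Sum>k\<in>K. s k)) I"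
  using assms by (induction K rule: infinite_finite_induct) (auto intro!: has_sum_add)

text \<open>The weight \<open>\<kappa> (k - l)\<close> on the edge between \<open>k\<close> and \<open>l\<close> defines a translation
  invariant graph with constant weighted degree.\<close>

locale symmetric_kernel =
  fixes \<kappa> :: "'g::ab_group_add \<Rightarrow> real"
  assumes \<kappa>_nonneg: "0 \<le> \<kappa> j" and \<kappa>_symmetric: "\<kappa> (- j) = \<kappa> j" and \<kappa>_zero: "\<kappa> 0 = 0"
    and \<kappa>_summable: "\<kappa> summable_on UNIV"
begin

definition degree :: real where "degree = (\<Sum>\<^sub>\<infinity>j. \<kappa> j)"

lemma degree_nonneg: "0 \<le> degree"
  unfolding degree_def by (rule infsum_nonneg) (rule \<kappa>_nonneg)

lemma \<kappa>_diff: "\<kappa> (k - l) = \<kappa> (l - k)"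
  using \<kappa>_symmetric[of "k - l"] by simp

text \<open>Edges inside and outside the window together contribute the degree to the diagonal of the Dirichlet
  Laplacian, which is therefore the same for all windows.\<close>

definition lap :: "'g set \<Rightarrow> ('g \<Rightarrow> real) \<Rightarrow> 'g \<Rightarrow> real"
  where "lap W x k = degree * x k - (\<Sum>l\<in>W. \<kappa> (k - l) * x l)"

definition form :: "'g set \<Rightarrow> ('g \<Rightarrow> real) \<Rightarrow> real"
  where "form W x = (\<Sum>k\<in>W. x k * lap W x k)"

lemma has_sum_\<kappa>: "((\<lambda>l. \<kappa> (k - l)) has_sum degree) UNIV"
proof -
  have bij: "bij_betw (\<lambda>l. k - l) UNIV UNIV" by (rule bij_betwI[where g="\<lambda>l. k - l"]) auto
  show ?thesis
    using has_sum_reindex_bij_betw[OF bij, of \<kappa>] has_sum_infsum[OF \<kappa>_summable]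
    by (simp add: degree_def)
qed

lemma dirichlet_laplacian_eq:
  assumes W: "finite W" and k: "k \<in> W"
  shows "dirichlet_laplacian (\<lambda>k l. \<kappa> (k - l)) W x k
    = complex_of_real degree * x k - (\<Sum>l\<in>W. complex_of_real (\<kappa> (k - l)) * x l)"
proof -
  have "(\<Sum>\<^sub>\<infinity>l\<in>W \<union> (UNIV - W). \<kappa> (k - l)) = (\<Sum>\<^sub>\<infinity>l\<in>W. \<kappa> (k - l)) + (\<Sum>\<^sub>\<infinity>l\<in>UNIV - W. \<kappa> (k - l))"
    by (rule infsum_Un_disjoint)
      (use W has_sum_imp_summable[OF has_sum_\<kappa>[of k]] in \<open>auto intro: summable_on_subset_banach\<close>)
  moreover have "W \<union> (UNIV - W) = UNIV" by auto
  ultimately have "degree = (\<Sum>l\<in>W. \<kappa> (k - l)) + (\<Sum>\<^sub>\<infinity>l\<in>UNIV - W. \<kappa> (k - l))"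
    using infsumI[OF has_sum_\<kappa>[of k]] W by simp
  then have "complex_of_real degree = (\<Sum>l\<in>W. complex_of_real (\<kappa> (k - l))) + complex_of_real (\<Sum>\<^sub>\<infinity>l\<in>UNIV - W. \<kappa> (k - l))"
    by (simp only: of_real_add of_real_sum)
  then show ?thesis
    using k by (simp add: dirichlet_laplacian_def right_diff_distrib sum_subtractf sum_distrib_right distrib_right)
qed

lemma lap_add: "lap W (\<lambda>k. x k + t * y k) k = lap W x k + t * lap W y k"
  by (simp add: lap_def algebra_simps sum.distrib sum_distrib_left)

lemma lap_symmetric: "(\<Sum>k\<in>W. y k * lap W x k) = (\<Sum>k\<in>W. x k * lap W y k)"
proof -
  have "(\<Sum>k\<in>W. \<Sum>l\<in>W. y k * (\<kappa> (k - l) * x l)) = (\<Sum>l\<in>W. \<Sum>k\<in>W. y k * (\<kappa> (k - l) * x l))"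
    by (rule sum.swap)
  also have "\<dots> = (\<Sum>k\<in>W. \<Sum>l\<in>W. x k * (\<kappa> (k - l) * y l))"
    by (intro sum.cong refl) (simp add: \<kappa>_diff mult.commute mult.left_commute)
  finally show ?thesis
    by (simp add: lap_def right_diff_distrib sum_subtractf sum_distrib_left mult_ac)
qed

lemma form_add:
  "form W (\<lambda>k. x k + t * y k) = form W x + 2 * t * (\<Sum>k\<in>W. y k * lap W x k) + t\<^sup>2 * form W y"
proof -
  have "form W (\<lambda>k. x k + t * y k) = (\<Sum>k\<in>W. x k * lap W x k + t * (y k * lap W x k)
      + t * (x k * lap W y k) + t\<^sup>2 * (y k * lap W y k))"
    unfolding form_def lap_add by (intro sum.cong refl) (simp add: algebra_simps power2_eq_square)
  also have "\<dots> = form W x + t * (\<Sum>k\<in>W. y k * lap W x k) + t * (\<Sum>k\<in>W. x k * lap W y k) + t\<^sup>2 * form W y"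
    by (simp only: sum.distrib sum_distrib_left[symmetric] form_def)
  finally show ?thesis by (simp add: lap_symmetric[where W=W and x=x and y=y])
qed

lemma form_cong: "(\<And>k. k \<in> W \<Longrightarrow> x k = y k) \<Longrightarrow> form W x = form W y"
  unfolding form_def lap_def by (intro sum.cong refl) (simp cong: sum.cong)

lemma form_scale: "form W (\<lambda>k. t * x k) = t\<^sup>2 * form W x"
proof -
  have "lap W (\<lambda>k. t * x k) k = t * lap W x k" for k
    by (simp add: lap_def right_diff_distrib sum_distrib_left mult.left_commute)
  then show ?thesis by (simp add: form_def sum_distrib_left power2_eq_square mult_ac)
qed

text \<open>The form is continuous on the unit sphere of the functions on a finite window, which is
  compact.\<close>

lemma exists_minimiser:
  assumes W: "finite W" "W \<noteq> {}"
  obtains \<phi> where "\<And>k. k \<notin> W \<Longrightarrow> \<phi> k = 0" "(\<Sum>k\<in>W. (\<phi> k)\<^sup>2) = 1"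
    "\<And>x. form W \<phi> * (\<Sum>k\<in>W. (x k)\<^sup>2) \<le> form W x"
proof -
  define K where "K = PiE UNIV (\<lambda>k. if k \<in> W then {-1..1::real} else {0})"
  define S where "S = K \<inter> {x. (\<Sum>k\<in>W. (x k)\<^sup>2) = 1}"
  have "compact K"
    unfolding K_def compactin_euclidean_iff[symmetric] euclidean_product_topology[symmetric]
    by (subst compactin_PiE) auto
  moreover have "closed {x :: 'g \<Rightarrow> real. (\<Sum>k\<in>W. (x k)\<^sup>2) = 1}"
    by (intro closed_Collect_eq continuous_intros) auto
  ultimately have "compact S" unfolding S_def by (rule compact_Int_closed)
  obtain k0 where k0: "k0 \<in> W" using W by blast
  have "(\<Sum>k\<in>W. (if k = k0 then 1 else 0 :: real)\<^sup>2) = (\<Sum>k\<in>W. if k = k0 then 1 else 0)"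
    by (intro sum.cong) auto
  then have "(\<lambda>k. if k = k0 then 1 else 0) \<in> S"
    using k0 W by (auto simp: S_def K_def split: if_splits)
  then have "S \<noteq> {}" by blast
  have "continuous_on S (form W)"
    unfolding form_def[abs_def] lap_def
    by (intro continuous_intros continuous_on_subset[OF continuous_on_product_coordinates]) auto
  then obtain \<phi> where \<phi>: "\<phi> \<in> S" "\<And>x. x \<in> S \<Longrightarrow> form W \<phi> \<le> form W x"
    using continuous_attains_inf[OF \<open>compact S\<close> \<open>S \<noteq> {}\<close>] by blast
  show ?thesis
  proof (rule that)
    show "\<phi> k = 0" if "k \<notin> W" for k using \<phi>(1) that by (auto simp: S_def K_def PiE_iff split: if_splits)
    show "(\<Sum>k\<in>W. (\<phi> k)\<^sup>2) = 1" using \<phi>(1) by (simp add: S_def)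
    fix x :: "'g \<Rightarrow> real"
    define n where "n = (\<Sum>k\<in>W. (x k)\<^sup>2)"
    show "form W \<phi> * (\<Sum>k\<in>W. (x k)\<^sup>2) \<le> form W x"
    proof (cases "n = 0")
      case True
      then have "x k = 0" if "k \<in> W" for k
        using that W by (simp add: n_def sum_nonneg_eq_0_iff)
      then have "form W x = 0" by (simp add: form_def)
      then show ?thesis using True by (simp add: n_def)
    next
      case False
      have "0 \<le> n" by (simp add: n_def sum_nonneg)
      then have n: "0 < n" using False by simp
      define y where "y k = (if k \<in> W then inverse (sqrt n) * x k else 0)" for k
      have sq: "(y k)\<^sup>2 = (x k)\<^sup>2 / n" if "k \<in> W" for k
        using that n by (simp add: y_def power_mult_distrib field_simps)
      have "(\<Sum>k\<in>W. (y k)\<^sup>2) = 1"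
        using n by (simp add: sq sum_divide_distrib[symmetric] n_def[symmetric])
      moreover have "y k \<in> {-1..1}" if "k \<in> W" for k
      proof -
        have "(x k)\<^sup>2 \<le> n" unfolding n_def by (rule member_le_sum) (use that W in auto)
        then have "(y k)\<^sup>2 \<le> 1" using n by (simp add: sq[OF that])
        then show ?thesis using abs_le_square_iff[of "y k" 1] by auto
      qed
      ultimately have "y \<in> S" by (auto simp: S_def K_def y_def)
      then have "form W \<phi> \<le> form W y" by (rule \<phi>(2))
      also have "\<dots> = form W (\<lambda>k. inverse (sqrt n) * x k)" by (rule form_cong) (simp add: y_def)
      also have "\<dots> = form W x / n" unfolding form_scale using n by (simp add: power_inverse field_simps)
      finally show ?thesis using n by (simp add: n_def[symmetric] field_simps)
    qed
  qed
qed

lemma minimiser_eigenvector: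
  assumes W: "finite W" and unit: "(\<Sum>k\<in>W. (\<phi> k)\<^sup>2) = 1"
    and min: "\<And>x. form W \<phi> * (\<Sum>k\<in>W. (x k)\<^sup>2) \<le> form W x" and k: "k \<in> W"
  shows "lap W \<phi> k = form W \<phi> * \<phi> k"
proof -
  define r where "r = form W \<phi>"
  \<comment> \<open>Vary \<open>\<phi>\<close> in the direction of its defect as an eigenvector.\<close>
  define y where "y k = lap W \<phi> k - r * \<phi> k" for k
  define a where "a = (\<Sum>k\<in>W. (y k)\<^sup>2)"
  define c where "c = form W y - r * a"
  have "0 \<le> a" by (simp add: a_def sum_nonneg)
  have quad: "0 \<le> 2 * t * a + t\<^sup>2 * c" for t
  proof -
    have 1: "(\<Sum>k\<in>W. (\<phi> k + t * y k)\<^sup>2) = 1 + 2 * t * (\<Sum>k\<in>W. \<phi> k * y k) + t\<^sup>2 * a"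
    proof -
      have "(\<Sum>k\<in>W. (\<phi> k + t * y k)\<^sup>2) = (\<Sum>k\<in>W. (\<phi> k)\<^sup>2 + 2 * t * (\<phi> k * y k) + t\<^sup>2 * (y k)\<^sup>2)"
        by (intro sum.cong refl) (simp add: power2_eq_square algebra_simps)
      then show ?thesis by (simp add: sum.distrib sum_distrib_left[symmetric] unit a_def)
    qed
    have 2: "a = (\<Sum>k\<in>W. y k * lap W \<phi> k) - r * (\<Sum>k\<in>W. \<phi> k * y k)"
      by (simp add: a_def sum_distrib_left sum_subtractf[symmetric])
        (intro sum.cong refl, simp add: y_def power2_eq_square algebra_simps)
    have "r * (\<Sum>k\<in>W. (\<phi> k + t * y k)\<^sup>2) \<le> form W (\<lambda>k. \<phi> k + t * y k)"
      using min[of "\<lambda>k. \<phi> k + t * y k"] by (simp add: r_def)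
    then have "r * (1 + 2 * t * (\<Sum>k\<in>W. \<phi> k * y k) + t\<^sup>2 * a)
        \<le> r + 2 * t * (a + r * (\<Sum>k\<in>W. \<phi> k * y k)) + t\<^sup>2 * form W y"
      unfolding 1 form_add r_def[symmetric] 2 by simp
    then show ?thesis unfolding c_def by (simp add: algebra_simps)
  qed
  have "a = 0"
  proof (rule ccontr)
    assume "a \<noteq> 0"
    then have a: "0 < a" using \<open>0 \<le> a\<close> by simp
    define C where "C = \<bar>c\<bar> + 1"
    have C: "0 < C" "c < C" by (auto simp: C_def)
    have "0 \<le> 2 * (- a / C) * a + (- a / C)\<^sup>2 * c" by (rule quad)
    also have "(- a / C)\<^sup>2 * c \<le> (- a / C)\<^sup>2 * C" using C by (intro mult_left_mono) auto
    also have "2 * (- a / C) * a + (- a / C)\<^sup>2 * C = - (a\<^sup>2 / C)"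
      using C by (simp add: field_simps power2_eq_square)
    finally show False using a C by (simp add: divide_le_0_iff)
  qed
  then have "(y k)\<^sup>2 = 0" using W k by (simp add: a_def sum_nonneg_eq_0_iff)
  then show ?thesis by (simp add: y_def r_def)
qed

text \<open>The minimum of the form is an eigenvalue.  For real \<open>r\<close> below it, \<open>L - r\<close> on the window,
  extended by the identity to all families, is coercive and hence invertible.\<close>

lemma min_spec_dirichlet_eq:
  assumes W: "finite W" and supp: "\<And>k. k \<notin> W \<Longrightarrow> \<phi> k = 0" and unit: "(\<Sum>k\<in>W. (\<phi> k)\<^sup>2) = 1"
    and min: "\<And>x. form W \<phi> * (\<Sum>k\<in>W. (x k)\<^sup>2) \<le> form W x"
  shows "min_spec_dirichlet (\<lambda>k l. \<kappa> (k - l)) W = form W \<phi>"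
  unfolding min_spec_dirichlet_def
proof (rule Least_equality)
  let ?L = "dirichlet_laplacian (\<lambda>k l. \<kappa> (k - l)) W"
  let ?D = "l2 W UNIV :: ('g \<Rightarrow> complex) set"
  have L0: "?L x k = 0" if "k \<notin> W" for k x using that by (simp add: dirichlet_laplacian_def)
  show "complex_of_real (form W \<phi>) \<in> spectrum ?D ?L"
  proof (rule ccontr)
    assume "\<not> ?thesis"
    then obtain C where C: "C \<in> bounded_operators ?D ?D"
      "\<And>x. x \<in> ?D \<Longrightarrow> C (minus_scalar ?L (complex_of_real (form W \<phi>)) x) = x"
      by (auto simp: spectrum_def)
    define x where "x k = complex_of_real (\<phi> k)" for k
    have "(\<lambda>i. (norm (x i))\<^sup>2) summable_on UNIV"
      by (rule finite_nonzero_values_imp_summable_on, rule finite_subset[OF _ W])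
        (use supp in \<open>auto simp: x_def\<close>)
    then have x: "x \<in> ?D" using supp by (auto simp: l2_def x_def)
    have "minus_scalar ?L (complex_of_real (form W \<phi>)) x k = 0" for k
    proof (cases "k \<in> W")
      case True
      have "?L x k = complex_of_real (lap W \<phi> k)"
        by (simp add: dirichlet_laplacian_eq[OF W True] lap_def x_def)
      then show ?thesis
        by (simp add: minus_scalar_def minimiser_eigenvector[OF W unit min True] scaleC_complex_def x_def)
    qed (simp add: minus_scalar_def L0 x_def supp scaleC_complex_def)
    then have "minus_scalar ?L (complex_of_real (form W \<phi>)) x = (\<lambda>i. 0 *\<^sub>C x i)"
      by (simp add: fun_eq_iff scaleC_complex_def)
    moreover have "C (\<lambda>i. 0 *\<^sub>C x i) = (\<lambda>i. 0 *\<^sub>C C x i)"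
      using C(1) x unfolding bounded_operators_def by blast
    ultimately have "x = (\<lambda>i. 0 *\<^sub>C C x i)"
      using C(2)[OF x] by simp
    then have "x k = 0" for k using fun_cong[of x _ k] by (simp add: scaleC_complex_def)
    then have "\<phi> k = 0" for k by (simp add: x_def)
    then show False using unit by simp
  qed
  fix r assume r: "complex_of_real r \<in> spectrum ?D ?L"
  show "form W \<phi> \<le> r"
  proof (rule ccontr)
    assume "\<not> ?thesis"
    then have less: "r < form W \<phi>" by simp
    \<comment> \<open>The operator \<open>L - r\<close> on the window and the identity elsewhere.\<close>
    define h :: "'g \<Rightarrow> ('g, complex) ell2 \<Rightarrow> complex" where
      "h i X = complex_of_real (degree - r - 1) * coord X i - (\<Sum>l\<in>W. complex_of_real (\<kappa> (i - l)) * coord X l)" for i X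
    define T :: "('g, complex) ell2 \<Rightarrow> ('g, complex) ell2" where "T X = X + (\<Sum>i\<in>W. single i (h i X))" for X
    have "bounded_linear (h i)" for i
      unfolding h_def[abs_def]
      by (intro bounded_linear_sub bounded_linear_sum bounded_linear_compose[OF bounded_linear_mult_right]
          bounded_linear_coord)
    then have bl: "bounded_linear T"
      unfolding T_def[abs_def]
      by (intro bounded_linear_add bounded_linear_ident bounded_linear_sum
          bounded_linear_compose[OF bounded_linear_single])
    then obtain M where M: "\<And>X. norm (T X) \<le> M * norm X"
      using bounded_linear.bounded[OF bl] by (auto simp: mult.commute)
    have cT: "coord (T X) i = (if i \<in> W then coord X i + h i X else coord X i)" for X i
      using W by (simp add: T_def coord_sum coord_single)
    have h_scale: "h i (c *\<^sub>C X) = c * h i X" for i c X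
      by (simp add: h_def scaleC_complex_def right_diff_distrib sum_distrib_left mult.left_commute)
    have T_scale: "T (c *\<^sub>C X) = c *\<^sub>C T X" for c X
      by (rule ell2_eqI) (simp add: cT h_scale scaleC_complex_def distrib_left)
    define m where "m = min 1 (form W \<phi> - r)"
    have m: "0 < m" "m \<le> 1" "m \<le> form W \<phi> - r" using less by (auto simp: m_def)
    have coercive: "m * (norm X)\<^sup>2 \<le> Re (cinner (T X) X)" for X
    proof -
      define x y where "x k = Re (coord X k)" and "y k = Im (coord X k)" for k
      define n where "n = (\<Sum>k\<in>W. (x k)\<^sup>2) + (\<Sum>k\<in>W. (y k)\<^sup>2)"
      have "n = (\<Sum>k\<in>W. (norm (coord X k))\<^sup>2)"
        by (simp add: n_def x_def y_def cmod_power2 sum.distrib)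
      also have "\<dots> \<le> (norm X)\<^sup>2"
        unfolding norm_ell2_square by (rule finite_sum_le_infsum[OF summable_coord W]) auto
      finally have n: "n \<le> (norm X)\<^sup>2" .
      have "Re (h k X * cnj (coord X k)) =
          x k * lap W x k + y k * lap W y k - (r + 1) * ((x k)\<^sup>2 + (y k)\<^sup>2)" for k
        by (simp add: h_def lap_def x_def y_def left_diff_distrib right_diff_distrib distrib_left distrib_right power2_eq_square)
      then have "Re (cinner (T X) X) = (norm X)\<^sup>2 + (form W x + form W y - (r + 1) * n)"
        by (simp add: T_def cinner_add_left cinner_self cinner_sum_left cinner_single cinner_complex_def
            n_def form_def sum.distrib sum_subtractf sum_distrib_left[symmetric])
      moreover have "form W \<phi> * n \<le> form W x + form W y"
        using min[of x] min[of y] by (simp add: n_def distrib_left)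
      ultimately have "(norm X)\<^sup>2 + (form W \<phi> - r - 1) * n \<le> Re (cinner (T X) X)"
        by (simp add: algebra_simps)
      moreover have "m * (norm X)\<^sup>2 \<le> (norm X)\<^sup>2 + (form W \<phi> - r - 1) * n"
      proof -
        have "0 \<le> n" by (simp add: n_def sum_nonneg)
        then have "(m - 1) * n \<le> (form W \<phi> - r - 1) * n" using m by (intro mult_right_mono) auto
        moreover have "(m - 1) * (norm X)\<^sup>2 \<le> (m - 1) * n" using m n by (intro mult_left_mono_neg) auto
        ultimately show ?thesis by (simp add: algebra_simps)
      qed
      ultimately show ?thesis by linarith
    qed
    have T_add: "T (x + y) = T x + T y" for x y using bl by (simp add: linear_simps)
    note cs = coercive_surj[OF T_add T_scale M coercive m(1)]
    have "complex_of_real r \<notin> spectrum ?D ?L"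
    proof (rule not_in_spectrumI[OF T_add T_scale cs(2) m(1) cs(1)])
      show "?D \<subseteq> l2 UNIV UNIV" by (auto simp: l2_def)
      show "coord X \<in> ?D" if "coord (T X) \<in> ?D" for X
        using that summable_coord[of X] by (auto simp: l2_def cT)
      show "coord (T (Ell2 x)) = minus_scalar ?L (complex_of_real r) x" if x: "x \<in> ?D" for x
      proof
        fix k
        show "coord (T (Ell2 x)) k = minus_scalar ?L (complex_of_real r) x k"
          using x by (cases "k \<in> W")
            (auto simp: cT coord_Ell2_l2[OF x] h_def minus_scalar_def dirichlet_laplacian_eq[OF W]
              scaleC_complex_def L0 l2_def algebra_simps)
      qed
    qed
    with r show False by simp
  qed
qed

text \<open>The form of the Laplacian is the Dirichlet energy, arranged by edge directions.  The factor is two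
  because every edge belongs to two opposite directions.\<close>

lemma energy_has_sum:
  assumes W: "finite W" and supp: "\<And>k. k \<notin> W \<Longrightarrow> \<phi> k = 0"
  shows "((\<lambda>j. \<kappa> j * difference_energy \<phi> j) has_sum 2 * form W \<phi>) UNIV"
proof -
  define n where "n = (\<Sum>k\<in>W. (\<phi> k)\<^sup>2)"
  have hn: "((\<lambda>k. (\<phi> k)\<^sup>2) has_sum n) UNIV"
    unfolding n_def by (rule has_sum_finite_neutralI[OF W subset_UNIV]) (use supp in auto)
  have D: "difference_energy \<phi> j = 2 * n - 2 * (\<Sum>i\<in>W. \<phi> i * \<phi> (i - j))" for j
  proof -
    have bij: "bij_betw (\<lambda>i. i - j) UNIV UNIV" by (rule bij_betwI[where g="\<lambda>i. i + j"]) auto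
    have 1: "((\<lambda>i. (\<phi> (i - j))\<^sup>2) has_sum n) UNIV"
      using has_sum_reindex_bij_betw[OF bij, of "\<lambda>k. (\<phi> k)\<^sup>2"] hn by simp
    have 2: "((\<lambda>i. - 2 * (\<phi> i * \<phi> (i - j))) has_sum (- 2 * (\<Sum>i\<in>W. \<phi> i * \<phi> (i - j)))) UNIV"
      by (intro has_sum_cmult_right has_sum_finite_neutralI[OF W subset_UNIV]) (use supp in auto)
    have "((\<lambda>i. (\<phi> (i - j) - \<phi> i)\<^sup>2) has_sum (n + n + - 2 * (\<Sum>i\<in>W. \<phi> i * \<phi> (i - j)))) UNIV"
      using has_sum_add[OF has_sum_add[OF 1 hn] 2] by (simp add: power2_diff mult_ac)
    then show ?thesis unfolding difference_energy_def by (simp add: infsumI)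
  qed
  have conv: "((\<lambda>j. \<kappa> j * \<phi> (i - j)) has_sum (\<Sum>l\<in>W. \<kappa> (i - l) * \<phi> l)) UNIV" for i
  proof -
    have bij: "bij_betw (\<lambda>j. i - j) UNIV UNIV" by (rule bij_betwI[where g="\<lambda>j. i - j"]) auto
    have "((\<lambda>l. \<kappa> (i - l) * \<phi> l) has_sum (\<Sum>l\<in>W. \<kappa> (i - l) * \<phi> l)) UNIV"
      by (rule has_sum_finite_neutralI[OF W subset_UNIV]) (use supp in auto)
    then show ?thesis
      using has_sum_reindex_bij_betw[OF bij, of "\<lambda>l. \<kappa> (i - l) * \<phi> l"] by simp
  qed
  have "((\<lambda>j. \<Sum>i\<in>W. - 2 * \<phi> i * (\<kappa> j * \<phi> (i - j))) has_sum
      (\<Sum>i\<in>W. - 2 * \<phi> i * (\<Sum>l\<in>W. \<kappa> (i - l) * \<phi> l))) UNIV"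
    by (rule has_sum_sum) (intro has_sum_cmult_right conv)
  moreover have "((\<lambda>j. 2 * n * \<kappa> j) has_sum 2 * n * degree) UNIV"
    unfolding degree_def by (intro has_sum_cmult_right has_sum_infsum \<kappa>_summable)
  ultimately have "((\<lambda>j. 2 * n * \<kappa> j + (\<Sum>i\<in>W. - 2 * \<phi> i * (\<kappa> j * \<phi> (i - j)))) has_sum
      2 * n * degree + (\<Sum>i\<in>W. - 2 * \<phi> i * (\<Sum>l\<in>W. \<kappa> (i - l) * \<phi> l))) UNIV"
    by (intro has_sum_add)
  moreover have "2 * n * \<kappa> j + (\<Sum>i\<in>W. - 2 * \<phi> i * (\<kappa> j * \<phi> (i - j))) = \<kappa> j * difference_energy \<phi> j" for j
    by (simp add: D right_diff_distrib sum_distrib_left sum_negf mult_ac)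
  moreover have "2 * n * degree + (\<Sum>i\<in>W. - 2 * \<phi> i * (\<Sum>l\<in>W. \<kappa> (i - l) * \<phi> l)) = 2 * form W \<phi>"
    by (simp add: form_def lap_def n_def right_diff_distrib sum_subtractf sum_distrib_left sum_distrib_right
        sum_negf power2_eq_square mult_ac)
  ultimately show ?thesis by simp
qed

lemma form_nonneg:
  assumes "finite W" "\<And>k. k \<notin> W \<Longrightarrow> \<phi> k = 0"
  shows "0 \<le> form W \<phi>"
  using has_sum_nonneg[OF energy_has_sum[OF assms]] \<kappa>_nonneg
  by (auto simp: difference_energy_def infsum_nonneg)

end

section \<open>Almost invariant finite sets in Abelian groups\<close>

lemma polynomial_below_exponential:
  assumes "0 < \<delta>"
  obtains N where "real (Suc N) ^ c < (1 + \<delta>) ^ N"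
proof -
  define L where "L = ln (1 + \<delta>)"
  have L: "0 < L" using assms by (simp add: L_def)
  have "filterlim (\<lambda>N. L * real N) at_top sequentially"
    by (rule filterlim_tendsto_pos_mult_at_top[OF tendsto_const L filterlim_real_sequentially])
  from filterlim_compose[OF tendsto_power_div_exp_0 this, of c]
  have "((\<lambda>N. (L * real N) ^ c / exp (L * real N)) \<longlongrightarrow> 0) sequentially" .
  moreover have "0 < (L / 2) ^ c" using L by simp
  ultimately have "\<forall>\<^sub>F N in sequentially. (L * real N) ^ c / exp (L * real N) < (L / 2) ^ c"
    by (rule order_tendstoD(2))
  then have "\<forall>\<^sub>F N in sequentially. (L * real N) ^ c / exp (L * real N) < (L / 2) ^ c \<and> 1 \<le> N"
    using eventually_ge_at_top[of 1] by eventually_elim auto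
  then obtain N where N: "(L * real N) ^ c / exp (L * real N) < (L / 2) ^ c" "1 \<le> N"
    using eventually_happens[of _ sequentially] by auto
  have "(L / 2) ^ c * real (Suc N) ^ c \<le> (L / 2) ^ c * (2 * real N) ^ c"
    using N(2) L by (intro mult_left_mono power_mono) auto
  also have "\<dots> = (L * real N) ^ c" unfolding power_mult_distrib[symmetric] by simp
  also have "\<dots> < (L / 2) ^ c * exp (L * real N)" using N(1) by (simp add: pos_divide_less_eq)
  also have "exp (L * real N) = (1 + \<delta>) ^ N"
    using exp_of_nat_mult[of N L] assms by (simp add: L_def mult.commute)
  finally show ?thesis using that L by (simp add: mult_less_cancel_left_pos)
qed

text \<open>The sums of at most \<open>N\<close> copies of each element of a finite set grow polynomially in \<open>N\<close>,
  so they cannot grow by a fixed factor at every step.\<close>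

lemma exists_almost_invariant:
  fixes J :: "'g::ab_group_add set"
  assumes J: "finite J" and \<delta>: "0 < \<delta>"
  obtains F where "finite F" "F \<noteq> {}" "\<And>j. j \<in> J \<Longrightarrow> real (card {k \<in> F. k - j \<notin> F}) \<le> \<delta> * real (card F)"
proof -
  \<comment> \<open>Multiples in the group; negated generators turn subtraction of \<open>j\<close> into one further
    summand.\<close>
  define mul :: "nat \<Rightarrow> 'g \<Rightarrow> 'g" where "mul n x = (\<Sum>_\<in>{..<n}. x)" for n x
  define F where "F N = (\<lambda>n. \<Sum>j\<in>J. mul (n j) (- j)) ` (J \<rightarrow>\<^sub>E {..N})" for N
  have fin: "finite (F N)" for N unfolding F_def using J by (intro finite_imageI finite_PiE) auto
  have ne: "F N \<noteq> {}" for N by (auto simp: F_def PiE_eq_empty_iff)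
  have mono: "F N \<subseteq> F (Suc N)" for N unfolding F_def by (intro image_mono PiE_mono) auto
  have step: "k - j \<in> F (Suc N)" if k: "k \<in> F N" and j: "j \<in> J" for k j N
  proof -
    obtain n where n: "n \<in> J \<rightarrow>\<^sub>E {..N}" "k = (\<Sum>j\<in>J. mul (n j) (- j))" using k by (auto simp: F_def)
    define n' where "n' = n(j := Suc (n j))"
    have "(\<Sum>i\<in>J. mul (n' i) (- i)) = mul (Suc (n j)) (- j) + (\<Sum>i\<in>J - {j}. mul (n i) (- i))"
      using J j by (simp add: sum.remove[OF J j] n'_def)
    also have "\<dots> = (\<Sum>i\<in>J. mul (n i) (- i)) - j"
      using J j by (simp add: sum.remove[OF J j] mul_def algebra_simps)
    finally have "k - j = (\<Sum>i\<in>J. mul (n' i) (- i))" using n by simp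
    moreover have "n' \<in> J \<rightarrow>\<^sub>E {..Suc N}"
      using n(1) j by (auto simp: n'_def PiE_iff extensional_def le_SucI)
    ultimately show ?thesis unfolding F_def by blast
  qed
  have card_le: "card (F N) \<le> Suc N ^ card J" for N
    using card_image_le[of "J \<rightarrow>\<^sub>E {..N}" "\<lambda>n. \<Sum>j\<in>J. mul (n j) (- j)"] J
    by (simp add: F_def card_PiE finite_PiE)
  have "\<exists>N. real (card (F (Suc N))) \<le> (1 + \<delta>) * real (card (F N))"
  proof (rule ccontr)
    assume "\<not> ?thesis"
    then have grow: "(1 + \<delta>) * real (card (F N)) \<le> real (card (F (Suc N)))" for N
      by (simp add: not_le less_imp_le)
    have "(1 + \<delta>) ^ N \<le> real (card (F N))" for N
    proof (induction N)
      case 0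
      then show ?case using fin[of 0] ne[of 0] by (simp add: Suc_le_eq card_gt_0_iff)
    next
      case (Suc N)
      have "(1 + \<delta>) ^ Suc N \<le> (1 + \<delta>) * real (card (F N))" using Suc \<delta> by simp
      with grow[of N] show ?case by linarith
    qed
    moreover have "real (card (F N)) \<le> real (Suc N) ^ card J" for N
      using card_le[of N] by (simp only: of_nat_power[symmetric] of_nat_le_iff)
    moreover obtain N where "real (Suc N) ^ card J < (1 + \<delta>) ^ N"
      using polynomial_below_exponential[OF \<delta>] by blast
    ultimately show False by (meson leD order_trans)
  qed
  then obtain N where N: "real (card (F (Suc N))) \<le> (1 + \<delta>) * real (card (F N))" by blast
  have "real (card {k \<in> F N. k - j \<notin> F N}) \<le> \<delta> * real (card (F N))" if j: "j \<in> J" for j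
  proof -
    have "card {k \<in> F N. k - j \<notin> F N} = card ((\<lambda>k. k - j) ` {k \<in> F N. k - j \<notin> F N})"
      by (rule card_image[symmetric]) (auto intro: inj_onI)
    also have "\<dots> \<le> card (F (Suc N) - F N)"
      by (rule card_mono) (use fin step j in auto)
    also have "\<dots> = card (F (Suc N)) - card (F N)"
      by (rule card_Diff_subset) (use fin mono in auto)
    finally have "real (card {k \<in> F N. k - j \<notin> F N}) \<le> real (card (F (Suc N))) - real (card (F N))"
      using card_mono[OF fin mono[of N]] by linarith
    also have "\<dots> \<le> \<delta> * real (card (F N))" using N by (simp add: algebra_simps)
    finally show ?thesis .
  qed
  with fin ne show ?thesis using that by blast
qed

context symmetric_kernel
begin

text \<open>The energy of an indicator function is the total weight of the edges that leave the set.  Outside a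
  finite set \<open>J\<close> of directions the weights are negligible, and in the directions in \<open>J\<close> only few
  points of an almost invariant set have an edge that leaves it.\<close>

lemma exists_small_energy:
  assumes \<delta>: "0 < \<delta>"
  obtains F where "finite F" "F \<noteq> {}"
    "\<And>W. finite W \<Longrightarrow> F \<subseteq> W \<Longrightarrow> form W (\<lambda>k. if k \<in> F then 1 else 0) \<le> \<delta> * real (card F)"
proof -
  define e where "e = \<delta> / (degree + 1)"
  have e: "0 < e" "e * (degree + 1) = \<delta>" using \<delta> degree_nonneg by (auto simp: e_def)
  obtain J where J: "finite J" "dist (sum \<kappa> J) degree \<le> e"
    using has_sum_finite_approximation[OF has_sum_infsum[OF \<kappa>_summable] e(1)]
    by (auto simp: degree_def)
  have J_le: "sum \<kappa> J \<le> degree"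
    unfolding degree_def by (rule finite_sum_le_infsum[OF \<kappa>_summable J(1)]) (auto simp: \<kappa>_nonneg)
  obtain F where F: "finite F" "F \<noteq> {}"
    "\<And>j. j \<in> J \<Longrightarrow> real (card {k \<in> F. k - j \<notin> F}) \<le> e * real (card F)"
    using exists_almost_invariant[OF J(1) e(1)] by blast
  have "form W (\<lambda>k. if k \<in> F then 1 else 0) \<le> \<delta> * real (card F)" if W: "finite W" "F \<subseteq> W" for W
  proof -
    have ind: "(\<Sum>k\<in>W. (if k \<in> F then 1 else 0) * f k) = (\<Sum>k\<in>F. f k)" for f :: "'g \<Rightarrow> real"
      using W by (intro sum.mono_neutral_cong_right) auto
    have ind': "(\<Sum>k\<in>W. f k * (if k \<in> F then 1 else 0)) = (\<Sum>k\<in>F. f k)" for f :: "'g \<Rightarrow> real"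
      using ind[of f] by (simp add: mult.commute)
    have "form W (\<lambda>k. if k \<in> F then 1 else 0) = (\<Sum>k\<in>F. degree - (\<Sum>l\<in>F. \<kappa> (k - l)))"
      unfolding form_def lap_def ind ind' by (intro sum.cong) auto
    also have "\<dots> \<le> (\<Sum>k\<in>F. e + (\<Sum>j\<in>J. if k - j \<notin> F then \<kappa> j else 0))"
    proof (rule sum_mono)
      fix k assume "k \<in> F"
      have "(\<Sum>j\<in>J. if k - j \<in> F then \<kappa> j else 0) = (\<Sum>j\<in>{j\<in>J. k - j \<in> F}. \<kappa> j)"
        by (rule sum.inter_filter[symmetric]) (rule J)
      also have "\<dots> = (\<Sum>l\<in>(\<lambda>j. k - j) ` {j\<in>J. k - j \<in> F}. \<kappa> (k - l))"
        by (subst sum.reindex) (auto intro: inj_onI)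
      also have "\<dots> \<le> (\<Sum>l\<in>F. \<kappa> (k - l))"
        by (rule sum_mono2) (use F \<kappa>_nonneg in auto)
      finally have 1: "(\<Sum>j\<in>J. if k - j \<in> F then \<kappa> j else 0) \<le> (\<Sum>l\<in>F. \<kappa> (k - l))" .
      have "sum \<kappa> J = (\<Sum>j\<in>J. if k - j \<in> F then \<kappa> j else 0) + (\<Sum>j\<in>J. if k - j \<notin> F then \<kappa> j else 0)"
        unfolding sum.distrib[symmetric] by (intro sum.cong) auto
      moreover have "degree \<le> sum \<kappa> J + e" using J(2) by (simp add: dist_real_def)
      ultimately show "degree - (\<Sum>l\<in>F. \<kappa> (k - l)) \<le> e + (\<Sum>j\<in>J. if k - j \<notin> F then \<kappa> j else 0)"
        using 1 by linarith
    qed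
    also have "\<dots> = e * real (card F) + (\<Sum>j\<in>J. \<kappa> j * real (card {k \<in> F. k - j \<notin> F}))"
    proof -
      have "(\<Sum>k\<in>F. \<Sum>j\<in>J. if k - j \<notin> F then \<kappa> j else 0) = (\<Sum>j\<in>J. \<Sum>k\<in>F. if k - j \<notin> F then \<kappa> j else 0)"
        by (rule sum.swap)
      also have "\<dots> = (\<Sum>j\<in>J. \<kappa> j * real (card {k \<in> F. k - j \<notin> F}))"
        using F(1) by (simp add: sum.inter_filter[symmetric] mult.commute)
      finally show ?thesis by (simp add: sum.distrib mult.commute)
    qed
    also have "\<dots> \<le> e * real (card F) + (\<Sum>j\<in>J. \<kappa> j * (e * real (card F)))"
      by (intro add_left_mono sum_mono mult_left_mono F(3) \<kappa>_nonneg)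
    also have "\<dots> = e * real (card F) * (1 + sum \<kappa> J)"
      unfolding sum_distrib_right[symmetric] by (simp add: algebra_simps)
    also have "\<dots> \<le> e * real (card F) * (1 + degree)"
      using J_le e(1) by (intro mult_left_mono) auto
    also have "\<dots> = \<delta> * real (card F)" by (simp add: e(2)[symmetric] mult_ac add.commute)
    finally show ?thesis .
  qed
  with F show ?thesis using that by blast
qed

text \<open>Each window that contains the support of a fixed test function has its energy quotient as an upper
  bound for the bottom of the spectrum.\<close>

lemma min_spec_dirichlet_tendsto_0:
  assumes W: "\<And>n. finite (W n)" "\<And>n. W n \<noteq> {}" "\<And>n. W n \<subseteq> W (Suc n)" "(\<Union>n. W n) = UNIV"
  shows "(\<lambda>n. min_spec_dirichlet (\<lambda>k l. \<kappa> (k - l)) (W n)) \<longlonglongrightarrow> 0"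
proof -
  have "\<exists>\<phi>. (\<forall>k. k \<notin> W n \<longrightarrow> \<phi> k = 0) \<and> (\<Sum>k\<in>W n. (\<phi> k)\<^sup>2) = 1
      \<and> (\<forall>x. form (W n) \<phi> * (\<Sum>k\<in>W n. (x k)\<^sup>2) \<le> form (W n) x)" for n
    using exists_minimiser[OF W(1,2)[of n]] by metis
  then obtain \<phi> where \<phi>: "\<And>n k. k \<notin> W n \<Longrightarrow> \<phi> n k = 0" "\<And>n. (\<Sum>k\<in>W n. (\<phi> n k)\<^sup>2) = 1"
    "\<And>n x. form (W n) (\<phi> n) * (\<Sum>k\<in>W n. (x k)\<^sup>2) \<le> form (W n) x" by metis
  define m where "m n = form (W n) (\<phi> n)" for n
  have eq: "min_spec_dirichlet (\<lambda>k l. \<kappa> (k - l)) (W n) = m n" for n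
    unfolding m_def by (rule min_spec_dirichlet_eq[OF W(1) \<phi>])
  have m0: "0 \<le> m n" for n unfolding m_def by (rule form_nonneg[OF W(1) \<phi>(1)])
  have "\<exists>N. \<forall>n\<ge>N. norm (m n - 0) < \<delta>" if \<delta>: "0 < \<delta>" for \<delta>
  proof -
    obtain F where F: "finite F" "F \<noteq> {}"
      "\<And>W. finite W \<Longrightarrow> F \<subseteq> W \<Longrightarrow> form W (\<lambda>k. if k \<in> F then 1 else 0) \<le> \<delta> / 2 * real (card F)"
      using exists_small_energy[of "\<delta> / 2"] \<delta> by auto
    have incr: "W m \<subseteq> W n" if "m \<le> n" for m n
      using that W(3) by (rule lift_Suc_mono_le[rotated])
    have "\<exists>N. F \<subseteq> W N"
      using F(1) W(4)
    proof (induction F rule: finite_induct)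
      case (insert k F)
      then obtain N M where "F \<subseteq> W N" "k \<in> W M" by blast
      then show ?case
        using incr[of N "max N M"] incr[of M "max N M"] by (intro exI[of _ "max N M"]) auto
    qed auto
    then obtain N where N: "F \<subseteq> W N" by blast
    have "norm (m n - 0) < \<delta>" if "N \<le> n" for n
    proof -
      have FW: "F \<subseteq> W n" using N incr[OF that] by blast
      have "(\<Sum>k\<in>W n. (if k \<in> F then 1 else 0 :: real)\<^sup>2) = (\<Sum>k\<in>F. 1)"
        using FW W(1) by (intro sum.mono_neutral_cong_right) auto
      then have "m n * real (card F) \<le> \<delta> / 2 * real (card F)"
        using \<phi>(3)[of n "\<lambda>k. if k \<in> F then 1 else 0"] F(3)[OF W(1) FW] by (simp add: m_def)
      moreover have "0 < real (card F)" using F by (simp add: card_gt_0_iff)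
      ultimately have "m n \<le> \<delta> / 2" by simp
      then show ?thesis using m0[of n] \<delta> by simp
    qed
    then show ?thesis by blast
  qed
  then show ?thesis unfolding eq by (intro LIMSEQ_I)
qed

end

section \<open>The penalty term\<close>

lemma difference_energy_minus: "difference_energy \<phi> (- j) = difference_energy \<phi> j"
proof -
  have bij: "bij_betw (\<lambda>i. i - j) UNIV UNIV" by (rule bij_betwI[where g="\<lambda>i. i + j"]) auto
  show ?thesis
    unfolding difference_energy_def
    using infsum_reindex_bij_betw[OF bij, of "\<lambda>i. (\<phi> (i - - j) - \<phi> i)\<^sup>2"]
    by (simp add: power2_commute)
qed

lemma difference_energy_zero: "difference_energy \<phi> 0 = 0"
  by (simp add: difference_energy_def)

lemma difference_energy_nonneg: "0 \<le> difference_energy \<phi> j"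
  by (simp add: difference_energy_def infsum_nonneg)

lemma summable_on_minus_iff:
  fixes f :: "'g::ab_group_add \<Rightarrow> 'v::real_normed_vector"
  shows "(\<lambda>j. f (- j)) summable_on UNIV \<longleftrightarrow> f summable_on UNIV"
    and "(\<Sum>\<^sub>\<infinity>j. f (- j)) = (\<Sum>\<^sub>\<infinity>j. f j)"
proof -
  have bij: "bij_betw uminus UNIV (UNIV :: 'g set)"
    by (rule bij_betwI[where g=uminus]) auto
  show "(\<lambda>j. f (- j)) summable_on UNIV \<longleftrightarrow> f summable_on UNIV"
    "(\<Sum>\<^sub>\<infinity>j. f (- j)) = (\<Sum>\<^sub>\<infinity>j. f j)"
    using summable_on_reindex_bij_betw[OF bij] infsum_reindex_bij_betw[OF bij] by auto
qed

locale decaying_coefficients =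
  fixes s :: "'g::ab_group_add \<Rightarrow> real" and p :: real
  assumes s_nonneg: "0 \<le> s j" and s_summable: "s summable_on UNIV"
    and s_powr_summable: "(\<lambda>j. s j powr p) summable_on UNIV" and p: "0 \<le> p" "p \<le> 1"
begin

definition mean :: "'g \<Rightarrow> real" where "mean j = (s j + s (- j)) / 2"
definition \<kappa> :: "'g \<Rightarrow> real" where "\<kappa> j = (if j = 0 then 0 else 2 * mean j powr p)"

lemma mean_nonneg: "0 \<le> mean j"
  by (simp add: mean_def s_nonneg)

lemma s_minus_summable: "(\<lambda>j. s (- j)) summable_on UNIV"
  using s_summable by (simp add: summable_on_minus_iff)

lemma mean_summable: "mean summable_on UNIV"
  unfolding mean_def[abs_def] divide_inverse
  by (intro summable_on_cmult_left summable_on_add s_summable s_minus_summable)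

sublocale symmetric_kernel \<kappa>
proof
  show "0 \<le> \<kappa> j" for j by (simp add: \<kappa>_def)
  show "\<kappa> (- j) = \<kappa> j" for j by (simp add: \<kappa>_def mean_def add.commute)
  show "\<kappa> 0 = 0" by (simp add: \<kappa>_def)
  show "\<kappa> summable_on UNIV"
  proof (rule summable_on_comparison_test)
    show "(\<lambda>j. 2 * (s j powr p + s (- j) powr p)) summable_on UNIV"
      using s_powr_summable summable_on_minus_iff(1)[of "\<lambda>j. s j powr p"]
      by (intro summable_on_cmult_right summable_on_add) auto
    fix j
    show "0 \<le> \<kappa> j" by (simp add: \<kappa>_def)
    \<comment> \<open>The larger of two numbers dominates their mean; with \<open>0 powr 0 = 0\<close> this includes
      \<open>p = 0\<close>.\<close>
    have "mean j powr p \<le> max (s j) (s (- j)) powr p"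
      by (rule powr_mono2) (use p mean_nonneg in \<open>auto simp: mean_def\<close>)
    also have "\<dots> \<le> s j powr p + s (- j) powr p" by (simp add: max_def)
    finally show "\<kappa> j \<le> 2 * (s j powr p + s (- j) powr p)" by (simp add: \<kappa>_def)
  qed
qed

lemma mean_powr_summable: "(\<lambda>j. mean j powr (2 - p)) summable_on UNIV"
proof (rule summable_on_comparison_test)
  define C where "C = (\<Sum>\<^sub>\<infinity>j. mean j)"
  show "(\<lambda>j. mean j * C powr (1 - p)) summable_on UNIV"
    by (intro summable_on_cmult_left mean_summable)
  fix j
  have "mean j \<le> C"
    using finite_sum_le_infsum[OF mean_summable, of "{j}"] by (simp add: C_def mean_nonneg)
  then have "mean j powr (1 - p) \<le> C powr (1 - p)"
    by (intro powr_mono2) (use p mean_nonneg in auto)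
  then have "mean j * mean j powr (1 - p) \<le> mean j * C powr (1 - p)"
    by (intro mult_left_mono mean_nonneg)
  moreover have "mean j powr (2 - p) = mean j * mean j powr (1 - p)"
    using powr_add[of "mean j" 1 "1 - p"] mean_nonneg[of j] by simp
  ultimately show "mean j powr (2 - p) \<le> mean j * C powr (1 - p)" by simp
qed simp

definition weight :: real where "weight = (\<Sum>\<^sub>\<infinity>j\<in>UNIV - {0}. mean j powr (2 - p))"

text \<open>Splitting \<open>t = t\<^bsup>1 - p/2\<^esup> t\<^bsup>p/2\<^esup>\<close> and the Cauchy--Schwarz inequality separate the
  penalty into the two factors of its definition.\<close>

lemma commutator_bound:
  assumes W: "finite W" "\<And>k. k \<notin> W \<Longrightarrow> \<phi> k = 0"
    and summable: "(\<lambda>j. s j * sqrt (difference_energy \<phi> j)) summable_on UNIV"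
  shows "(\<Sum>\<^sub>\<infinity>j. s j * sqrt (difference_energy \<phi> j)) \<le> sqrt weight * sqrt (form W \<phi>)"
proof -
  let ?D = "difference_energy \<phi>"
  have sum': "(\<lambda>j. s (- j) * sqrt (?D j)) summable_on UNIV"
    "(\<Sum>\<^sub>\<infinity>j. s (- j) * sqrt (?D j)) = (\<Sum>\<^sub>\<infinity>j. s j * sqrt (?D j))"
    using summable summable_on_minus_iff[of "\<lambda>j. s j * sqrt (?D j)"] by (simp_all add: difference_energy_minus)
  have mean_split: "mean j * sqrt (?D j) = (s j * sqrt (?D j) + s (- j) * sqrt (?D j)) * (1 / 2)" for j
    by (simp add: mean_def field_simps)
  have mean_sum: "(\<lambda>j. mean j * sqrt (?D j)) summable_on UNIV"
    "(\<Sum>\<^sub>\<infinity>j. mean j * sqrt (?D j)) = (\<Sum>\<^sub>\<infinity>j. s j * sqrt (?D j))"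
    unfolding mean_split
    by (intro summable_on_cmult_left summable_on_add summable sum')
      (simp add: infsum_cmult_left' infsum_add summable sum' del: times_divide_eq_right)
  have "(\<Sum>\<^sub>\<infinity>j. mean j * sqrt (?D j)) \<le> sqrt weight * sqrt (form W \<phi>)"
  proof (rule infsum_le_finite_sums[OF mean_sum(1)])
    fix F :: "'g set" assume F: "finite F"
    have fin: "finite (F - {0})" using F by simp
    have split: "mean j * sqrt (?D j) = \<bar>mean j powr (1 - p / 2)\<bar> * \<bar>sqrt (mean j powr p * ?D j)\<bar>" for j
    proof -
      have "mean j = mean j powr (1 - p / 2) * mean j powr (p / 2)"
        using mean_nonneg[of j] by (simp add: powr_add[symmetric])
      moreover have "mean j powr (p / 2) = sqrt (mean j powr p)"
        using powr_half_sqrt[of "mean j powr p"] by (simp add: powr_powr)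
      ultimately show ?thesis
        by (simp add: real_sqrt_mult difference_energy_nonneg)
    qed
    have "(\<Sum>j\<in>F. mean j * sqrt (?D j)) = (\<Sum>j\<in>F - {0}. mean j * sqrt (?D j))"
      by (rule sum.mono_neutral_right[OF F]) (auto simp: difference_energy_zero)
    also have "\<dots> = (\<Sum>j\<in>F - {0}. \<bar>mean j powr (1 - p / 2)\<bar> * \<bar>sqrt (mean j powr p * ?D j)\<bar>)"
      by (rule sum.cong[OF refl]) (rule split)
    also have "\<dots> \<le> L2_set (\<lambda>j. mean j powr (1 - p / 2)) (F - {0})
        * L2_set (\<lambda>j. sqrt (mean j powr p * ?D j)) (F - {0})"
      by (rule L2_set_mult_ineq)
    also have "\<dots> \<le> sqrt weight * sqrt (form W \<phi>)"
    proof (intro mult_mono)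
      have "(\<Sum>j\<in>F - {0}. (mean j powr (1 - p / 2))\<^sup>2) = (\<Sum>j\<in>F - {0}. mean j powr (2 - p))"
        by (intro sum.cong refl) (simp add: power2_eq_square powr_add[symmetric])
      also have "\<dots> \<le> weight"
        unfolding weight_def
        by (rule finite_sum_le_infsum[OF _ fin])
          (use mean_powr_summable in \<open>auto intro: summable_on_subset_banach\<close>)
      finally show "L2_set (\<lambda>j. mean j powr (1 - p / 2)) (F - {0}) \<le> sqrt weight"
        by (simp add: L2_set_def)
      have "2 * (\<Sum>j\<in>F - {0}. (sqrt (mean j powr p * ?D j))\<^sup>2) = (\<Sum>j\<in>F - {0}. \<kappa> j * ?D j)"
        unfolding sum_distrib_left
        by (intro sum.cong refl) (simp add: \<kappa>_def difference_energy_nonneg)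
      also have "\<dots> \<le> 2 * form W \<phi>"
        by (rule finite_sum_le_has_sum[OF energy_has_sum[OF W] fin])
          (auto simp: \<kappa>_nonneg difference_energy_nonneg)
      finally show "L2_set (\<lambda>j. sqrt (mean j powr p * ?D j)) (F - {0}) \<le> sqrt (form W \<phi>)"
        by (simp add: L2_set_def)
    qed (auto simp: L2_set_nonneg weight_def infsum_nonneg)
    finally show "(\<Sum>j\<in>F. mean j * sqrt (?D j)) \<le> sqrt weight * sqrt (form W \<phi>)" .
  qed
  then show ?thesis by (simp only: mean_sum(2))
qed

end

section \<open>Pseudospectra of operators in the Wiener algebra\<close>

text \<open>The coefficients are the matrix entries of the operator, as seen on families supported at one
  position.\<close>

lemma wiener_representation_unique:
  fixes A :: "('g::ab_group_add \<Rightarrow> 'y::complex_hilbert_space) \<Rightarrow> 'g \<Rightarrow> 'y"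
  assumes "wiener_representation A b" "wiener_representation A b'"
  shows "b = b'"
proof -
  have "blinfun_apply (c j i) y = A (\<lambda>k. if k = i - j then y else 0) i"
    if rep: "wiener_representation A c" for c i j y
  proof -
    let ?x = "\<lambda>k. if k = i - j then y else 0"
    have "((\<lambda>l. blinfun_apply (c l i) (?x (i - l))) has_sum A ?x i) UNIV"
      by (rule wiener_has_sum[OF rep single_in_l2E])
    moreover have "((\<lambda>l. blinfun_apply (c l i) (?x (i - l))) has_sum blinfun_apply (c j i) y) UNIV"
      by (rule has_sum_finite_neutralI[of "{j}"]) auto
    ultimately show ?thesis using has_sum_unique by blast
  qed
  then show ?thesis using assms by (intro ext blinfun_eqI) simp
qed

context convolution_operator
begin

lemma T_bound:
  assumes "x \<in> l2 UNIV F"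
  shows "l2norm (T x) \<le> (\<Sum>\<^sub>\<infinity>j. s j) * l2norm x"
proof -
  obtain Z G where "(Z has_sum G) UNIV" "\<And>j i. coord (Z j) i = c j i (x (i - j))"
    and G: "norm G \<le> (\<Sum>\<^sub>\<infinity>j. s j) * l2norm x"
    "\<And>i. ((\<lambda>j. c j i (x (i - j))) has_sum coord G i) UNIV"
    by (rule convolution_series[where c=c and s=s, OF l2_summable[OF assms] c_bound s_nonneg s_summable]) (rule that)
  have "T x = coord G" using has_sum_unique[OF T_has_sum[OF assms] G(2)] by blast
  then show ?thesis using G(1) by (simp add: norm_ell2)
qed

lemma minus_scalar_le:
  assumes "x \<in> l2 UNIV F"
  shows "l2norm (minus_scalar T z x) \<le> l2norm (minus_scalar T z' x) + dist z z' * l2norm x"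
proof -
  have s: "(\<lambda>i. (norm ((z' - z) *\<^sub>C x i))\<^sup>2) summable_on UNIV"
    using summable_coord[of "(z' - z) *\<^sub>C Ell2 x"] by (simp add: coord_Ell2_l2[OF assms])
  have n: "l2norm (\<lambda>i. (z' - z) *\<^sub>C x i) = dist z z' * l2norm x"
    using norm_scaleC[of "z' - z" "Ell2 x"]
    by (simp add: norm_ell2 coord_Ell2_l2[OF assms] fun_eq_iff[symmetric] dist_norm norm_minus_commute
        scaleC_ell2.rep_eq)
  have "minus_scalar T z x = (\<lambda>i. minus_scalar T z' x i + (z' - z) *\<^sub>C x i)"
  proof -
    have "(z' - z) *\<^sub>C v = z' *\<^sub>C v - z *\<^sub>C v" for v :: 'v
      using scaleC_add_left[of "z' - z" z v] by simp
    then show ?thesis by (simp add: minus_scalar_def)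
  qed
  then show ?thesis
    using l2norm_add(2)[OF minus_scalar_summable[OF assms, of z'] s] by (simp add: n)
qed

lemma minus_scalar_ge:
  assumes "x \<in> l2 UNIV F"
  shows "(cmod z - (\<Sum>\<^sub>\<infinity>j. s j)) * l2norm x \<le> l2norm (minus_scalar T z x)"
proof -
  have "l2norm (\<lambda>i. z *\<^sub>C x i) = norm (Ell2 (T x) - Ell2 (minus_scalar T z x))"
    unfolding norm_ell2
    by (rule arg_cong[where f=l2norm])
      (simp add: fun_eq_iff coord_Ell2[OF T_summable[OF assms]]
        coord_Ell2[OF minus_scalar_summable[OF assms]], simp add: minus_scalar_def)
  also have "\<dots> \<le> l2norm (T x) + l2norm (minus_scalar T z x)"
    using norm_triangle_ineq4[of "Ell2 (T x)" "Ell2 (minus_scalar T z x)"]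
    by (simp add: norm_Ell2[OF T_summable[OF assms]] norm_Ell2[OF minus_scalar_summable[OF assms]])
  finally have "l2norm (\<lambda>i. z *\<^sub>C x i) \<le> (\<Sum>\<^sub>\<infinity>j. s j) * l2norm x + l2norm (minus_scalar T z x)"
    using T_bound[OF assms] by linarith
  moreover have "l2norm (\<lambda>i. z *\<^sub>C x i) = cmod z * l2norm x"
    using norm_scaleC[of z "Ell2 x"] by (simp add: norm_ell2 coord_Ell2_l2[OF assms] scaleC_ell2.rep_eq)
  ultimately show ?thesis by (simp add: algebra_simps)
qed

end

text \<open>Lower norms may be infinite, so inequalities between them are tested by real lower bounds.\<close>

lemma ennreal_le_by_reals:
  assumes "\<And>a. 0 \<le> a \<Longrightarrow> ennreal a \<le> x \<Longrightarrow> ennreal a \<le> y"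
  shows "x \<le> y"
proof (rule ccontr)
  assume "\<not> x \<le> y"
  then obtain t where t: "y < t" "t < x" using dense[of y x] by (auto simp: not_le)
  then obtain a where a: "t = ennreal a" "0 \<le> a" by (cases t) (auto simp: top.extremum_strict)
  have "ennreal a \<le> y" by (rule assms[OF a(2)]) (use t a in simp)
  then show False using t(1) a(1) by simp
qed

lemma ennreal_le_add_by_reals:
  assumes d: "0 \<le> d" and "\<And>a. 0 \<le> a \<Longrightarrow> ennreal (a + d) \<le> x \<Longrightarrow> ennreal a \<le> y"
  shows "x \<le> y + ennreal d"
proof (rule ennreal_le_by_reals)
  fix a :: real assume a: "0 \<le> a" "ennreal a \<le> x"
  show "ennreal a \<le> y + ennreal d"
  proof (cases "a \<le> d")
    case True
    then have "ennreal a \<le> 0 + ennreal d" by (simp add: ennreal_leI)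
    also have "\<dots> \<le> y + ennreal d" by (intro add_right_mono) simp
    finally show ?thesis .
  next
    case False
    then have "ennreal (a - d) \<le> y" using assms(2)[of "a - d"] a by simp
    then have "ennreal (a - d) + ennreal d \<le> y + ennreal d" by (rule add_right_mono)
    then show ?thesis using False d by (simp add: ennreal_plus[symmetric] del: ennreal_plus)
  qed
qed

locale wiener_operator =
  fixes A :: "('g::ab_group_add \<Rightarrow> 'y::complex_hilbert_space) \<Rightarrow> 'g \<Rightarrow> 'y" and b
  assumes rep: "wiener_representation A b"
begin

lemma b: "b j \<in> linf_ops"
  using rep by (simp add: wiener_representation_def)

lemma supnorm_summable: "(\<lambda>j. supnorm (b j)) summable_on UNIV"
  using rep by (simp add: wiener_representation_def)

sublocale primal: convolution_operator UNIV A "\<lambda>j i. blinfun_apply (b j i)" "\<lambda>j. supnorm (b j)"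
proof (rule convolution_operator.intro)
  show "(\<lambda>i. (norm (A x i))\<^sup>2) summable_on UNIV" if "x \<in> l2E" for x
    using rep that by (auto simp: wiener_representation_def bounded_operators_def l2_def)
  show "norm (blinfun_apply (b j i) v) \<le> supnorm (b j) * norm v" for i j v
    using norm_blinfun[of "b j i" v] mult_right_mono[OF norm_le_supnorm[OF b, of j i] norm_ge_zero[of v]]
    by simp
qed (auto intro: wiener_has_sum[OF rep] supnorm_nonneg[OF b] supnorm_summable blinfun.bounded_linear_right)

sublocale dual: convolution_operator dual_space "adjoint_op A"
  "\<lambda>j i v. v o\<^sub>L b (- j) (i - j)" "\<lambda>j. supnorm (b (- j))"
proof (rule convolution_operator.intro)
  show "(0 :: 'y \<Rightarrow>\<^sub>L complex) \<in> dual_space" by (simp add: dual_space_def scaleC_complex_def)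
  show "r *\<^sub>R f \<in> dual_space" if "f \<in> dual_space" for r and f :: "'y \<Rightarrow>\<^sub>L complex"
    using dual_space_scaleC[OF that] by (simp add: scaleR_eq_scaleC)
  show "(\<lambda>i. (norm (adjoint_op A f i))\<^sup>2) summable_on UNIV" if "f \<in> l2E'" for f
    by (rule l2_summable[OF adjoint_series(1)[OF rep that]])
  show "((\<lambda>j. f (i - j) o\<^sub>L b (- j) (i - j)) has_sum adjoint_op A f i) UNIV" if "f \<in> l2E'" for f i
    by (rule adjoint_series(3)[OF rep that])
  show "bounded_linear (\<lambda>v :: 'y \<Rightarrow>\<^sub>L complex. v o\<^sub>L b (- j) (i - j))" for i j
    by (rule bounded_bilinear.bounded_linear_left[OF bounded_bilinear_blinfun_compose])
  show "norm (v o\<^sub>L b (- j) (i - j)) \<le> supnorm (b (- j)) * norm v" for i j and v :: "'y \<Rightarrow>\<^sub>L complex"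
    using norm_blinfun_compose[of v "b (- j) (i - j)"]
      mult_left_mono[OF norm_le_supnorm[OF b, of "- j" "i - j"] norm_ge_zero[of v]]
    by (simp add: mult.commute)
  show "(\<lambda>j. supnorm (b (- j))) summable_on UNIV"
    using supnorm_summable summable_on_minus_iff(1)[of "\<lambda>j. supnorm (b j)"] by simp
qed (rule supnorm_nonneg[OF b])

lemma mu_ge_iff:
  assumes "0 \<le> a"
  shows "ennreal a \<le> mu (minus_scalar A z) \<longleftrightarrow>
    (\<forall>x\<in>l2E. a * l2norm x \<le> l2norm (minus_scalar A z x)) \<and>
    (\<forall>f\<in>l2E'. a * l2norm f \<le> l2norm (minus_scalar (adjoint_op A) z f))"
proof -
  have "lower_norm l2E' (adjoint_op (minus_scalar A z)) = lower_norm l2E' (minus_scalar (adjoint_op A) z)"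
    unfolding lower_norm_def by (intro INF_cong refl) (simp add: adjoint_minus_scalar(1)[OF rep])
  then show ?thesis
    using primal.lower_norm_minus_scalar_ge_iff[OF assms] dual.lower_norm_minus_scalar_ge_iff[OF assms]
    by (simp add: mu_def)
qed

lemma window_mu_ge_iff:
  assumes "0 \<le> a"
  shows "ennreal a \<le> window_mu W A z \<longleftrightarrow> (\<forall>k.
    (\<forall>x\<in>l2 ((+) k ` W) UNIV. a * l2norm x \<le> l2norm (minus_scalar A z x)) \<and>
    (\<forall>f\<in>l2 ((+) k ` W) dual_space. a * l2norm f \<le> l2norm (minus_scalar (adjoint_op A) z f)))"
  unfolding window_mu_def le_INF_iff
  by (simp add: primal.lower_norm_window_ge_iff[OF assms] dual.lower_norm_window_ge_iff[OF assms])

lemma mu_le_window_mu: "mu (minus_scalar A z) \<le> window_mu W A z"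
proof (rule ennreal_le_by_reals)
  fix a :: real assume "0 \<le> a" "ennreal a \<le> mu (minus_scalar A z)"
  then show "ennreal a \<le> window_mu W A z"
    unfolding window_mu_ge_iff[OF \<open>0 \<le> a\<close>] mu_ge_iff[OF \<open>0 \<le> a\<close>]
    using primal.l2_subset dual.l2_subset by blast
qed

lemma mu_lipschitz: "mu (minus_scalar A z) \<le> mu (minus_scalar A z') + ennreal (dist z z')"
proof (rule ennreal_le_add_by_reals)
  fix a :: real assume a: "0 \<le> a" "ennreal (a + dist z z') \<le> mu (minus_scalar A z)"
  then show "ennreal a \<le> mu (minus_scalar A z')"
    using mu_ge_iff[of "a + dist z z'" z] mu_ge_iff[of a z']
      primal.minus_scalar_le[of _ z z'] dual.minus_scalar_le[of _ z z']
    by (simp add: distrib_right) (meson add_le_cancel_right order_trans)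
qed simp

lemma bounded_mu_le: "bounded {z. mu (minus_scalar A z) \<le> ennreal r}"
proof -
  define K where "K = (\<Sum>\<^sub>\<infinity>j. supnorm (b j))"
  have K': "(\<Sum>\<^sub>\<infinity>j. supnorm (b (- j))) = K"
    using summable_on_minus_iff(2)[of "\<lambda>j. supnorm (b j)"] by (simp add: K_def)
  have "cmod z \<le> K + max r 0" if z: "mu (minus_scalar A z) \<le> ennreal r" for z
  proof (rule ccontr)
    assume "\<not> ?thesis"
    then have *: "r < cmod z - K" "0 < cmod z - K" by auto
    then have "ennreal (cmod z - K) \<le> mu (minus_scalar A z)"
      using primal.minus_scalar_ge[of _ z] dual.minus_scalar_ge[of _ z]
      by (subst mu_ge_iff) (auto simp: K_def[symmetric] K')
    with z have "ennreal (cmod z - K) \<le> ennreal r" by (rule order_trans[rotated])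
    then show False using * by (cases "0 \<le> r") (auto simp: ennreal_neg)
  qed
  then show ?thesis unfolding bounded_iff by blast
qed

text \<open>As a map on the type of square-summable families, \<open>A - z\<close> is subject to the results on
  abstract Hilbert spaces.\<close>

definition shifted :: "complex \<Rightarrow> ('g, 'y) ell2 \<Rightarrow> ('g, 'y) ell2"
  where "shifted z X = Ell2 (minus_scalar A z (coord X))"

lemma coord_shifted: "coord (shifted z X) = minus_scalar A z (coord X)"
  unfolding shifted_def by (rule coord_Ell2[OF primal.minus_scalar_summable[OF coord_in_l2E]])

lemma norm_shifted: "norm (shifted z X) = l2norm (minus_scalar A z (coord X))"
  by (simp add: norm_ell2 coord_shifted)

lemma shifted_add: "shifted z (X + Y) = shifted z X + shifted z Y"
proof (rule ell2_eqI)
  fix i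
  have "coord (X + Y) = (\<lambda>i. coord X i + coord Y i)" by auto
  moreover have "A (\<lambda>i. coord X i + coord Y i) = (\<lambda>i. A (coord X) i + A (coord Y) i)"
    using rep coord_in_l2E[of X] coord_in_l2E[of Y]
    unfolding wiener_representation_def bounded_operators_def by blast
  ultimately show "coord (shifted z (X + Y)) i = coord (shifted z X + shifted z Y) i"
    by (simp add: coord_shifted minus_scalar_def scaleC_add_right)
qed

lemma shifted_scaleC: "shifted z (c *\<^sub>C X) = c *\<^sub>C shifted z X"
proof (rule ell2_eqI)
  fix i
  have "coord (c *\<^sub>C X) = (\<lambda>i. c *\<^sub>C coord X i)" by auto
  moreover have "A (\<lambda>i. c *\<^sub>C coord X i) = (\<lambda>i. c *\<^sub>C A (coord X) i)"
    using rep coord_in_l2E[of X] unfolding wiener_representation_def bounded_operators_def by blast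
  ultimately show "coord (shifted z (c *\<^sub>C X)) i = coord (c *\<^sub>C shifted z X) i"
    by (simp add: coord_shifted minus_scalar_def scaleC_diff_right scaleC_scaleC mult.commute)
qed

lemma shifted_bounded:
  obtains M where "0 < M" "\<And>X. norm (shifted z X) \<le> M * norm X"
proof
  define K where "K = (\<Sum>\<^sub>\<infinity>j. supnorm (b j))"
  have "0 \<le> K" unfolding K_def by (rule infsum_nonneg) (rule supnorm_nonneg[OF b])
  then show "0 < K + cmod z + 1" by (simp add: add_nonneg_pos)
  fix X :: "('g, 'y) ell2"
  have "l2norm (minus_scalar A 0 (coord X)) = l2norm (A (coord X))"
  proof -
    have "0 *\<^sub>C v = 0" for v :: 'y using norm_scaleC[of 0 v] by simp
    then show ?thesis by (simp add: minus_scalar_def)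
  qed
  then have "norm (shifted z X) \<le> l2norm (A (coord X)) + cmod z * norm X"
    using primal.minus_scalar_le[OF coord_in_l2E, of z X 0] by (simp add: norm_shifted norm_ell2[of X])
  also have "\<dots> \<le> K * norm X + cmod z * norm X"
    using primal.T_bound[OF coord_in_l2E, of X] by (simp add: K_def norm_ell2)
  finally show "norm (shifted z X) \<le> (K + cmod z + 1) * norm X"
    using norm_ge_zero[of X] unfolding distrib_right by linarith
qed

lemma shifted_below_iff:
  "(\<forall>X. a * norm X \<le> norm (shifted z X)) \<longleftrightarrow> (\<forall>x\<in>l2E. a * l2norm x \<le> l2norm (minus_scalar A z x))"
proof
  assume *: "\<forall>X. a * norm X \<le> norm (shifted z X)"
  show "\<forall>x\<in>l2E. a * l2norm x \<le> l2norm (minus_scalar A z x)"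
  proof
    fix x :: "'g \<Rightarrow> 'y" assume "x \<in> l2E"
    then show "a * l2norm x \<le> l2norm (minus_scalar A z x)"
      using *[rule_format, of "Ell2 x"] by (simp add: norm_shifted norm_ell2[of "Ell2 x"] coord_Ell2_l2)
  qed
next
  assume *: "\<forall>x\<in>l2E. a * l2norm x \<le> l2norm (minus_scalar A z x)"
  show "\<forall>X. a * norm X \<le> norm (shifted z X)"
  proof
    fix X
    show "a * norm X \<le> norm (shifted z X)"
      using *[rule_format, OF coord_in_l2E[of X]] by (simp add: norm_shifted norm_ell2[of X])
  qed
qed

lemma mu_ge_imp_below:
  assumes "ennreal a \<le> mu (minus_scalar A z)" "0 \<le> a"
  shows "a * norm X \<le> norm (shifted z X)"
  using assms mu_ge_iff[of a z] shifted_below_iff[of a z] by blast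

text \<open>A vector orthogonal to the range induces a functional in the kernel of the adjoint.\<close>

lemma surj_shifted:
  assumes a: "0 < a" and ge: "ennreal a \<le> mu (minus_scalar A z)"
  shows "surj (shifted z)"
proof -
  obtain M where M: "\<And>X. norm (shifted z X) \<le> M * norm X" using shifted_bounded by blast
  have below: "a * norm X \<le> norm (shifted z X)" for X
    using mu_ge_imp_below[OF ge] a by simp
  show ?thesis
  proof (rule bounded_below_surj[OF shifted_add shifted_scaleC M below a])
    fix w assume orth: "\<And>X. cinner (shifted z X) w = 0"
    have bl: "bounded_linear (\<lambda>y. cinner y (coord w i))" for i
      by (rule bounded_linear_intro[where K="norm (coord w i)"])
        (simp_all add: cinner_add_left scaleR_eq_scaleC cinner_scaleC_left scaleC_complex_def cinner_le)
    define f where "f i = Blinfun (\<lambda>y. cinner y (coord w i))" for i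
    have f_apply: "blinfun_apply (f i) y = cinner y (coord w i)" for i y
      unfolding f_def by (simp add: bounded_linear_Blinfun_apply[OF bl])
    have norm_f: "norm (f i) = norm (coord w i)" for i
    proof (rule antisym)
      show "norm (f i) \<le> norm (coord w i)"
        by (rule norm_blinfun_bound) (simp_all add: f_apply cinner_le mult.commute)
      have "norm (coord w i) * norm (coord w i) = norm (blinfun_apply (f i) (coord w i))"
        by (simp add: f_apply cinner_self power2_eq_square norm_mult)
      also have "\<dots> \<le> norm (f i) * norm (coord w i)" by (rule norm_blinfun)
      finally show "norm (coord w i) \<le> norm (f i)"
        by (cases "coord w i = 0") simp_all
    qed
    have f: "f \<in> l2E'"
      by (simp add: l2_def dual_space_def f_apply cinner_scaleC_left scaleC_complex_def norm_f summable_coord)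
    have "dual_pairing f (minus_scalar A z x) = 0" if "x \<in> l2E" for x
      using orth[of "Ell2 x"] by (simp add: dual_pairing_def f_apply cinner_ell2_def coord_shifted coord_Ell2_l2[OF that])
    then have pz: "dual_pairing (minus_scalar (adjoint_op A) z f) x = 0" if "x \<in> l2E" for x
      using adjoint_minus_scalar(3)[OF rep f] that by simp
    have "minus_scalar (adjoint_op A) z f i = 0" for i
      by (rule blinfun_eqI) (use pz[OF single_in_l2E] in \<open>simp add: pairing_single\<close>)
    then have "l2norm (minus_scalar (adjoint_op A) z f) = 0" by (simp add: l2norm_def)
    then have "a * l2norm f \<le> 0"
      using ge mu_ge_iff[of a z] a f by fastforce
    then have "l2norm f \<le> 0" using a by (simp add: mult_le_0_iff)
    moreover have "l2norm f = norm w" by (simp add: l2norm_def norm_f norm_ell2)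
    ultimately show "w = 0" by simp
  qed
qed

text \<open>Surjectivity passes the lower bound to the adjoint: a vector \<open>y\<close> that almost norms \<open>f\<close> is
  \<open>(A - z) x\<close> with \<open>a \<parallel>x\<parallel> \<le> \<parallel>y\<parallel>\<close>, and the pairing of \<open>f\<close> with \<open>y\<close> is that of
  the image of \<open>f\<close> under the adjoint with \<open>x\<close>.\<close>

lemma mu_ge_of_surj:
  assumes surj: "surj (shifted z)" and a: "0 < a" and below: "\<And>X. a * norm X \<le> norm (shifted z X)"
  shows "ennreal a \<le> mu (minus_scalar A z)"
proof -
  have "a * l2norm x \<le> l2norm (minus_scalar A z x)" if "x \<in> l2E" for x
    using below shifted_below_iff that by blast
  moreover have "a * l2norm f \<le> l2norm (minus_scalar (adjoint_op A) z f)" if f: "f \<in> l2E'" for f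
  proof -
    define G where "G = Ell2 f"
    define H where "H = Ell2 (minus_scalar (adjoint_op A) z f)"
    have G: "coord G = f" "norm G = l2norm f" by (simp_all add: G_def coord_Ell2_l2[OF f] norm_ell2)
    have H: "coord H = minus_scalar (adjoint_op A) z f" "norm H = l2norm (minus_scalar (adjoint_op A) z f)"
      by (simp_all add: H_def coord_Ell2_l2[OF adjoint_minus_scalar(2)[OF rep f]] norm_ell2)
    have le: "t * (a * norm G) \<le> norm H" if t: "0 \<le> t" "t < 1" for t
    proof (cases "norm G = 0")
      case False
      obtain y where y: "norm y \<le> norm G" "t * (norm G)\<^sup>2 \<le> norm (dual_pairing f (coord y))"
        using almost_norming[of G t] f t by (auto simp: G)
      obtain x where x: "y = shifted z x" using surj by blast
      have "norm (dual_pairing f (coord y)) = norm (dual_pairing (coord H) (coord x))"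
        by (simp add: x coord_shifted H adjoint_minus_scalar(3)[OF rep f coord_in_l2E])
      also have "\<dots> \<le> norm H * norm x" by (rule pairing_le)
      finally have "t * (norm G)\<^sup>2 \<le> norm H * norm x" using y(2) by linarith
      then have "a * (t * (norm G)\<^sup>2) \<le> a * (norm H * norm x)" using a by (intro mult_left_mono) auto
      also have "\<dots> = norm H * (a * norm x)" by simp
      also have "\<dots> \<le> norm H * norm G"
        using below[of x] y(1) by (intro mult_left_mono) (auto simp: x)
      finally have "(t * (a * norm G)) * norm G \<le> norm H * norm G"
        by (simp add: power2_eq_square mult_ac)
      then show ?thesis using False by simp
    qed simp
    have "a * norm G \<le> norm H"
    proof (rule field_le_mult_one_interval)
      show "t * (a * norm G) \<le> norm H" if "0 < t" "t < 1" for t using le that by simp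
    qed
    then show ?thesis by (simp add: G H)
  qed
  ultimately show ?thesis using a by (subst mu_ge_iff) auto
qed

lemma mu_zero_iff_spectrum: "mu (minus_scalar A z) = 0 \<longleftrightarrow> z \<in> spectrum l2E A"
proof
  assume "z \<in> spectrum l2E A"
  show "mu (minus_scalar A z) = 0"
  proof (rule ccontr)
    assume "mu (minus_scalar A z) \<noteq> 0"
    then have "0 < mu (minus_scalar A z)" by (simp add: zero_less_iff_neq_zero)
    then obtain t where t: "0 < t" "t < mu (minus_scalar A z)" using dense by blast
    then obtain a where a: "t = ennreal a" "0 \<le> a" by (cases t) (auto simp: top.extremum_strict)
    have a: "0 < a" "ennreal a \<le> mu (minus_scalar A z)" using t a by auto
    have below: "a * norm X \<le> norm (shifted z X)" for X
      using mu_ge_imp_below[OF a(2)] a by simp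
    have "z \<notin> spectrum l2E A"
      by (rule not_in_spectrumI[OF shifted_add shifted_scaleC below a(1) surj_shifted[OF a]])
        (auto simp: coord_in_l2E coord_shifted coord_Ell2_l2)
    then show False using \<open>z \<in> spectrum l2E A\<close> by simp
  qed
next
  assume mu0: "mu (minus_scalar A z) = 0"
  show "z \<in> spectrum l2E A"
  proof (rule ccontr)
    assume "z \<notin> spectrum l2E A"
    then obtain C where C: "C \<in> bounded_operators l2E l2E"
      "\<And>x. x \<in> l2E \<Longrightarrow> C (minus_scalar A z x) = x" "\<And>x. x \<in> l2E \<Longrightarrow> minus_scalar A z (C x) = x"
      by (auto simp: spectrum_def)
    obtain K where K: "\<And>x. x \<in> l2E \<Longrightarrow> l2norm (C x) \<le> K * l2norm x"
      using C(1) unfolding bounded_operators_def by blast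
    define a where "a = 1 / max K 1"
    have a: "0 < a" by (simp add: a_def)
    have below: "a * norm X \<le> norm (shifted z X)" for X
    proof -
      have "norm X \<le> K * norm (shifted z X)"
        using K[OF coord_in_l2E, of "shifted z X"] C(2)[OF coord_in_l2E, of X]
        by (simp add: coord_shifted norm_ell2)
      also have "\<dots> \<le> max K 1 * norm (shifted z X)" by (intro mult_right_mono) auto
      finally show ?thesis by (simp add: a_def divide_le_eq mult.commute)
    qed
    have "surj (shifted z)"
    proof (rule surjI)
      fix Y :: "('g, 'y) ell2"
      have "C (coord Y) \<in> l2E" using C(1) coord_in_l2E by (auto simp: bounded_operators_def)
      then show "shifted z (Ell2 (C (coord Y))) = Y"
        by (intro ell2_eqI) (simp add: coord_shifted coord_Ell2_l2 C(3)[OF coord_in_l2E])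
    qed
    from mu_ge_of_surj[OF this a below] show False using mu0 a by simp
  qed
qed

text \<open>At a point where \<open>\<mu>\<close> is positive the operator is invertible, so the absence of local
  minima passes to \<open>\<mu>\<close>.\<close>

lemma mu_not_locally_minimal:
  assumes \<epsilon>: "0 < \<epsilon>" and eq: "mu (minus_scalar A z) = ennreal \<epsilon>" and r: "0 < r"
  obtains z' where "dist z z' < r" "mu (minus_scalar A z') < ennreal \<epsilon>"
proof (rule ccontr)
  assume "\<not> thesis"
  note no = this and found = that
  have ge: "ennreal \<epsilon> \<le> mu (minus_scalar A z')" if "dist z z' < r" for z'
    using no found[OF that] by (meson not_le)
  obtain M where M: "0 < M" "\<And>X. norm (shifted z X) \<le> M * norm X" using shifted_bounded by blast
  have surj: "surj (shifted z)" by (rule surj_shifted[OF \<epsilon>]) (simp add: eq)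
  have below: "\<epsilon> * norm X \<le> norm (shifted z X - w *\<^sub>C X)" if "cmod w < r" for w X
  proof -
    have "shifted z X - w *\<^sub>C X = shifted (z + w) X"
      by (rule ell2_eqI) (simp add: coord_shifted minus_scalar_def scaleC_add_left)
    then show ?thesis
      using mu_ge_imp_below[OF ge[of "z + w"]] that \<epsilon> by (simp add: dist_norm)
  qed
  obtain \<eta> where \<eta>: "0 < \<eta>" "\<And>X. (\<epsilon> + \<eta>) * norm X \<le> norm (shifted z X)"
    using lower_norm_not_locally_minimal[OF shifted_add shifted_scaleC M(2,1) surj below \<epsilon> r] by blast
  have "ennreal (\<epsilon> + \<eta>) \<le> mu (minus_scalar A z)"
    by (rule mu_ge_of_surj[OF surj _ \<eta>(2)]) (use \<epsilon> \<eta> in simp)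
  then show False using eq \<epsilon> \<eta>(1) by simp
qed

end

section \<open>Hausdorff convergence of sublevel sets\<close>

text \<open>By compactness: points that violate the claim for arbitrarily large \<open>n\<close> accumulate at a point of
  the sublevel set, and a nearby point that belongs to almost all \<open>U n\<close> gives a contradiction.  The
  sublevel set may be empty.\<close>

lemma sublevel_sets_near:
  fixes f :: "complex \<Rightarrow> ennreal"
  assumes lip: "\<And>z z'. f z \<le> f z' + ennreal (dist z z')"
    and bdd: "bounded {z. f z \<le> ennreal (e + 1)}" and e: "0 \<le> e"
    and \<delta>: "\<delta> \<longlonglongrightarrow> 0" "\<And>n. 0 \<le> \<delta> n"
    and dense: "\<And>z \<eta>. f z \<le> ennreal e \<Longrightarrow> 0 < \<eta> \<Longrightarrow> \<exists>z'. dist z z' < \<eta> \<and> (\<forall>\<^sub>F n in sequentially. z' \<in> U n)"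
    and \<eta>: "0 < \<eta>"
  shows "\<forall>\<^sub>F n in sequentially. \<forall>z. f z \<le> ennreal (e + \<delta> n) \<longrightarrow> (\<exists>z'\<in>U n. dist z z' < \<eta>)"
proof (rule ccontr)
  assume "\<not> ?thesis"
  then have bad: "\<exists>n\<ge>N. \<exists>z. f z \<le> ennreal (e + \<delta> n) \<and> (\<forall>z'\<in>U n. \<not> dist z z' < \<eta>)" for N
    unfolding eventually_sequentially by blast
  have "\<forall>\<^sub>F n in sequentially. \<delta> n < 1" using order_tendstoD(2)[OF \<delta>(1), of 1] by simp
  then obtain N0 where N0: "\<And>n. N0 \<le> n \<Longrightarrow> \<delta> n < 1" by (auto simp: eventually_sequentially)
  have "\<forall>k. \<exists>n z. k + N0 \<le> n \<and> f z \<le> ennreal (e + \<delta> n) \<and> (\<forall>z'\<in>U n. \<not> dist z z' < \<eta>)"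
    using bad by blast
  then obtain n z where nz: "\<And>k. k + N0 \<le> n k" "\<And>k. f (z k) \<le> ennreal (e + \<delta> (n k))"
    "\<And>k z'. z' \<in> U (n k) \<Longrightarrow> \<not> dist (z k) z' < \<eta>" by metis
  have "f (z k) \<le> ennreal (e + 1)" for k
  proof (rule order_trans[OF nz(2)])
    have "N0 \<le> n k" using nz(1)[of k] by simp
    then show "ennreal (e + \<delta> (n k)) \<le> ennreal (e + 1)"
      using N0[of "n k"] by (intro ennreal_leI) simp
  qed
  then have "bounded (range z)" by (intro bounded_subset[OF bdd]) auto
  then obtain l s where s: "strict_mono s" and l: "(z \<circ> s) \<longlonglongrightarrow> l"
    using bounded_imp_convergent_subsequence by blast
  have ns: "filterlim (\<lambda>k. n (s k)) at_top sequentially"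
    by (rule filterlim_at_top_mono[OF filterlim_ident])
      (use nz(1) seq_suble[OF s] in \<open>auto intro!: always_eventually elim: order_trans[rotated] intro: le_trans[OF _ add_leD1]\<close>)
  have "(\<lambda>k. dist l (z (s k))) \<longlonglongrightarrow> dist l l"
    using l by (intro tendsto_intros) (simp add: o_def)
  then have "(\<lambda>k. e + \<delta> (n (s k)) + dist l (z (s k))) \<longlonglongrightarrow> e + 0 + 0"
    by (intro tendsto_add tendsto_const filterlim_compose[OF \<delta>(1) ns]) simp
  then have "(\<lambda>k. ennreal (e + \<delta> (n (s k)) + dist l (z (s k)))) \<longlonglongrightarrow> ennreal e"
    using tendsto_ennrealI by fastforce
  moreover have "f l \<le> ennreal (e + \<delta> (n (s k)) + dist l (z (s k)))" for k
  proof -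
    have "f l \<le> f (z (s k)) + ennreal (dist l (z (s k)))" by (rule lip)
    also have "\<dots> \<le> ennreal (e + \<delta> (n (s k))) + ennreal (dist l (z (s k)))"
      by (intro add_right_mono nz(2))
    finally show ?thesis using e \<delta>(2)[of "n (s k)"] by (simp add: ennreal_plus[symmetric] del: ennreal_plus)
  qed
  ultimately have "f l \<le> ennreal e" by (intro LIMSEQ_le_const) auto
  then obtain z' where z': "dist l z' < \<eta> / 2" "\<forall>\<^sub>F n in sequentially. z' \<in> U n"
    using dense[of l "\<eta> / 2"] \<eta> by auto
  have "\<forall>\<^sub>F k in sequentially. dist (z (s k)) l < \<eta> / 2"
    using tendstoD[OF l, of "\<eta> / 2"] \<eta> by (simp add: o_def)
  moreover have "\<forall>\<^sub>F k in sequentially. z' \<in> U (n (s k))"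
    using z'(2) ns by (rule eventually_compose_filterlim)
  ultimately have "\<forall>\<^sub>F k in sequentially. False"
  proof eventually_elim
    case (elim k)
    have "dist (z (s k)) z' < \<eta>" using dist_triangle[of "z (s k)" z' l] elim(1) z'(1) by linarith
    then show False using nz(3)[OF elim(2)] by simp
  qed
  then show False by simp
qed

lemma hausdorff_convergesI:
  assumes "\<And>n. bounded (S n)" "bounded T"
    and ST: "\<And>\<eta>. 0 < \<eta> \<Longrightarrow> \<forall>\<^sub>F n in sequentially. \<forall>s\<in>S n. \<exists>t\<in>T. dist s t < \<eta>"
    and TS: "\<And>\<eta>. 0 < \<eta> \<Longrightarrow> \<forall>\<^sub>F n in sequentially. \<forall>t\<in>T. \<exists>s\<in>S n. dist t s < \<eta>"
  shows "hausdorff_converges S T"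
  unfolding hausdorff_converges_def
proof (intro conjI allI assms(1,2))
  show "(\<lambda>n. hausdorff_dist (S n) T) \<longlonglongrightarrow> 0"
  proof (rule order_tendstoI)
    fix a :: ennreal assume "0 < a"
    then obtain t where t: "0 < t" "t < a" using dense by blast
    then obtain \<eta> where \<eta>: "t = ennreal \<eta>" "0 \<le> \<eta>" by (cases t) (auto simp: top.extremum_strict)
    then have "0 < \<eta>" using t by auto
    from ST[OF this] TS[OF this]
    show "\<forall>\<^sub>F n in sequentially. hausdorff_dist (S n) T < a"
    proof eventually_elim
      case (elim n)
      have "hausdorff_dist (S n) T \<le> ennreal \<eta>"
        unfolding hausdorff_dist_def
        using elim by (intro max.boundedI SUP_least) (meson INF_lower2 ennreal_leI less_imp_le)+
      then show ?case using t \<eta> by simp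
    qed
  qed simp
qed

text \<open>Both the approximating sets and the limit lie between \<open>U n\<close> and the sublevel sets at height
  \<open>e + \<delta> n\<close>, which are close to each other.\<close>

lemma hausdorff_converges_sandwich:
  fixes f :: "complex \<Rightarrow> ennreal"
  assumes lip: "\<And>z z'. f z \<le> f z' + ennreal (dist z z')"
    and bdd: "\<And>r. bounded {z. f z \<le> ennreal r}" and e: "0 \<le> e"
    and \<delta>: "\<delta> \<longlonglongrightarrow> 0" "\<And>n. 0 \<le> \<delta> n"
    and dense: "\<And>z \<eta>. f z \<le> ennreal e \<Longrightarrow> 0 < \<eta> \<Longrightarrow> \<exists>z'. dist z z' < \<eta> \<and> (\<forall>\<^sub>F n in sequentially. z' \<in> U n)"
    and S: "\<And>n. U n \<subseteq> S n" "\<And>n. S n \<subseteq> {z. f z \<le> ennreal (e + \<delta> n)}"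
    and T: "\<And>n. U n \<subseteq> T" "T \<subseteq> {z. f z \<le> ennreal e}"
  shows "hausdorff_converges S T"
proof (rule hausdorff_convergesI)
  show "bounded (S n)" for n using bdd S(2) by (rule bounded_subset)
  show "bounded T" using bdd T(2) by (rule bounded_subset)
  fix \<eta> :: real assume "0 < \<eta>"
  have near: "\<forall>\<^sub>F n in sequentially. \<forall>z. f z \<le> ennreal (e + \<delta> n) \<longrightarrow> (\<exists>z'\<in>U n. dist z z' < \<eta>)"
    by (rule sublevel_sets_near[OF lip bdd e \<delta> _ \<open>0 < \<eta>\<close>]) (rule dense)
  show "\<forall>\<^sub>F n in sequentially. \<forall>s\<in>S n. \<exists>t\<in>T. dist s t < \<eta>"
    using near by eventually_elim (use S T in blast)
  show "\<forall>\<^sub>F n in sequentially. \<forall>t\<in>T. \<exists>s\<in>S n. dist t s < \<eta>"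
    using near
  proof eventually_elim
    case (elim n)
    have "f t \<le> ennreal (e + \<delta> n)" if "t \<in> T" for t
      using T(2) that \<delta>(2)[of n] by (auto intro: order_trans[OF _ ennreal_leI])
    then show ?case using elim S(1) by blast
  qed
qed

section \<open>Convergence of the approximations\<close>

text \<open>Localisation with the ground state of the Dirichlet Laplacian on \<open>W\<close> as window function: its
  energy is the smallest eigenvalue in the penalty.  For the adjoint the coefficients are reflected,
  which leaves the bound unchanged because the energies are even.\<close>

lemma (in wiener_operator) window_mu_le:
  assumes coeff: "decaying_coefficients (\<lambda>j. supnorm (b j)) p" and W: "finite W" "W \<noteq> {}"
  shows "window_mu W A z \<le> mu (minus_scalar A z) + ennreal (penalty p W b)"
proof -
  interpret coeff: decaying_coefficients "\<lambda>j. supnorm (b j)" p by (rule coeff)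
  have graph: "coeff_graph p b = (\<lambda>k l. coeff.\<kappa> (k - l))"
    by (simp add: fun_eq_iff coeff_graph_def coeff.\<kappa>_def coeff.mean_def)
  obtain \<phi> where \<phi>: "\<And>k. k \<notin> W \<Longrightarrow> \<phi> k = 0" "(\<Sum>k\<in>W. (\<phi> k)\<^sup>2) = 1"
    "\<And>x. coeff.form W \<phi> * (\<Sum>k\<in>W. (x k)\<^sup>2) \<le> coeff.form W x"
    using coeff.exists_minimiser[OF W] by blast
  have "min_spec_dirichlet (\<lambda>k l. coeff.\<kappa> (k - l)) W = coeff.form W \<phi>"
    by (rule coeff.min_spec_dirichlet_eq[OF W(1) \<phi>])
  then have pen: "penalty p W b = sqrt coeff.weight * sqrt (coeff.form W \<phi>)"
    unfolding penalty_def graph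
    by (simp add: coeff.weight_def coeff.mean_def)
  have form0: "0 \<le> coeff.form W \<phi>" by (rule coeff.form_nonneg[OF W(1) \<phi>(1)])
  have weight0: "0 \<le> coeff.weight" by (simp add: coeff.weight_def infsum_nonneg)
  show ?thesis
  proof (rule ennreal_le_add_by_reals)
    show "0 \<le> penalty p W b"
      unfolding pen using weight0 form0 by simp
    fix a :: real assume a: "0 \<le> a" "ennreal (a + penalty p W b) \<le> window_mu W A z"
    define a' where "a' = a + penalty p W b"
    have a': "0 \<le> a'" using a \<open>0 \<le> penalty p W b\<close> by (simp add: a'_def)
    have low: "a' * l2norm x \<le> l2norm (minus_scalar A z x)" if "x \<in> l2 ((+) k ` W) UNIV" for k x
      using a(2) that unfolding a'_def[symmetric] window_mu_ge_iff[OF a'] by blast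
    have low': "a' * l2norm f \<le> l2norm (minus_scalar (adjoint_op A) z f)"
      if "f \<in> l2 ((+) k ` W) dual_space" for k f
      using a(2) that unfolding a'_def[symmetric] window_mu_ge_iff[OF a'] by blast
    let ?D = "difference_energy \<phi>"
    have E: "(\<Sum>\<^sub>\<infinity>j. supnorm (b (- j)) * sqrt (?D j)) = (\<Sum>\<^sub>\<infinity>j. supnorm (b j) * sqrt (?D j))"
      using summable_on_minus_iff(2)[of "\<lambda>j. supnorm (b j) * sqrt (?D j)"]
      by (simp add: difference_energy_minus)
    have "a * l2norm x \<le> l2norm (minus_scalar A z x)" if x: "x \<in> l2E" for x
    proof -
      have loc: "a' * l2norm x \<le> l2norm (minus_scalar A z x) + (\<Sum>\<^sub>\<infinity>j. supnorm (b j) * sqrt (?D j)) * l2norm x"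
        by (rule primal.localisation(1)[OF W(1) \<phi>(1,2) low a' x])
      have sm: "(\<lambda>j. supnorm (b j) * sqrt (?D j)) summable_on UNIV"
        by (rule primal.localisation(2)[OF W(1) \<phi>(1,2) low a' x])
      have "(\<Sum>\<^sub>\<infinity>j. supnorm (b j) * sqrt (?D j)) \<le> penalty p W b"
        unfolding pen by (rule coeff.commutator_bound[OF W(1) \<phi>(1) sm])
      then have "(\<Sum>\<^sub>\<infinity>j. supnorm (b j) * sqrt (?D j)) * l2norm x \<le> penalty p W b * l2norm x"
        by (intro mult_right_mono) simp_all
      then show ?thesis using loc by (simp add: a'_def distrib_right)
    qed
    moreover have "a * l2norm f \<le> l2norm (minus_scalar (adjoint_op A) z f)" if f: "f \<in> l2E'" for f
    proof -
      have loc: "a' * l2norm f \<le> l2norm (minus_scalar (adjoint_op A) z f)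
          + (\<Sum>\<^sub>\<infinity>j. supnorm (b (- j)) * sqrt (?D j)) * l2norm f"
        by (rule dual.localisation(1)[OF W(1) \<phi>(1,2) low' a' f])
      have "(\<lambda>j. supnorm (b (- j)) * sqrt (?D j)) summable_on UNIV"
        by (rule dual.localisation(2)[OF W(1) \<phi>(1,2) low' a' f])
      then have sm: "(\<lambda>j. supnorm (b j) * sqrt (?D j)) summable_on UNIV"
        using summable_on_minus_iff(1)[of "\<lambda>j. supnorm (b j) * sqrt (?D j)"]
        by (simp add: difference_energy_minus)
      have "(\<Sum>\<^sub>\<infinity>j. supnorm (b j) * sqrt (?D j)) \<le> penalty p W b"
        unfolding pen by (rule coeff.commutator_bound[OF W(1) \<phi>(1) sm])
      then have "(\<Sum>\<^sub>\<infinity>j. supnorm (b j) * sqrt (?D j)) * l2norm f \<le> penalty p W b * l2norm f"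
        by (intro mult_right_mono) simp_all
      then show ?thesis using loc unfolding E by (simp add: a'_def distrib_right)
    qed
    ultimately show "ennreal a \<le> mu (minus_scalar A z)" using mu_ge_iff[OF a(1)] by blast
  qed
qed

theorem corollary5p11:
  fixes p :: real
    and A :: "('g::{ab_group_add, countable} \<Rightarrow> 'y::complex_hilbert_space) \<Rightarrow> 'g \<Rightarrow> 'y"
    and b :: "'g \<Rightarrow> 'g \<Rightarrow> ('y \<Rightarrow>\<^sub>L 'y)"
    and W :: "nat \<Rightarrow> 'g set"
  assumes "0 \<le> p" and "p \<le> 1"
    and "A \<in> wiener_algebra p"
    and "wiener_representation A b"
    and "subexponential_growth (coeff_graph p b)"
    and "connected_graph (coeff_graph p b)"
    and "\<And>n. finite (W n)" and "\<And>n. W n \<noteq> {}"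
    and "\<And>n. W n \<subseteq> W (Suc n)"
    and "(\<Union>n. W n) = UNIV"
  shows "(\<forall>\<epsilon>>0.
      hausdorff_converges (\<lambda>n. gamma_open \<epsilon> (W n) A) (pseudospec_open \<epsilon> A)
    \<and> hausdorff_converges (\<lambda>n. gamma_open (\<epsilon> + penalty p (W n) b) (W n) A) (pseudospec_open \<epsilon> A)
    \<and> hausdorff_converges (\<lambda>n. Gamma_closed \<epsilon> (W n) A) (pseudospec_closed \<epsilon> A)
    \<and> hausdorff_converges (\<lambda>n. Gamma_closed (\<epsilon> + penalty p (W n) b) (W n) A) (pseudospec_closed \<epsilon> A))
   \<and> hausdorff_converges (\<lambda>n. Gamma_closed (penalty p (W n) b) (W n) A) (pseudospec_closed 0 A)
   \<and> pseudospec_closed 0 A = spectrum l2E A"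
proof -
  interpret wiener_operator A b by unfold_locales (rule assms(4))
  have "(\<lambda>j. supnorm (b j) powr p) summable_on UNIV"
    using assms(3) wiener_representation_unique[OF rep] by (auto simp: wiener_algebra_def)
  then have coeff: "decaying_coefficients (\<lambda>j. supnorm (b j)) p"
    by unfold_locales (use assms(1,2) supnorm_nonneg[OF b] supnorm_summable in auto)
  interpret coeff: decaying_coefficients "\<lambda>j. supnorm (b j)" p by (rule coeff)
  have graph: "coeff_graph p b = (\<lambda>k l. coeff.\<kappa> (k - l))"
    by (simp add: fun_eq_iff coeff_graph_def coeff.\<kappa>_def coeff.mean_def)
  define f where "f z = mu (minus_scalar A z)" for z
  define \<delta> where "\<delta> n = penalty p (W n) b" for n
  have \<delta>_lim: "\<delta> \<longlonglongrightarrow> 0"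
  proof -
    have "(\<lambda>n. sqrt (min_spec_dirichlet (coeff_graph p b) (W n))) \<longlonglongrightarrow> sqrt 0"
      unfolding graph by (intro tendsto_real_sqrt coeff.min_spec_dirichlet_tendsto_0 assms)
    from tendsto_mult_left[OF this] show ?thesis unfolding \<delta>_def penalty_def by simp
  qed
  have \<delta>_nonneg: "0 \<le> \<delta> n" for n
  proof -
    obtain \<phi> where \<phi>: "\<And>k. k \<notin> W n \<Longrightarrow> \<phi> k = 0" "(\<Sum>k\<in>W n. (\<phi> k)\<^sup>2) = 1"
      "\<And>x. coeff.form (W n) \<phi> * (\<Sum>k\<in>W n. (x k)\<^sup>2) \<le> coeff.form (W n) x"
      using coeff.exists_minimiser[OF assms(7,8)] by blast
    have "min_spec_dirichlet (\<lambda>k l. coeff.\<kappa> (k - l)) (W n) = coeff.form (W n) \<phi>"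
      by (rule coeff.min_spec_dirichlet_eq[OF assms(7) \<phi>])
    moreover have "0 \<le> coeff.form (W n) \<phi>" by (rule coeff.form_nonneg[OF assms(7) \<phi>(1)])
    ultimately show ?thesis
      unfolding \<delta>_def penalty_def graph by (simp add: infsum_nonneg)
  qed
  have lower: "f z \<le> window_mu (W n) A z" for n z unfolding f_def by (rule mu_le_window_mu)
  have upper: "window_mu (W n) A z \<le> f z + ennreal (\<delta> n)" for n z
    unfolding f_def \<delta>_def by (rule window_mu_le[OF coeff assms(7,8)])
  have sum_e: "ennreal (\<epsilon> + \<delta> n) = ennreal \<epsilon> + ennreal (\<delta> n)" if "0 \<le> \<epsilon>" for \<epsilon> n
    using that \<delta>_nonneg by simp
  note sandwich = hausdorff_converges_sandwich[OF mu_lipschitz bounded_mu_le _ \<delta>_lim \<delta>_nonneg, folded f_def]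
  \<comment> \<open>All four pairs for \<open>\<epsilon> > 0\<close> satisfy the same inclusions.\<close>
  have pos: "hausdorff_converges S T"
    if \<epsilon>: "0 < \<epsilon>" and S: "\<And>n. {z. f z + ennreal (\<delta> n) < ennreal \<epsilon>} \<subseteq> S n"
      "\<And>n. S n \<subseteq> {z. f z \<le> ennreal (\<epsilon> + \<delta> n)}"
      and T: "{z. f z < ennreal \<epsilon>} \<subseteq> T" "T \<subseteq> {z. f z \<le> ennreal \<epsilon>}" for \<epsilon> S T
  proof (rule sandwich[where e=\<epsilon> and U="\<lambda>n. {z. f z + ennreal (\<delta> n) < ennreal \<epsilon>}"])
    show "\<exists>z'. dist z z' < \<eta> \<and> (\<forall>\<^sub>F n in sequentially. z' \<in> {z. f z + ennreal (\<delta> n) < ennreal \<epsilon>})"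
      if z: "f z \<le> ennreal \<epsilon>" "0 < \<eta>" for z \<eta>
    proof -
      obtain z' where z': "dist z z' < \<eta>" "f z' < ennreal \<epsilon>"
      proof (cases "f z = ennreal \<epsilon>")
        case True
        then show ?thesis using mu_not_locally_minimal[OF \<epsilon> _ z(2)] that unfolding f_def by blast
      next
        case False
        then show ?thesis using that[of z] z by simp
      qed
      obtain r where r: "f z' = ennreal r" "0 \<le> r" "r < \<epsilon>"
        using z'(2) by (cases "f z'") (auto simp: ennreal_less_iff)
      have "\<forall>\<^sub>F n in sequentially. \<delta> n < \<epsilon> - r"
        using order_tendstoD(2)[OF \<delta>_lim, of "\<epsilon> - r"] r by simp
      then have "\<forall>\<^sub>F n in sequentially. f z' + ennreal (\<delta> n) < ennreal \<epsilon>"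
        by eventually_elim
          (use r \<delta>_nonneg in \<open>simp add: ennreal_plus[symmetric] ennreal_less_iff del: ennreal_plus\<close>)
      with z' show ?thesis by auto
    qed
    show "{z. f z + ennreal (\<delta> n) < ennreal \<epsilon>} \<subseteq> T" for n
    proof
      fix z assume z: "z \<in> {z. f z + ennreal (\<delta> n) < ennreal \<epsilon>}"
      have "f z \<le> f z + ennreal (\<delta> n)" by simp
      also have "\<dots> < ennreal \<epsilon>" using z by simp
      finally have "f z < ennreal \<epsilon>" .
      then show "z \<in> T" using T(1) by blast
    qed
  qed (use \<epsilon> S T in auto)
  \<comment> \<open>For \<open>\<epsilon> = 0\<close> the spectrum itself is contained in every approximating set.\<close>
  have zero: "hausdorff_converges (\<lambda>n. Gamma_closed (\<delta> n) (W n) A) (pseudospec_closed 0 A)"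
  proof (rule sandwich[where e=0 and U="\<lambda>n. pseudospec_closed 0 A"])
    show "pseudospec_closed 0 A \<subseteq> Gamma_closed (\<delta> n) (W n) A" for n
    proof
      fix z assume "z \<in> pseudospec_closed 0 A"
      then have "f z = 0" by (simp add: pseudospec_closed_def f_def)
      then show "z \<in> Gamma_closed (\<delta> n) (W n) A"
        using upper[of n z] by (simp add: Gamma_closed_def)
    qed
    show "Gamma_closed (\<delta> n) (W n) A \<subseteq> {z. f z \<le> ennreal (0 + \<delta> n)}" for n
      using lower[where n=n] by (auto simp: Gamma_closed_def intro: order_trans)
    show "\<exists>z'. dist z z' < \<eta> \<and> (\<forall>\<^sub>F n in sequentially. z' \<in> pseudospec_closed 0 A)"
      if "f z \<le> ennreal 0" "0 < \<eta>" for z \<eta>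
      using that by (intro exI[of _ z]) (simp add: pseudospec_closed_def f_def)
  qed (auto simp: pseudospec_closed_def f_def)
  have "pseudospec_closed 0 A = spectrum l2E A"
    by (auto simp: pseudospec_closed_def mu_zero_iff_spectrum)
  moreover have "hausdorff_converges (\<lambda>n. gamma_open \<epsilon> (W n) A) (pseudospec_open \<epsilon> A)"
    "hausdorff_converges (\<lambda>n. gamma_open (\<epsilon> + \<delta> n) (W n) A) (pseudospec_open \<epsilon> A)"
    "hausdorff_converges (\<lambda>n. Gamma_closed \<epsilon> (W n) A) (pseudospec_closed \<epsilon> A)"
    "hausdorff_converges (\<lambda>n. Gamma_closed (\<epsilon> + \<delta> n) (W n) A) (pseudospec_closed \<epsilon> A)"
    if \<epsilon>: "0 < \<epsilon>" for \<epsilon>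
  proof -
    have le: "ennreal \<epsilon> \<le> ennreal (\<epsilon> + \<delta> n)" for n using \<delta>_nonneg by (intro ennreal_leI) simp
    have U1: "window_mu (W n) A z < ennreal \<epsilon>" if "f z + ennreal (\<delta> n) < ennreal \<epsilon>" for n z
      using upper that by (rule order.strict_trans1)
    have U2: "window_mu (W n) A z < ennreal (\<epsilon> + \<delta> n)" if "f z + ennreal (\<delta> n) < ennreal \<epsilon>" for n z
      using U1[OF that] le by (rule order.strict_trans2)
    have L: "f z \<le> ennreal (\<epsilon> + \<delta> n)" if "window_mu (W n) A z \<le> ennreal (\<epsilon> + \<delta> n)" for n z
      using lower that by (rule order_trans)
    note defs = gamma_open_def Gamma_closed_def pseudospec_open_def pseudospec_closed_def f_def[symmetric]
    show "hausdorff_converges (\<lambda>n. gamma_open \<epsilon> (W n) A) (pseudospec_open \<epsilon> A)"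
      by (rule pos[OF \<epsilon>]) (auto simp: defs intro: U1 L order_trans[OF less_imp_le le])
    show "hausdorff_converges (\<lambda>n. gamma_open (\<epsilon> + \<delta> n) (W n) A) (pseudospec_open \<epsilon> A)"
      by (rule pos[OF \<epsilon>]) (auto simp: defs intro: U2 L)
    show "hausdorff_converges (\<lambda>n. Gamma_closed \<epsilon> (W n) A) (pseudospec_closed \<epsilon> A)"
      by (rule pos[OF \<epsilon>]) (auto simp: defs intro: less_imp_le[OF U1] L order_trans[OF _ le])
    show "hausdorff_converges (\<lambda>n. Gamma_closed (\<epsilon> + \<delta> n) (W n) A) (pseudospec_closed \<epsilon> A)"
      by (rule pos[OF \<epsilon>]) (auto simp: defs intro: less_imp_le[OF U2] L)
  qed
  ultimately show ?thesis using zero unfolding \<delta>_def by blast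
qed

end
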